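(* Let $q\in(0,1)$, $\alpha>0$, $k\in\mathbb{N}$, $k\ge 1$, and let $x_1\le x_2\le\cdots\le x_k$ be integers. Let $\omega$ be a random permutation of $\mathbb{Z}$ distributed according to the Mallows product measure $\mathcal{M}^p_\alpha$. For any fixed $i\in\mathbb{Z}$, the displacements $D_{i+j}=\omega(i+j)-(i+j)$, $j=1,\dots,k$, satisfy $$\mathbb{P}\left(D_{i+1}=x_1, D_{i+2}=x_2,\ldots,D_{i+k}=x_k\right)=\frac{(1-q)^k\,\alpha^k\, q^{\sum_{j=1}^k x_j-\frac{k^2}{2}}}{\prod_{j=1}^k\left(1+\alpha q^{x_j+2j-k-\frac32}\right)\left(1+\alpha q^{x_j+2j-k-\frac12}\right)}.$$
   Context: Fix $q\in(0,1)$. Let $\mathfrak{S}$ be the set of all bijections $\omega:\mathbb{Z}\to\mathbb{Z}$ with the $\sigma$-algebra generated by the coordinate maps $\omega\mapsto\omega(i)$. A probability measure $\mathbb{P}$ on $\mathfrak{S}$ is $q$-exchangeable if for every $i\in\mathbb{Z}$, every finite $I\subset\mathbb{Z}$ containing $i,i+1$, and all distinct integers $(y_j)_{j\in I}$: with $y'$ obtained from $y$ by swapping $y_i$ and $y_{i+1}$, one has $\mathbb{P}(\omega(j)=y'_j\ \forall j\in I)=q^{\mathrm{sign}(y_{i+1}-y_i)}\,\mathbb{P}(\omega(j)=y_j\ \forall j\in I)$. A permutation $\sigma\in\mathfrak{S}$ is balanced if $\#\{j>0:\sigma(j)\le 0\}=\#\{j\le 0:\sigma(j)>0\}<\infty$.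 By a theorem of Gnedin and Olshanski there is a unique $q$-exchangeable probability measure on $\mathfrak{S}$ supported on balanced permutations; it is denoted $\mathcal{M}_0$. For $c\in\mathbb{Z}$, $\mathcal{M}_c$ is the law of the permutation $i\mapsto\sigma(i)+c$, where $\sigma\sim\mathcal{M}_0$. With $(q;q)_\infty=\prod_{k\ge1}(1-q^k)$, the Mallows product measure with parameter $\alpha>0$ is $$\mathcal{M}^p_\alpha=\sum_{c\in\mathbb{Z}}\frac{\alpha^c q^{c^2/2}}{(q;q)_\infty\prod_{k=0}^\infty(1+\alpha q^{k+1/2})\prod_{k=0}^\infty(1+\alpha^{-1}q^{k+1/2})}\,\mathcal{M}_c$$ (the coefficients sum to $1$ by the Jacobi triple product identity). *)

theory Defs
  imports "HOL-Probability.Probability"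
begin

text \<open>
  The space of all bijections of the integers. Restricting the product of the discrete
  sigma-algebras gives exactly the sigma-algebra generated by the coordinate maps.
\<close>

definition perm_space :: "(int \<Rightarrow> int) measure" where
  "perm_space = restrict_space (\<Pi>\<^sub>M i\<in>UNIV. count_space UNIV) {\<omega>. bij \<omega>}"

definition q_exchangeable :: "real \<Rightarrow> (int \<Rightarrow> int) measure \<Rightarrow> bool" where
  "q_exchangeable q M \<longleftrightarrow>
     (\<forall>i I y. finite I \<and> i \<in> I \<and> i + 1 \<in> I \<and> inj_on y I \<longrightarrow>
        \<P>(\<omega> in M. \<forall>j\<in>I. \<omega> j = (y(i := y (i + 1), i + 1 := y i)) j) =
        q powi sgn (y (i + 1) - y i) * \<P>(\<omega> in M. \<forall>j\<in>I. \<omega> j = y j))"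

definition balanced :: "(int \<Rightarrow> int) \<Rightarrow> bool" where
  "balanced \<sigma> \<longleftrightarrow>
     finite {j. j > 0 \<and> \<sigma> j \<le> 0} \<and> finite {j. j \<le> 0 \<and> \<sigma> j > 0} \<and>
     card {j. j > 0 \<and> \<sigma> j \<le> 0} = card {j. j \<le> 0 \<and> \<sigma> j > 0}"

text \<open>
  For \<open>0 < q < 1\<close> the description is definite by a theorem of Gnedin and Olshanski;
  for other values of \<open>q\<close> the definition carries no meaning.
\<close>

definition mallows_balanced :: "real \<Rightarrow> (int \<Rightarrow> int) measure" where
  "mallows_balanced q =
     (THE M. prob_space M \<and> sets M = sets perm_space \<and>
             q_exchangeable q M \<and> (AE \<sigma> in M. balanced \<sigma>))"

definition mallows_shift :: "real \<Rightarrow> int \<Rightarrow> (int \<Rightarrow> int) measure" where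
  "mallows_shift q c = distr (mallows_balanced q) perm_space (\<lambda>\<sigma> i. \<sigma> i + c)"

definition mallows_weight :: "real \<Rightarrow> real \<Rightarrow> int \<Rightarrow> real" where
  "mallows_weight q \<alpha> c =
     \<alpha> powi c * q powr ((of_int c)\<^sup>2 / 2) /
     ((\<Prod>k. 1 - q ^ Suc k) *
      (\<Prod>k. 1 + \<alpha> * q powr (real k + 1 / 2)) *
      (\<Prod>k. 1 + inverse \<alpha> * q powr (real k + 1 / 2)))"

text \<open>The integral against the counting measure is the sum over all integers \<open>c\<close>.\<close>

definition mallows_product :: "real \<Rightarrow> real \<Rightarrow> (int \<Rightarrow> int) measure" where
  "mallows_product q \<alpha> =
     measure_of (space perm_space) (sets perm_space)
       (\<lambda>A. \<integral>\<^sup>+c. ennreal (mallows_weight q \<alpha> c) * emeasure (mallows_shift q c) A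
              \<partial>count_space UNIV)"

definition displacement :: "(int \<Rightarrow> int) \<Rightarrow> int \<Rightarrow> int" where
  "displacement \<omega> j = \<omega> j - j"

end

theory Submission
  imports Defs
begin

text \<open>
  The statement is about the unique balanced \<open>q\<close>-exchangeable law, so the proof has to build this
  law, to show that no other exists, and then to compute with it. The key is to look at a permutation
  \<open>\<omega>\<close> through the cut between \<open>0\<close> and \<open>1\<close>, that is, through the set \<open>A = \<omega> ` {..0}\<close>. For a balanced
  \<open>\<omega>\<close> this is a Maya diagram: a set of integers that contains all sufficiently small integers and no
  sufficiently large ones. It has a charge, which vanishes exactly when \<open>\<omega>\<close> is balanced, and an
  energy, the analogue of the size of a partition.

  \<^emph>\<open>Existence.\<close> Draw \<open>A\<close> with charge \<open>0\<close> and probability proportional to \<open>q ^ energy A\<close>. Given \<open>A\<close>,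
  let \<open>\<omega> 1, \<omega> 2, \<dots>\<close> be drawn one after the other without replacement from the complement of \<open>A\<close>, a
  value being chosen with probability \<open>(1 - q) * q ^ r\<close> if it has exactly \<open>r\<close> smaller rivals, and let
  \<open>\<omega> 0, \<omega> (-1), \<dots>\<close> be drawn from \<open>A\<close> in the same way with the order reversed. Geometric
  variables vanish infinitely often, so every value is used and \<open>\<omega>\<close> is a bijection. Detailed balance
  (\<open>detailed_balance\<close>) says that the weight of a diagram times the probability of a draw to the left
  agrees with the corresponding product for the reversed draw to the right, up to a constant that
  depends only on the charge. So the cut can be moved to the left of any finite window; all values
  in the window are then drawn from the left to the right, and exchanging two neighbours changes the two relevant factors by \<open>q\<close> or \<open>1 / q\<close>
  (\<open>kern_swap\<close>). This is \<open>q\<close>-exchangeability.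

  \<^emph>\<open>Uniqueness.\<close> Under any \<open>q\<close>-exchangeable law the probability of an arrangement of a given set of
  values on \<open>{1-n..n}\<close> is the probability of the increasing arrangement times a factor that depends
  only on the pattern (\<open>arrangement_ratio\<close>). For a balanced permutation and large \<open>n\<close>, the set of
  values on \<open>{1-n..n}\<close> is order isomorphic to \<open>{1-n..n}\<close> by a map that fixes every element of a
  prescribed finite set. Hence the conditional probability of a fixed cylinder is a number that
  depends on \<open>n\<close> only, and the probability of the cylinder is the limit of these numbers (\<open>cylinder_probability_determined\<close>).
  Uniqueness also gives, without computation, that the displacements are stationary: conjugating by
  the shift preserves balance and exchangeability. So one may take \<open>i = 0\<close>.

  \<^emph>\<open>Computation.\<close> Mixing over \<open>c\<close> with the given weights turns the sum over diagrams of
  charge \<open>0\<close> into a sum over all diagrams, and the weight of \<open>A\<close> becomes a product over its elements: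
  under the product measure the events \<open>m \<in> A\<close> are independent with odds \<open>\<alpha> * q powr (m - 1/2)\<close>. For
  an increasing sequence of values the transition probability is a product over integers as well
  (\<open>kern_increasing\<close>); here it matters that \<open>x\<close> is monotone. Therefore the expectation is a ratio
  of products, which telescopes (\<open>telescoping_product\<close>) and leaves two factors for each value. The
  normalisation of the balanced law is the Euler product, by the \<open>q\<close>-binomial formula for
  diagrams in a finite window.
\<close>

section \<open>Maya diagrams\<close>

text \<open>
  The states of the process that a permutation of the integers makes when the cut between two
  neighbouring places moves: \<open>A\<close> is the set of values to the left of the cut.
\<close>

definition maya :: "int set \<Rightarrow> bool" where
  "maya A \<longleftrightarrow> (\<exists>L. {..L} \<subseteq> A) \<and> (\<exists>U. A \<subseteq> {..U})"

definition charge :: "int set \<Rightarrow> int" where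
  "charge A = int (card (A \<inter> {0<..})) - int (card ({..0} - A))"

text \<open>
  Measured from \<open>0\<close> and not from the cut at \<open>1/2\<close>. The two versions differ by half the charge, and this
  one keeps the exponents of \<open>q\<close> natural numbers.
\<close>

definition energy :: "int set \<Rightarrow> nat" where
  "energy A = (\<Sum>m\<in>A \<inter> {0<..}. nat m) + (\<Sum>m\<in>{..0} - A. nat (- m))"

lemma maya_finite_above: "maya A \<Longrightarrow> finite (A \<inter> {L<..})"
  unfolding maya_def by (meson finite_greaterThanAtMost_int finite_subset Int_lower1 subsetI
      IntE atMost_iff greaterThanAtMost_iff greaterThan_iff subsetD)

lemma above_cut_below:
  assumes "maya A" "L \<in> A"
  shows "card (A \<inter> {L - 1<..}) = Suc (card (A \<inter> {L<..}))"
    and "\<Sum>(A \<inter> {L - 1<..}) = L + \<Sum>(A \<inter> {L<..})"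
proof -
  have "A \<inter> {L - 1<..} = insert L (A \<inter> {L<..})" using assms by auto
  then show "card (A \<inter> {L - 1<..}) = Suc (card (A \<inter> {L<..}))"
    and "\<Sum>(A \<inter> {L - 1<..}) = L + \<Sum>(A \<inter> {L<..})"
    using maya_finite_above[OF assms(1), of L] by simp_all
qed

text \<open>
  Lowering the reference level \<open>L\<close> by one adds the value \<open>L\<close> to the part above it; the correction terms
  \<open>L\<close> and \<open>L * (L + 1)\<close> absorb precisely this.
\<close>

lemma cut_invariance:
  assumes "maya A" "{..L} \<subseteq> A" "L' \<le> L"
  shows "int (card (A \<inter> {L'<..})) + L' = int (card (A \<inter> {L<..})) + L"
    and "2 * \<Sum>(A \<inter> {L'<..}) + L' * (L' + 1) = 2 * \<Sum>(A \<inter> {L<..}) + L * (L + 1)"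
proof -
  have "int (card (A \<inter> {L'<..})) + L' = int (card (A \<inter> {L<..})) + L \<and>
    2 * \<Sum>(A \<inter> {L'<..}) + L' * (L' + 1) = 2 * \<Sum>(A \<inter> {L<..}) + L * (L + 1)"
    using assms(3)
  proof (induction L' rule: int_le_induct)
    case base
    then show ?case by simp
  next
    case (step l)
    then have "l \<in> A" using assms(2) by auto
    from above_cut_below[OF assms(1) this] step show ?case by (auto simp: algebra_simps)
  qed
  then show "int (card (A \<inter> {L'<..})) + L' = int (card (A \<inter> {L<..})) + L"
    and "2 * \<Sum>(A \<inter> {L'<..}) + L' * (L' + 1) = 2 * \<Sum>(A \<inter> {L<..}) + L * (L + 1)" by auto
qed

lemma double_sum_nonpos_window:
  fixes L :: int
  assumes "L \<le> 0"
  shows "2 * \<Sum>{L<..0} = - L * (L + 1)"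
  using assms
proof (induction L rule: int_le_induct)
  case (step l)
  have "{l - 1<..0} = insert l {l<..0}" using step by auto
  then show ?case using step by (simp add: algebra_simps)
qed simp

text \<open>
  Charge and energy relative to an arbitrary level below which \<open>A\<close> is full. There are no holes any
  more in this description, so inserting an element or shifting the diagram becomes a computation with
  one finite set.
\<close>

lemma charge_energy_cut:
  assumes A: "maya A" and L: "{..L} \<subseteq> A"
  shows "charge A = int (card (A \<inter> {L<..})) + L"
    and "2 * int (energy A) = 2 * \<Sum>(A \<inter> {L<..}) + L * (L + 1)"
proof -
  define l where "l = min L 0"
  have l: "l \<le> L" "l \<le> 0" by (auto simp: l_def)
  have la: "{..l} \<subseteq> A" using L l by auto
  have fin1: "finite (A \<inter> {0<..})" by (rule maya_finite_above[OF A])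
  have fin2: "finite ({..0} - A)"
    by (rule finite_subset[of _ "{l<..0}"]) (use la in \<open>auto simp: subset_iff not_le[symmetric]\<close>)
  have split: "A \<inter> {l<..} = (A \<inter> {0<..}) \<union> ({l<..0} - ({..0} - A))" using l by auto
  have sub: "{..0} - A \<subseteq> {l<..0}" using la by (auto simp: subset_iff not_le[symmetric])
  have "card (A \<inter> {l<..}) = card (A \<inter> {0<..}) + (card {l<..0} - card ({..0} - A))"
    unfolding split using fin1 fin2 sub
    by (subst card_Un_disjoint) (auto simp: card_Diff_subset)
  moreover have "card ({..0} - A) \<le> card {l<..0}" using sub by (intro card_mono) auto
  ultimately have "charge A = int (card (A \<inter> {l<..})) + l"
    using l by (simp add: charge_def)
  then show "charge A = int (card (A \<inter> {L<..})) + L"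
    using cut_invariance(1)[OF A L l(1)] by simp
  have "\<Sum>(A \<inter> {l<..}) = \<Sum>(A \<inter> {0<..}) + (\<Sum>{l<..0} - \<Sum>({..0} - A))"
    unfolding split using fin1 fin2 sub
    by (subst sum.union_disjoint) (auto simp: sum_diff)
  moreover have "int (energy A) = \<Sum>(A \<inter> {0<..}) - \<Sum>({..0} - A)"
    unfolding energy_def of_nat_add of_nat_sum by (simp add: sum_negf[symmetric])
  ultimately have "2 * int (energy A) = 2 * \<Sum>(A \<inter> {l<..}) + l * (l + 1)"
    using double_sum_nonpos_window[OF l(2)] by simp
  then show "2 * int (energy A) = 2 * \<Sum>(A \<inter> {L<..}) + L * (L + 1)"
    using cut_invariance(2)[OF A L l(1)] by simp
qed

lemma maya_insert [simp]: "maya A \<Longrightarrow> maya (insert y A)"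
proof -
  assume "maya A"
  then obtain L U where "{..L} \<subseteq> A" "A \<subseteq> {..U}" by (auto simp: maya_def)
  then have "{..L} \<subseteq> insert y A" "insert y A \<subseteq> {..max y U}" by auto
  then show ?thesis unfolding maya_def by blast
qed

lemma maya_remove [simp]: "maya A \<Longrightarrow> maya (A - {y})"
proof -
  assume "maya A"
  then obtain L U where "{..L} \<subseteq> A" "A \<subseteq> {..U}" by (auto simp: maya_def)
  then have "{..min L (y - 1)} \<subseteq> A - {y}" "A - {y} \<subseteq> {..U}" by auto
  then show ?thesis unfolding maya_def by blast
qed

lemma charge_energy_insert:
  assumes "maya A" "y \<notin> A"
  shows "charge (insert y A) = charge A + 1"
    and "int (energy (insert y A)) = int (energy A) + y"
proof -
  obtain L where L: "{..L} \<subseteq> A" using assms by (auto simp: maya_def)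
  then have "y > L" using assms by (meson atMost_iff not_le subsetD)
  have eq: "insert y A \<inter> {L<..} = insert y (A \<inter> {L<..})" using \<open>y > L\<close> by auto
  have L': "{..L} \<subseteq> insert y A" using L by auto
  note f = maya_finite_above[OF assms(1), of L]
  show "charge (insert y A) = charge A + 1"
    using charge_energy_cut(1)[OF assms(1) L]
      charge_energy_cut(1)[OF maya_insert[OF assms(1)] L'] f assms(2)
    by (simp add: eq)
  show "int (energy (insert y A)) = int (energy A) + y"
    using charge_energy_cut(2)[OF assms(1) L]
      charge_energy_cut(2)[OF maya_insert[OF assms(1)] L'] f assms(2)
    by (simp add: eq)
qed

lemma atMost_shift_subset: "{..L} \<subseteq> A \<Longrightarrow> {..L + c} \<subseteq> (+) c ` A" for c :: int
proof
  fix x assume "{..L} \<subseteq> A" "x \<in> {..L + c}"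
  then have "x - c \<in> A" by auto
  then show "x \<in> (+) c ` A" by (rule rev_image_eqI) simp
qed

lemma maya_shift: "maya A \<Longrightarrow> maya ((+) c ` A)"
proof -
  assume "maya A"
  then obtain L U where "{..L} \<subseteq> A" "A \<subseteq> {..U}" by (auto simp: maya_def)
  then have "{..L + c} \<subseteq> (+) c ` A" "(+) c ` A \<subseteq> {..U + c}"
    using atMost_shift_subset by auto
  then show ?thesis unfolding maya_def by blast
qed

lemma charge_energy_shift:
  assumes "maya A"
  shows "charge ((+) c ` A) = charge A + c"
    and "2 * int (energy ((+) c ` A)) = 2 * int (energy A) + 2 * c * charge A + c * (c + 1)"
proof -
  obtain L where L: "{..L} \<subseteq> A" using assms by (auto simp: maya_def)
  have L': "{..L + c} \<subseteq> (+) c ` A"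
    using L by (rule atMost_shift_subset)
  have eq: "(+) c ` A \<inter> {L + c<..} = (+) c ` (A \<inter> {L<..})" by auto
  note f = maya_finite_above[OF assms, of L]
  have s: "\<Sum>((+) c ` (A \<inter> {L<..})) = c * int (card (A \<inter> {L<..})) + \<Sum>(A \<inter> {L<..})"
    using f by (subst sum.reindex) (auto simp: sum.distrib)
  show "charge ((+) c ` A) = charge A + c"
    using charge_energy_cut(1)[OF assms L] charge_energy_cut(1)[OF maya_shift[OF assms] L']
    by (simp add: eq card_image)
  show "2 * int (energy ((+) c ` A)) = 2 * int (energy A) + 2 * c * charge A + c * (c + 1)"
    unfolding charge_energy_cut(2)[OF maya_shift[OF assms] L']
      charge_energy_cut(2)[OF assms L] charge_energy_cut(1)[OF assms L] eq s
    by (simp add: algebra_simps)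
qed

definition rank_in :: "int set \<Rightarrow> int \<Rightarrow> nat" where
  "rank_in C y = card {m\<in>C. m < y}"

text \<open>
  The holes below \<open>y\<close> are the possible rivals of \<open>y\<close> when values are drawn from the complement, and the
  particles above \<open>y\<close> are its rivals when values are drawn from \<open>A\<close> in descending order. Counting
  both from a deep level shows that their difference is determined by \<open>y\<close> and the charge alone. This
  is what makes detailed balance work.
\<close>

lemma holes_minus_particles:
  assumes A: "maya A" and y: "y \<notin> A"
  shows "int (rank_in (- A) y) = int (rank_in (uminus ` A) (- y)) + y - 1 - charge A"
proof -
  obtain L where L: "{..L} \<subseteq> A" using A by (auto simp: maya_def)
  then have "y > L" using y by (meson atMost_iff not_le subsetD)
  note f = maya_finite_above[OF A]
  have 1: "{m \<in> - A. m < y} = {L<..<y} - A \<inter> {L<..<y}"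
    using L by (auto simp: subset_iff not_le[symmetric])
  have 2: "{m \<in> uminus ` A. m < - y} = uminus ` (A \<inter> {y<..})" by auto
  have 3: "A \<inter> {L<..} = A \<inter> {L<..<y} \<union> A \<inter> {y<..}" using \<open>y > L\<close> y
    by auto (metis linorder_neqE)
  have "card {m \<in> - A. m < y} = card {L<..<y} - card (A \<inter> {L<..<y})"
    unfolding 1 by (rule card_Diff_subset) auto
  moreover have "card (A \<inter> {L<..<y}) \<le> card {L<..<y}" by (intro card_mono) auto
  moreover have "card {m \<in> uminus ` A. m < - y} = card (A \<inter> {y<..})"
    unfolding 2 by (rule card_image) auto
  moreover have "card (A \<inter> {L<..}) = card (A \<inter> {L<..<y}) + card (A \<inter> {y<..})"
    unfolding 3 using f by (intro card_Un_disjoint) auto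
  ultimately show ?thesis using charge_energy_cut(1)[OF A L] \<open>y > L\<close>
    by (simp add: rank_in_def)
qed

text \<open>
  Diagrams that differ from the vacuum only inside \<open>{-n<..n}\<close>. They exhaust all Maya diagrams, so sums
  over diagrams become limits of finite sums.
\<close>

definition window :: "nat \<Rightarrow> int set set" where
  "window n = {A. {..- int n} \<subseteq> A \<and> A \<subseteq> {..int n}}"

lemma window_eq_image: "window n = (\<lambda>S. {..- int n} \<union> S) ` Pow {- int n<..int n}"
proof (intro equalityI subsetI)
  fix A assume "A \<in> window n"
  then have "A = {..- int n} \<union> (A \<inter> {- int n<..int n})"
    "A \<inter> {- int n<..int n} \<in> Pow {- int n<..int n}"
    by (auto simp: window_def)
  then show "A \<in> (\<lambda>S. {..- int n} \<union> S) ` Pow {- int n<..int n}" by blast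
qed (auto simp: window_def)

lemma inj_on_window: "inj_on (\<lambda>S. {..- int n} \<union> S) (Pow {- int n<..int n})"
proof (rule inj_onI)
  fix S T
  assume ST: "S \<in> Pow {- int n<..int n}" "T \<in> Pow {- int n<..int n}"
    and eq: "{..- int n} \<union> S = {..- int n} \<union> T"
  have "S = ({..- int n} \<union> S) \<inter> {- int n<..}" using ST(1) by auto
  also have "\<dots> = ({..- int n} \<union> T) \<inter> {- int n<..}" by (simp only: eq)
  also have "\<dots> = T" using ST(2) by auto
  finally show "S = T" .
qed

lemma finite_window: "finite (window n)"
  by (simp add: window_eq_image)

lemma window_mono: "m \<le> n \<Longrightarrow> window m \<subseteq> window n"
  by (auto simp: window_def subset_iff)

lemma window_maya: "A \<in> window n \<Longrightarrow> maya A"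
  by (auto simp: window_def maya_def)

lemma maya_imp_window: "maya A \<Longrightarrow> \<exists>n. A \<in> window n"
proof -
  assume "maya A"
  then obtain L U where "{..L} \<subseteq> A" "A \<subseteq> {..U}" by (auto simp: maya_def)
  then have "A \<in> window (nat (max (- L) U))" by (auto simp: window_def subset_iff)
  then show ?thesis ..
qed

lemma Union_window: "(\<Union>n. window n) = {A. maya A}"
  using window_maya maya_imp_window by blast

lemma countable_maya: "countable {A. maya A}"
  unfolding Union_window[symmetric] by (auto intro: countable_finite finite_window)

lemma charge_energy_window:
  assumes "S \<subseteq> {- int n<..int n}"
  shows "charge ({..- int n} \<union> S) = int (card S) - int n"
    and "2 * int (energy ({..- int n} \<union> S)) = 2 * \<Sum>S + int n * (int n - 1)"
proof -
  have m: "maya ({..- int n} \<union> S)"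
    using assms window_eq_image[of n] by (intro window_maya[of _ n]) auto
  have eq: "({..- int n} \<union> S) \<inter> {- int n<..} = S" using assms by auto
  show "charge ({..- int n} \<union> S) = int (card S) - int n"
    using charge_energy_cut(1)[OF m, of "- int n"] by (simp add: eq)
  show "2 * int (energy ({..- int n} \<union> S)) = 2 * \<Sum>S + int n * (int n - 1)"
    using charge_energy_cut(2)[OF m, of "- int n"] by (simp add: eq algebra_simps)
qed

lemma nn_integral_maya_LIMSEQ:
  fixes f :: "int set \<Rightarrow> ennreal"
  shows "(\<lambda>n. \<Sum>A\<in>window n. f A) \<longlonglongrightarrow> (\<integral>\<^sup>+A\<in>{A. maya A}. f A \<partial>count_space UNIV)"
proof -
  have mono: "A \<in> window n \<Longrightarrow> A \<in> window (Suc n)" for A n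
    using window_mono[of n "Suc n"] by auto
  have "(\<lambda>n. \<integral>\<^sup>+A\<in>window n. f A \<partial>count_space UNIV)
      \<longlonglongrightarrow> (SUP n. \<integral>\<^sup>+A\<in>window n. f A \<partial>count_space UNIV)"
    by (intro LIMSEQ_SUP incseq_SucI nn_integral_mono)
       (auto split: split_indicator dest: mono)
  also have "(SUP n. \<integral>\<^sup>+A\<in>window n. f A \<partial>count_space UNIV) =
      (\<integral>\<^sup>+A. (SUP n. f A * indicator (window n) A) \<partial>count_space UNIV)"
  proof (rule nn_integral_monotone_convergence_SUP[symmetric])
    show "incseq (\<lambda>n A. f A * indicator (window n) A)"
      by (auto intro!: incseq_SucI le_funI split: split_indicator dest: mono)
  qed auto
  also have "(\<lambda>A. SUP n. f A * indicator (window n) A) = (\<lambda>A. f A * indicator {A. maya A} A)"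
  proof
    fix A
    have "(SUP n. indicator (window n) A :: ennreal) = indicator (\<Union>n. window n) A"
    proof (intro antisym SUP_least)
      show "indicator (\<Union>n. window n) A \<le> (SUP n. indicator (window n) A :: ennreal)"
        by (auto split: split_indicator intro!: SUP_upper2)
    qed (auto split: split_indicator)
    then show "(SUP n. f A * indicator (window n) A) = f A * indicator {A. maya A} A"
      by (simp add: SUP_mult_left_ennreal[symmetric] Union_window)
  qed
  finally show ?thesis
    by (simp add: nn_integral_count_space_indicator[symmetric] nn_integral_count_space_finite
        finite_window)
qed

section \<open>Drawing without replacement from a half-infinite set\<close>

text \<open>
  The sets of order type \<open>\<omega>\<close>: exactly there every natural number is the rank of one element. The
  complement of a Maya diagram is one, and so is the reflection of the diagram itself.
\<close>

definition ray :: "int set \<Rightarrow> bool" where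
  "ray C \<longleftrightarrow> infinite C \<and> (\<forall>y. finite {m\<in>C. m < y})"

lemma ray_Diff_finite:
  assumes "ray C" "finite F"
  shows "ray (C - F)"
proof -
  have "finite {m \<in> C - F. m < y}" for y
    by (rule finite_subset[of _ "{m\<in>C. m < y}"]) (use assms in \<open>auto simp: ray_def\<close>)
  then show ?thesis using assms by (simp add: ray_def)
qed

lemma ray_remove: "ray C \<Longrightarrow> ray (C - {y})"
  using ray_Diff_finite[of C "{y}"] by simp

lemma ray_complement_maya: "maya A \<Longrightarrow> ray (- A)"
proof -
  assume "maya A"
  then obtain L U where *: "{..L} \<subseteq> A" "A \<subseteq> {..U}" by (auto simp: maya_def)
  have "{U<..} \<subseteq> - A" using * by auto
  then have "infinite (- A)" using infinite_super infinite_Ioi by blast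
  moreover have "{m\<in>- A. m < y} \<subseteq> {L<..<y}" for y
    using * by (auto simp: subset_iff not_le[symmetric])
  ultimately show ?thesis unfolding ray_def using finite_subset by blast
qed

lemma ray_uminus_maya: "maya A \<Longrightarrow> ray (uminus ` A)"
proof -
  assume "maya A"
  then obtain L U where *: "{..L} \<subseteq> A" "A \<subseteq> {..U}" by (auto simp: maya_def)
  have "infinite A" using *(1) infinite_super infinite_Iic by blast
  then have "infinite (uminus ` A)" by (simp add: finite_image_iff)
  moreover have "{m\<in>uminus ` A. m < y} \<subseteq> {- U..<y}" for y using * by auto
  ultimately show ?thesis unfolding ray_def using finite_subset by blast
qed

lemma rank_strict_mono:
  assumes "ray C" "x \<in> C" "x < y"
  shows "rank_in C x < rank_in C y"
  unfolding rank_in_def using assms by (intro psubset_card_mono) (auto simp: ray_def)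

lemma ray_least:
  assumes C: "ray C" and D: "D \<subseteq> C" "D \<noteq> {}"
  shows "\<exists>y\<in>D. \<forall>x\<in>D. y \<le> x"
proof -
  obtain c where c: "c \<in> D" using D by blast
  define F where "F = {m\<in>D. m < c + 1}"
  have "F \<subseteq> {m\<in>C. m < c + 1}" using D by (auto simp: F_def)
  then have fin: "finite F" using C finite_subset unfolding ray_def by blast
  have "c \<in> F" using c by (simp add: F_def)
  then have "Min F \<in> F" using fin by (intro Min_in) auto
  moreover have "Min F \<le> x" if "x \<in> D" for x
  proof (cases "x \<in> F")
    case True
    then show ?thesis using fin by simp
  next
    case False
    then have "c < x" using that by (auto simp: F_def)
    then show ?thesis using Min_le[OF fin \<open>c \<in> F\<close>] by simp
  qed
  ultimately show ?thesis by (auto simp: F_def)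
qed

lemma bij_betw_rank:
  assumes C: "ray C"
  shows "bij_betw (rank_in C) C UNIV"
proof (rule bij_betwI')
  fix x y assume "x \<in> C" "y \<in> C"
  then show "(rank_in C x = rank_in C y) = (x = y)"
    using rank_strict_mono[OF C, of x y] rank_strict_mono[OF C, of y x]
    by (cases x y rule: linorder_cases) auto
next
  fix n :: nat
  show "\<exists>y\<in>C. n = rank_in C y"
  proof (induction n)
    case 0
    have "C \<noteq> {}" using C unfolding ray_def by auto
    then obtain y where y: "y \<in> C" "\<And>x. x \<in> C \<Longrightarrow> y \<le> x"
      using ray_least[OF C order.refl] by blast
    then have "{m\<in>C. m < y} = {}" by (auto simp: not_less)
    then show ?case using y(1) unfolding rank_in_def by (metis card.empty)
  next
    case (Suc n)
    then obtain y where y: "y \<in> C" "n = rank_in C y" by blast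
    have "{m\<in>C. y < m} \<noteq> {}"
    proof
      assume "{m\<in>C. y < m} = {}"
      then have "C = {m\<in>C. m < y + 1}" by auto
      then show False using C unfolding ray_def by metis
    qed
    then obtain y' where y': "y' \<in> C" "y < y'" "\<And>x. x \<in> C \<Longrightarrow> y < x \<Longrightarrow> y' \<le> x"
      using ray_least[OF C, of "{m\<in>C. y < m}"] by blast
    have "{m\<in>C. m < y'} = insert y {m\<in>C. m < y}"
    proof (intro equalityI subsetI)
      fix x assume x: "x \<in> {m\<in>C. m < y'}"
      then have "\<not> y < x" using y'(3)[of x] by auto
      then show "x \<in> insert y {m\<in>C. m < y}" using x by auto
    qed (use y y' in auto)
    then have "rank_in C y' = Suc n" using y C by (simp add: rank_in_def ray_def)
    then show ?case using y'(1) by (intro bexI[of _ y']) simp_all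
  qed
qed simp

definition pick :: "int set \<Rightarrow> nat \<Rightarrow> int" where
  "pick C = inv_into C (rank_in C)"

lemma pick_in: "ray C \<Longrightarrow> pick C r \<in> C"
  using bij_betw_rank[of C] unfolding pick_def bij_betw_def by (metis UNIV_I inv_into_into)

lemma rank_pick: "ray C \<Longrightarrow> rank_in C (pick C r) = r"
  using bij_betw_rank[of C] unfolding pick_def bij_betw_def by (metis UNIV_I f_inv_into_f)

lemma pick_eq_iff: "ray C \<Longrightarrow> pick C r = y \<longleftrightarrow> y \<in> C \<and> r = rank_in C y"
  using bij_betw_rank[of C] pick_in[of C r] rank_pick[of C r]
  unfolding bij_betw_def inj_on_def by metis

lemma pick_0_le: "ray C \<Longrightarrow> y \<in> C \<Longrightarrow> pick C 0 \<le> y"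
  using rank_strict_mono[of C y "pick C 0"] rank_pick[of C 0] by (metis not_le not_less_zero)

text \<open>
  Drawing without replacement, driven by a sequence \<open>g\<close> of ranks: the next value is the one with rank
  \<open>g n\<close> among those that remain.
\<close>

primrec rest :: "int set \<Rightarrow> (nat \<Rightarrow> nat) \<Rightarrow> nat \<Rightarrow> int set" where
  "rest C g 0 = C"
| "rest C g (Suc n) = rest C g n - {pick (rest C g n) (g n)}"

definition sel :: "int set \<Rightarrow> (nat \<Rightarrow> nat) \<Rightarrow> nat \<Rightarrow> int" where
  "sel C g n = pick (rest C g n) (g n)"

lemma rest_eq: "rest C g n = C - sel C g ` {..<n}"
  by (induction n) (auto simp: sel_def lessThan_Suc)

lemma ray_rest: "ray C \<Longrightarrow> ray (rest C g n)"
  by (induction n) (auto intro: ray_remove)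

lemma sel_in_rest: "ray C \<Longrightarrow> sel C g n \<in> rest C g n"
  unfolding sel_def by (intro pick_in ray_rest)

lemma inj_sel: "ray C \<Longrightarrow> inj (sel C g)"
proof (rule linorder_injI)
  fix m n :: nat
  assume "ray C" "m < n"
  then show "sel C g m \<noteq> sel C g n" using sel_in_rest[of C g n] unfolding rest_eq
    by (metis DiffD2 imageI lessThan_iff)
qed

lemma sel_in: "ray C \<Longrightarrow> sel C g n \<in> C"
  using sel_in_rest[of C g n] by (simp add: rest_eq)

text \<open>
  A value \<open>y\<close> that is never drawn would be overtaken at each of the infinitely many times at which the
  rank is \<open>0\<close>, each time by a different smaller value. There are only finitely many of these.
\<close>

lemma bij_betw_sel:
  assumes C: "ray C" and io: "\<And>N. \<exists>n\<ge>N. g n = 0"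
  shows "bij_betw (sel C g) UNIV C"
proof -
  have "y \<in> range (sel C g)" if y: "y \<in> C" for y
  proof (rule ccontr)
    assume ny: "y \<notin> range (sel C g)"
    define Z where "Z = {n. g n = 0}"
    have "infinite Z" unfolding Z_def infinite_nat_iff_unbounded_le using io by auto
    moreover have "sel C g ` Z \<subseteq> {m\<in>C. m < y}"
    proof
      fix x assume "x \<in> sel C g ` Z"
      then obtain n where n: "g n = 0" "x = sel C g n" by (auto simp: Z_def)
      have "y \<in> rest C g n" using y ny by (auto simp: rest_eq)
      then have "x \<le> y" unfolding n sel_def n(1) using pick_0_le ray_rest[OF C] by blast
      moreover have "x \<noteq> y" using ny n by auto
      ultimately show "x \<in> {m\<in>C. m < y}" using sel_in[OF C] n by auto
    qed
    then have "finite (sel C g ` Z)" using C finite_subset unfolding ray_def by blast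
    then have "finite Z" using inj_sel[OF C] by (metis finite_image_iff inj_on_subset subset_UNIV)
    ultimately show False by blast
  qed
  then show ?thesis using inj_sel[OF C] sel_in[OF C] by (auto simp: bij_betw_def)
qed

text \<open>
  Ranks and drawn values determine each other, so an event about the values drawn is an event about the
  independent coordinates of \<open>g\<close>.
\<close>

lemma sel_prefix_iff:
  assumes C: "ray C" and "n \<le> length ys"
  shows "(\<forall>j<n. sel C g j = ys ! j) \<longleftrightarrow>
    (\<forall>j<n. ys ! j \<in> C - set (take j ys)) \<and>
    (\<forall>j<n. g j = rank_in (C - set (take j ys)) (ys ! j))"
  using assms(2)
proof (induction n)
  case (Suc n)
  have key: "sel C g n = ys ! n \<longleftrightarrow> ys ! n \<in> C - set (take n ys) \<and>
      g n = rank_in (C - set (take n ys)) (ys ! n)" if pre: "\<forall>j<n. sel C g j = ys ! j"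
  proof -
    have "set (take n ys) = (!) ys ` {..<n}"
      using nth_image[of n ys] Suc.prems by (simp add: lessThan_atLeast0)
    also have "\<dots> = sel C g ` {..<n}"
      using pre by (intro image_cong) auto
    finally have "set (take n ys) = sel C g ` {..<n}" .
    then have "rest C g n = C - set (take n ys)" by (simp add: rest_eq)
    then show ?thesis unfolding sel_def using pick_eq_iff[OF ray_rest[OF C]] by metis
  qed
  have IH: "(\<forall>j<n. sel C g j = ys ! j) \<longleftrightarrow>
      (\<forall>j<n. ys ! j \<in> C - set (take j ys)) \<and>
      (\<forall>j<n. g j = rank_in (C - set (take j ys)) (ys ! j))"
    using Suc by simp
  have "(\<forall>j<Suc n. sel C g j = ys ! j) \<longleftrightarrow> (\<forall>j<n. sel C g j = ys ! j) \<and>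
      ys ! n \<in> C - set (take n ys) \<and> g n = rank_in (C - set (take n ys)) (ys ! n)"
    using key unfolding All_less_Suc by blast
  then show ?case unfolding IH All_less_Suc by blast
qed simp

section \<open>The one-sided q-shuffle\<close>

locale mallows =
  fixes q :: real
  assumes q_pos: "0 < q" and q_less_1: "q < 1"
begin

text \<open>
  The transition probabilities of drawing with geometric ranks: \<open>step C y\<close> for one value, \<open>kern C ys\<close>
  for a finite sequence of values.
\<close>

definition step :: "int set \<Rightarrow> int \<Rightarrow> real" where
  "step C y = (if y \<in> C then (1 - q) * q ^ rank_in C y else 0)"

primrec kern :: "int set \<Rightarrow> int list \<Rightarrow> real" where
  "kern C [] = 1"
| "kern C (y # ys) = step C y * kern (C - {y}) ys"

lemma step_nonneg: "0 \<le> step C y"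
  using q_pos q_less_1 by (simp add: step_def)

lemma kern_nonneg: "0 \<le> kern C ys"
  by (induction ys arbitrary: C) (auto simp: step_nonneg)

lemma kern_append: "kern C (xs @ ys) = kern C xs * kern (C - set xs) ys"
proof (induction xs arbitrary: C)
  case (Cons x xs)
  then show ?case using Diff_insert2[of C x "set xs"] by simp
qed simp

lemma kern_prod: "kern C ys = (\<Prod>j<length ys. step (C - set (take j ys)) (ys ! j))"
proof (induction ys arbitrary: C)
  case (Cons y ys)
  have "C - set (take (Suc j) (y # ys)) = C - {y} - set (take j ys)" for j
    using Diff_insert2[of C y "set (take j ys)"] by simp
  then show ?case
    using Cons[of "C - {y}"] by (simp add: prod.lessThan_Suc_shift del: prod.lessThan_Suc)
qed simp

lemma kern_0:
  "\<not> (distinct ys \<and> set ys \<subseteq> C) \<Longrightarrow> kern C ys = 0"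
proof (induction ys arbitrary: C)
  case (Cons y ys)
  show ?case
  proof (cases "y \<in> C")
    case True
    then have "\<not> (distinct ys \<and> set ys \<subseteq> C - {y})" using Cons.prems by auto
    then show ?thesis using Cons.IH[of "C - {y}"] by simp
  qed (simp add: step_def)
qed simp

definition geo :: "(nat \<Rightarrow> nat) measure" where
  "geo = (\<Pi>\<^sub>M j\<in>UNIV. measure_pmf (geometric_pmf (1 - q)))"

lemma prob_space_geo: "prob_space geo"
  unfolding geo_def by (intro prob_space_PiM prob_space_measure_pmf)

lemma space_geo [simp]: "space geo = UNIV"
  by (auto simp: geo_def space_PiM)

lemma measurable_geo_component [measurable]: "(\<lambda>g. g j) \<in> measurable geo (count_space UNIV)"
  unfolding geo_def
  using measurable_component_singleton[of j UNIV "\<lambda>_. measure_pmf (geometric_pmf (1 - q))"]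
  by simp

lemma emeasure_geo_box:
  "emeasure geo {g. \<forall>j<n. g j \<in> X j} =
    (\<Prod>j<n. emeasure (measure_pmf (geometric_pmf (1 - q))) (X j))"
proof -
  have eq: "{g. \<forall>j<n. g j \<in> X j} =
      prod_emb UNIV (\<lambda>_. measure_pmf (geometric_pmf (1 - q))) {..<n} (Pi\<^sub>E {..<n} X)"
    by (simp add: prod_emb_def PiE_def Pi_def set_eq_iff space_PiM)
  show ?thesis
    unfolding geo_def eq
    by (rule emeasure_PiM_emb) (simp_all add: prob_space_measure_pmf)
qed

lemma emeasure_geo_cylinder:
  "emeasure geo {g. \<forall>j<n. g j = r j} = ennreal (\<Prod>j<n. (1 - q) * q ^ r j)"
  using emeasure_geo_box[of n "\<lambda>j. {r j}"] q_pos q_less_1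
  by (simp add: emeasure_pmf_single prod_ennreal mult.commute)

text \<open>
  A geometric variable is nonzero with probability \<open>q\<close>, so no zero occurs from time \<open>N\<close> on with
  probability at most \<open>q ^ m\<close> for every \<open>m\<close>.
\<close>

lemma AE_geo_zeros: "AE g in geo. \<forall>N. \<exists>n\<ge>N. g n = 0"
proof -
  interpret prob_space geo by (rule prob_space_geo)
  have "AE g in geo. \<exists>n\<ge>N. g n = 0" for N
  proof -
    define B where "B = {g :: nat \<Rightarrow> nat. \<forall>n\<ge>N. g n \<noteq> 0}"
    have B: "B \<in> sets geo"
    proof -
      have "{g \<in> space geo. \<forall>n\<ge>N. g n \<noteq> 0} \<in> sets geo" by measurable
      then show ?thesis by (simp add: B_def)
    qed
    have nz: "emeasure (measure_pmf (geometric_pmf (1 - q))) (- {0}) = ennreal q"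
    proof -
      have "measure (measure_pmf (geometric_pmf (1 - q))) (UNIV - {0}) = 1 - (1 - q)"
        using q_pos q_less_1 measure_pmf.prob_compl[of "{0}" "geometric_pmf (1 - q)"]
        by (simp add: measure_pmf_single)
      then show ?thesis by (simp add: measure_pmf.emeasure_eq_measure Compl_eq_Diff_UNIV)
    qed
    have le: "emeasure geo B \<le> ennreal (q ^ m)" for m
    proof -
      have "emeasure geo B \<le> emeasure geo {g. \<forall>j<N + m. g j \<in> (if j < N then UNIV else (- {0}))}"
      proof (rule emeasure_mono)
        have "{g \<in> space geo. \<forall>j<N + m. g j \<in> (if j < N then UNIV else (- {0}))} \<in> sets geo"
          by measurable
        then show "{g. \<forall>j<N + m. g j \<in> (if j < N then UNIV else (- {0}))} \<in> sets geo" by simp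
      qed (auto simp: B_def)
      also have "\<dots> = (\<Prod>j<N + m. if j < N then 1 else ennreal q)"
        unfolding emeasure_geo_box
        by (intro prod.cong) (auto simp: nz measure_pmf.emeasure_space_1[simplified])
      also have "\<dots> = ennreal q ^ m"
      proof -
        have "{..<N + m} \<inter> - {j. j < N} = {N..<N + m}" by auto
        then show ?thesis by (simp add: prod.If_cases)
      qed
      finally show ?thesis using q_pos by (simp add: ennreal_power)
    qed
    have "(\<lambda>m. ennreal (q ^ m)) \<longlonglongrightarrow> ennreal 0"
      using q_pos q_less_1 by (intro tendsto_ennrealI LIMSEQ_realpow_zero) auto
    then have "emeasure geo B \<le> 0" using le by (intro LIMSEQ_le_const[of _ 0]) auto
    then have "B \<in> null_sets geo" using B by (auto simp: null_sets_def)
    then show ?thesis by (rule AE_I') (auto simp: B_def)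
  qed
  then show ?thesis by (simp add: AE_all_countable)
qed

lemma sel_prefix:
  assumes C: "ray C"
  shows "{g. \<forall>j<length ys. sel C g j = ys ! j} \<in> sets geo"
    and "emeasure geo {g. \<forall>j<length ys. sel C g j = ys ! j} = ennreal (kern C ys)"
proof -
  let ?valid = "\<forall>j<length ys. ys ! j \<in> C - set (take j ys)"
  let ?r = "\<lambda>j. rank_in (C - set (take j ys)) (ys ! j)"
  have eq: "{g. \<forall>j<length ys. sel C g j = ys ! j} =
      (if ?valid then {g. \<forall>j<length ys. g j = ?r j} else {})"
    using sel_prefix_iff[OF C order.refl, of ys] by auto
  have "{g \<in> space geo. \<forall>j<length ys. g j = ?r j} \<in> sets geo" by measurable
  then show "{g. \<forall>j<length ys. sel C g j = ys ! j} \<in> sets geo" unfolding eq by simp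
  show "emeasure geo {g. \<forall>j<length ys. sel C g j = ys ! j} = ennreal (kern C ys)"
  proof (cases ?valid)
    case True
    then show ?thesis unfolding eq by (simp add: emeasure_geo_cylinder kern_prod step_def)
  next
    case False
    then obtain j where "j < length ys" "ys ! j \<notin> C - set (take j ys)" by blast
    then have "kern C ys = 0" unfolding kern_prod by (auto simp: step_def intro!: bexI[of _ j])
    then show ?thesis unfolding eq if_not_P[OF False] by simp
  qed
qed

lemma measurable_sel:
  assumes C: "ray C"
  shows "(\<lambda>g. sel C g n) \<in> measurable geo (count_space UNIV)"
proof (subst measurable_count_space_eq2_countable, intro conjI ballI)
  fix v :: int
  define Y where "Y = {ys :: int list. length ys = Suc n \<and> ys ! n = v}"
  have "(\<lambda>g. sel C g n) -` {v} \<inter> space geo =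
      (\<Union>ys\<in>Y. {g. \<forall>j<length ys. sel C g j = ys ! j})"
  proof (intro equalityI subsetI)
    fix g assume "g \<in> (\<lambda>g. sel C g n) -` {v} \<inter> space geo"
    then have "map (sel C g) [0..<Suc n] \<in> Y" by (auto simp: Y_def simp del: upt_Suc)
    then show "g \<in> (\<Union>ys\<in>Y. {g. \<forall>j<length ys. sel C g j = ys ! j})"
      by (rule UN_I) (auto simp del: upt_Suc)
  qed (auto simp: Y_def)
  also have "\<dots> \<in> sets geo"
    using sel_prefix(1)[OF C] by (intro sets.countable_UN') (auto intro: countableI_type)
  finally show "(\<lambda>g. sel C g n) -` {v} \<inter> space geo \<in> sets geo" .
qed auto

end

section \<open>Random permutations with a prescribed image of the left half-line\<close>

lemma space_perm_space [simp]: "space perm_space = {\<omega>. bij \<omega>}"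
  by (simp add: perm_space_def space_restrict_space space_PiM PiE_def)

lemma measurable_perm_component [measurable]:
  "(\<lambda>\<omega>. \<omega> i) \<in> measurable perm_space (count_space UNIV)"
  unfolding perm_space_def
  by (rule measurable_restrict_space1) (rule measurable_component_singleton, simp)

lemma measurable_to_perm_space:
  assumes "\<And>i. (\<lambda>s. f s i) \<in> measurable M (count_space UNIV)"
    and "\<And>s. s \<in> space M \<Longrightarrow> bij (f s)"
  shows "f \<in> measurable M perm_space"
  unfolding perm_space_def
proof (rule measurable_restrict_space2)
  show "f \<in> measurable M (\<Pi>\<^sub>M i\<in>UNIV. count_space UNIV)"
    using assms(1) by (intro measurable_PiM_single') auto
qed (use assms(2) in auto)

definition cyl :: "int set \<Rightarrow> (int \<Rightarrow> int) \<Rightarrow> (int \<Rightarrow> int) set" where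
  "cyl J y = {\<omega>. bij \<omega> \<and> (\<forall>j\<in>J. \<omega> j = y j)}"

lemma sets_cyl [measurable]: "cyl J y \<in> sets perm_space"
proof -
  have "{\<omega> \<in> space perm_space. \<forall>j\<in>J. \<omega> j = y j} \<in> sets perm_space" by measurable
  then show ?thesis by (simp add: cyl_def)
qed

lemma sets_image: "{\<omega>. bij \<omega> \<and> \<omega> ` S = A} \<in> sets perm_space"
proof -
  have "{\<omega> \<in> space perm_space. (\<forall>j\<in>S. \<omega> j \<in> A) \<and> (\<forall>v\<in>A. \<exists>j\<in>S. \<omega> j = v)}
      \<in> sets perm_space" by measurable
  moreover have "(\<forall>j\<in>S. \<omega> j \<in> A) \<and> (\<forall>v\<in>A. \<exists>j\<in>S. \<omega> j = v) \<longleftrightarrow> \<omega> ` S = A"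
    for \<omega> :: "int \<Rightarrow> int" by auto
  ultimately show ?thesis by simp
qed

text \<open>
  The finiteness conditions in the definition of balanced permutations say that the image of the left
  half-line is a Maya diagram.
\<close>

lemma maya_iff: "maya A \<longleftrightarrow> finite ({..0} - A) \<and> finite (A \<inter> {0<..})"
proof
  assume A: "maya A"
  then obtain L where "{..L} \<subseteq> A" by (auto simp: maya_def)
  then have "{..0} - A \<subseteq> {L<..0}" by (auto simp: subset_iff not_le[symmetric])
  then show "finite ({..0} - A) \<and> finite (A \<inter> {0<..})"
    using maya_finite_above[OF A] finite_subset by blast
next
  assume *: "finite ({..0} - A) \<and> finite (A \<inter> {0<..})"
  obtain L where L: "\<forall>x\<in>{..0} - A. L \<le> x" using * bdd_below_finite bdd_below.unfold by metis
  obtain U where U: "\<forall>x\<in>A \<inter> {0<..}. x \<le> U" using * bdd_above_finite bdd_above.unfold by metis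
  have "{..min (L - 1) 0} \<subseteq> A"
  proof
    fix x assume x: "x \<in> {..min (L - 1) 0}"
    then have "\<not> L \<le> x" "x \<in> {..0}" by auto
    then show "x \<in> A" using L by blast
  qed
  moreover have "A \<subseteq> {..max U 0}" using U by force
  ultimately show "maya A" unfolding maya_def by blast
qed

lemma balanced_iff_charge:
  assumes "bij \<omega>"
  shows "balanced \<omega> \<longleftrightarrow> maya (\<omega> ` {..0}) \<and> charge (\<omega> ` {..0}) = 0"
proof -
  have inj: "inj_on \<omega> S" for S using assms by (meson bij_betw_def inj_on_subset subset_UNIV)
  have surj: "range \<omega> = UNIV" using assms by (simp add: bij_def)
  have "\<omega> ` {j. j > 0 \<and> \<omega> j \<le> 0} = {..0} - \<omega> ` {..0}"
  proof (intro equalityI subsetI)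
    fix x assume x: "x \<in> {..0} - \<omega> ` {..0}"
    then obtain j where "x = \<omega> j" using surj by blast
    then show "x \<in> \<omega> ` {j. j > 0 \<and> \<omega> j \<le> 0}" using x by (cases "j > 0") auto
  next
    fix x assume "x \<in> \<omega> ` {j. j > 0 \<and> \<omega> j \<le> 0}"
    then obtain j where j: "x = \<omega> j" "j > 0" "\<omega> j \<le> 0" by blast
    have "\<omega> j \<noteq> \<omega> i" if "i \<le> 0" for i using injD[OF inj[of UNIV], of j i] that j(2) by auto
    then show "x \<in> {..0} - \<omega> ` {..0}" using j by auto
  qed
  then have 1: "finite {j. j > 0 \<and> \<omega> j \<le> 0} = finite ({..0} - \<omega> ` {..0})"
    "card {j. j > 0 \<and> \<omega> j \<le> 0} = card ({..0} - \<omega> ` {..0})"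
    using finite_image_iff[OF inj] card_image[OF inj] by metis+
  have "\<omega> ` {j. j \<le> 0 \<and> \<omega> j > 0} = \<omega> ` {..0} \<inter> {0<..}" by auto
  then have 2: "finite {j. j \<le> 0 \<and> \<omega> j > 0} = finite (\<omega> ` {..0} \<inter> {0<..})"
    "card {j. j \<le> 0 \<and> \<omega> j > 0} = card (\<omega> ` {..0} \<inter> {0<..})"
    using finite_image_iff[OF inj] card_image[OF inj] by metis+
  show ?thesis unfolding balanced_def maya_iff charge_def 1 2 by linarith
qed

context mallows
begin

definition seeds :: "((nat \<Rightarrow> nat) \<times> (nat \<Rightarrow> nat)) measure" where
  "seeds = geo \<Otimes>\<^sub>M geo"

text \<open>
  The right half of the permutation draws ascending values from the complement of \<open>A\<close>, the left half
  draws descending values from \<open>A\<close>; the reflection reduces the second case to the first.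
\<close>

definition arrange :: "int set \<Rightarrow> (nat \<Rightarrow> nat) \<times> (nat \<Rightarrow> nat) \<Rightarrow> int \<Rightarrow> int" where
  "arrange A s i =
     (if 0 < i then sel (- A) (fst s) (nat (i - 1)) else - sel (uminus ` A) (snd s) (nat (- i)))"

definition good_seed :: "(nat \<Rightarrow> nat) \<times> (nat \<Rightarrow> nat) \<Rightarrow> bool" where
  "good_seed s \<longleftrightarrow> (\<forall>N. \<exists>n\<ge>N. fst s n = 0) \<and> (\<forall>N. \<exists>n\<ge>N. snd s n = 0)"

text \<open>
  The identity is a default value on a null set of seeds and for sets that are not Maya diagrams; it
  makes this a probability measure on bijections for every \<open>A\<close>, as needed for a kernel.
\<close>

definition law :: "int set \<Rightarrow> (int \<Rightarrow> int) measure" where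
  "law A = distr seeds perm_space (\<lambda>s. if maya A \<and> good_seed s then arrange A s else id)"

lemma space_seeds [simp]: "space seeds = UNIV"
  by (simp add: seeds_def space_pair_measure)

lemma prob_space_seeds: "prob_space seeds"
  unfolding seeds_def by (intro prob_space_pair prob_space_geo)

lemma arrange_left_image:
  assumes A: "maya A" and s: "good_seed s"
  shows "bij_betw (arrange A s) {..0} A"
proof -
  have 1: "bij_betw (\<lambda>i. nat (- i)) {..0} UNIV"
    by (rule bij_betw_byWitness[where f' = "\<lambda>n. - int n"]) auto
  have 2: "bij_betw (sel (uminus ` A) (snd s)) UNIV (uminus ` A)"
    using s by (intro bij_betw_sel ray_uminus_maya A) (auto simp: good_seed_def)
  have 3: "bij_betw uminus (uminus ` A) A"
    by (rule bij_betw_byWitness[where f' = uminus]) auto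
  have "bij_betw (uminus \<circ> (sel (uminus ` A) (snd s) \<circ> (\<lambda>i. nat (- i)))) {..0} A"
    by (intro bij_betw_trans[OF bij_betw_trans[OF 1 2] 3])
  then show ?thesis
    by (rule bij_betw_cong[THEN iffD1, rotated]) (auto simp: arrange_def)
qed

lemma arrange_right_image:
  assumes A: "maya A" and s: "good_seed s"
  shows "bij_betw (arrange A s) {0<..} (- A)"
proof -
  have 1: "bij_betw (\<lambda>i. nat (i - 1)) {0<..} UNIV"
    by (rule bij_betw_byWitness[where f' = "\<lambda>n. 1 + int n"]) auto
  have 2: "bij_betw (sel (- A) (fst s)) UNIV (- A)"
    using s by (intro bij_betw_sel ray_complement_maya A) (auto simp: good_seed_def)
  have "bij_betw (sel (- A) (fst s) \<circ> (\<lambda>i. nat (i - 1))) {0<..} (- A)"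
    by (intro bij_betw_trans[OF 1 2])
  then show ?thesis
    by (rule bij_betw_cong[THEN iffD1, rotated]) (auto simp: arrange_def)
qed

lemma bij_arrange:
  assumes A: "maya A" and s: "good_seed s"
  shows "bij (arrange A s)"
proof -
  have "bij_betw (arrange A s) ({..0} \<union> {0<..}) (A \<union> - A)"
    by (intro bij_betw_combine arrange_left_image arrange_right_image assms) auto
  moreover have "{..0} \<union> {0::int<..} = UNIV" by auto
  ultimately show ?thesis by simp
qed

lemma pred_good_seed [measurable]: "Measurable.pred seeds good_seed"
  unfolding good_seed_def seeds_def by measurable

lemma AE_good_seed: "AE s in seeds. good_seed s"
proof -
  interpret pair_prob_space geo geo
    by (intro pair_prob_space.intro pair_sigma_finite.intro prob_space_imp_sigma_finite
        prob_space_geo)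
  have "AE s in seeds. (\<forall>N. \<exists>n\<ge>N. fst s n = 0)"
    unfolding seeds_def using AE_geo_zeros by (intro AE_pair_measure) auto
  moreover have "AE s in seeds. (\<forall>N. \<exists>n\<ge>N. snd s n = 0)"
    unfolding seeds_def using AE_geo_zeros by (intro AE_pair_measure) auto
  ultimately show ?thesis by (auto simp: good_seed_def)
qed

lemma measurable_arrange:
  assumes A: "maya A"
  shows "(\<lambda>s. arrange A s i) \<in> measurable seeds (count_space UNIV)"
  unfolding arrange_def seeds_def
  using measurable_compose[OF measurable_fst measurable_sel[OF ray_complement_maya[OF A]]]
    measurable_compose[OF measurable_compose[OF measurable_snd
      measurable_sel[OF ray_uminus_maya[OF A]]], of uminus "count_space UNIV"]
  by (cases "0 < i") auto

lemma measurable_arrange_perm: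
  "(\<lambda>s. if maya A \<and> good_seed s then arrange A s else id) \<in> measurable seeds perm_space"
proof (rule measurable_to_perm_space)
  fix i
  show "(\<lambda>s. (if maya A \<and> good_seed s then arrange A s else id) i)
      \<in> measurable seeds (count_space UNIV)"
  proof (cases "maya A")
    case True
    have "(\<lambda>s. if good_seed s then arrange A s i else i) \<in> measurable seeds (count_space UNIV)"
      by (intro measurable_If measurable_arrange True pred_good_seed[unfolded pred_def]) auto
    also have "(\<lambda>s. if good_seed s then arrange A s i else i) =
        (\<lambda>s. (if maya A \<and> good_seed s then arrange A s else id) i)"
      using True by auto
    finally show ?thesis .
  qed simp
next
  fix s
  show "bij (if maya A \<and> good_seed s then arrange A s else id)"
    using bij_arrange by auto
qed

lemma prob_space_law: "prob_space (law A)"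
  unfolding law_def by (intro prob_space.prob_space_distr prob_space_seeds measurable_arrange_perm)

lemma sets_law [simp, measurable_cong]: "sets (law A) = sets perm_space"
  by (simp add: law_def)

lemma AE_law_image:
  assumes A: "maya A"
  shows "AE \<omega> in law A. \<omega> ` {..0} = A"
proof -
  let ?f = "\<lambda>s. if maya A \<and> good_seed s then arrange A s else id"
  have "AE s in seeds. bij (?f s) \<and> ?f s ` {..0} = A"
    using AE_good_seed
  proof eventually_elim
    case (elim s)
    then show ?case
      using arrange_left_image[OF A elim] bij_arrange[OF A elim] A by (simp add: bij_betw_def)
  qed
  then have "AE \<omega> in law A. bij \<omega> \<and> \<omega> ` {..0} = A"
    unfolding law_def using sets_image
    by (subst AE_distr_iff[OF measurable_arrange_perm]) auto
  then show ?thesis by eventually_elim simp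
qed

lemma law_cylinder:
  assumes A: "maya A"
  shows "emeasure (law A) (cyl {- int m<..int n} y) =
    ennreal (kern (- A) (map (\<lambda>j. y (1 + int j)) [0..<n]) *
      kern (uminus ` A) (map (\<lambda>j. - y (- int j)) [0..<m]))"
proof -
  define rs where "rs = map (\<lambda>j. y (1 + int j)) [0..<n]"
  define ls where "ls = map (\<lambda>j. - y (- int j)) [0..<m]"
  let ?R = "{g. \<forall>j<length rs. sel (- A) g j = rs ! j}"
  let ?L = "{g. \<forall>j<length ls. sel (uminus ` A) g j = ls ! j}"
  interpret geo: prob_space geo by (rule prob_space_geo)
  note R = sel_prefix[OF ray_complement_maya[OF A], of rs]
  note L = sel_prefix[OF ray_uminus_maya[OF A], of ls]
  let ?f = "\<lambda>s. if maya A \<and> good_seed s then arrange A s else id"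
  have arr: "(\<forall>j\<in>{- int m<..int n}. arrange A s j = y j) \<longleftrightarrow> s \<in> ?R \<times> ?L" for s
  proof -
    have "(\<forall>j\<in>{- int m<..int n}. arrange A s j = y j) \<longleftrightarrow>
        (\<forall>j\<in>{0<..int n}. arrange A s j = y j) \<and> (\<forall>j\<in>{- int m<..0}. arrange A s j = y j)"
      by (auto simp: Ball_def) (metis linorder_not_le)
    also have "(\<forall>j\<in>{0<..int n}. arrange A s j = y j) \<longleftrightarrow>
        (\<forall>j<n. arrange A s (1 + int j) = y (1 + int j))"
    proof (safe, goal_cases)
      case (2 j)
      then have "nat (j - 1) < n" by (simp add: nat_less_iff)
      then show ?case using spec[OF 2(1), of "nat (j - 1)"] 2(2) by simp
    qed auto
    also have "(\<forall>j\<in>{- int m<..0}. arrange A s j = y j) \<longleftrightarrow>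
        (\<forall>j<m. arrange A s (- int j) = y (- int j))"
    proof (safe, goal_cases)
      case (2 j)
      then have "nat (- j) < m" by (simp add: nat_less_iff)
      then show ?case using spec[OF 2(1), of "nat (- j)"] 2(2) by simp
    qed auto
    finally show ?thesis
      by (cases s) (auto simp: arrange_def rs_def ls_def minus_equation_iff)
  qed
  have "emeasure (law A) (cyl {- int m<..int n} y) =
      emeasure seeds (?f -` cyl {- int m<..int n} y \<inter> space seeds)"
    unfolding law_def by (rule emeasure_distr[OF measurable_arrange_perm sets_cyl])
  also have "\<dots> = emeasure seeds (?R \<times> ?L)"
  proof (rule emeasure_eq_AE)
    show "AE s in seeds. (s \<in> ?f -` cyl {- int m<..int n} y \<inter> space seeds) = (s \<in> ?R \<times> ?L)"
      using AE_good_seed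
    proof eventually_elim
      case (elim s)
      then show ?case using A bij_arrange[OF A elim] arr[of s] by (simp add: cyl_def)
    qed
    show "?R \<times> ?L \<in> sets seeds" unfolding seeds_def using R(1) L(1) by (rule pair_measureI)
  qed (rule measurable_sets[OF measurable_arrange_perm sets_cyl])
  also have "\<dots> = emeasure geo ?R * emeasure geo ?L"
    unfolding seeds_def using R(1) L(1) by (rule geo.emeasure_pair_measure_Times)
  also have "\<dots> = ennreal (kern (- A) rs * kern (uminus ` A) ls)"
    unfolding R(2) L(2) by (simp add: ennreal_mult kern_nonneg)
  finally show ?thesis unfolding rs_def ls_def .
qed

end

section \<open>The partition function of the neutral sector\<close>

lemma sum_window: "(\<Sum>A\<in>window n. f A) = (\<Sum>S\<in>Pow {- int n<..int n}. f ({..- int n} \<union> S))"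
  unfolding window_eq_image by (simp add: sum.reindex[OF inj_on_window])

lemma double_choose_2: "2 * int (n choose 2) = int n * (int n - 1)"
  by (induction n) (simp_all add: numeral_2_eq_2 algebra_simps)

context mallows
begin

definition qpoch :: "nat \<Rightarrow> real" where
  "qpoch n = (\<Prod>i<n. 1 - q ^ Suc i)"

text \<open>
  Up to a power of \<open>q\<close>, the Gaussian binomial coefficient.
\<close>

definition subset_sum :: "nat \<Rightarrow> nat \<Rightarrow> real" where
  "subset_sum N k = (\<Sum>S | S \<subseteq> {..<N} \<and> card S = k. q ^ \<Sum>S)"

lemma qpoch_Suc: "qpoch (Suc n) = qpoch n * (1 - q ^ Suc n)"
  by (simp add: qpoch_def)

lemma qpoch_pos: "0 < qpoch n"
proof -
  have "q ^ Suc i < 1" for i using q_pos q_less_1 by (intro power_Suc_less_one) auto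
  then show ?thesis unfolding qpoch_def by (intro prod_pos) (simp del: power_Suc)
qed

lemma subset_sum_Suc:
  "subset_sum (Suc N) (Suc k) = subset_sum N (Suc k) + q ^ N * subset_sum N k"
proof -
  let ?X = "{S. S \<subseteq> {..<N} \<and> card S = Suc k}"
  let ?Y = "{S. S \<subseteq> {..<N} \<and> card S = k}"
  have fin: "finite S" if "S \<subseteq> {..<N}" for S using that finite_subset by blast
  have eq: "{S. S \<subseteq> {..<Suc N} \<and> card S = Suc k} = ?X \<union> insert N ` ?Y"
  proof (intro equalityI subsetI)
    fix S assume S: "S \<in> {S. S \<subseteq> {..<Suc N} \<and> card S = Suc k}"
    show "S \<in> ?X \<union> insert N ` ?Y"
    proof (cases "N \<in> S")
      case True
      then have "S - {N} \<in> ?Y" "S = insert N (S - {N})"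
        using S by (auto simp: lessThan_Suc)
      then show ?thesis by blast
    qed (use S in \<open>auto simp: lessThan_Suc\<close>)
  next
    fix S assume "S \<in> ?X \<union> insert N ` ?Y"
    then show "S \<in> {S. S \<subseteq> {..<Suc N} \<and> card S = Suc k}"
    proof
      assume "S \<in> insert N ` ?Y"
      then obtain T where T: "T \<subseteq> {..<N}" "card T = k" "S = insert N T" by blast
      then have "N \<notin> T" "finite T" using fin by auto
      then show ?thesis using T by auto
    qed auto
  qed
  have inj: "inj_on (insert N) ?Y"
  proof (rule inj_onI)
    fix S T assume "S \<in> ?Y" "T \<in> ?Y" "insert N S = insert N T"
    moreover from this have "N \<notin> S" "N \<notin> T" by auto
    ultimately show "S = T" by (metis Diff_insert_absorb)
  qed
  have fX: "finite ?X" "finite ?Y" by (auto intro: finite_subset[of _ "Pow {..<N}"])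
  have "subset_sum (Suc N) (Suc k) = (\<Sum>S\<in>?X. q ^ \<Sum>S) + (\<Sum>S\<in>insert N ` ?Y. q ^ \<Sum>S)"
    unfolding subset_sum_def eq using fX by (intro sum.union_disjoint) auto
  also have "(\<Sum>S\<in>insert N ` ?Y. q ^ \<Sum>S) = (\<Sum>S\<in>?Y. q ^ N * q ^ \<Sum>S)"
    unfolding sum.reindex[OF inj] o_def
  proof (rule sum.cong[OF refl])
    fix S assume "S \<in> ?Y"
    then have "finite S" "N \<notin> S" using fin by auto
    then show "q ^ \<Sum>(insert N S) = q ^ N * q ^ \<Sum>S" by (simp add: power_add)
  qed
  finally show ?thesis unfolding subset_sum_def by (simp add: sum_distrib_left)
qed

text \<open>
  Induction over Pascal's rule \<open>subset_sum_Suc\<close>, which distinguishes whether the largest element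
  belongs to the subset.
\<close>

lemma q_binomial:
  "subset_sum (k + m) k * (qpoch k * qpoch m) = q ^ (k choose 2) * qpoch (k + m)"
proof (induction k arbitrary: m)
  case 0
  have "{S. S \<subseteq> {..<m} \<and> card S = 0} = {{}}" by (auto dest: finite_subset)
  then show ?case by (simp add: subset_sum_def qpoch_def numeral_2_eq_2)
next
  case (Suc k)
  note IHk = Suc
  show ?case
  proof (induction m)
    case 0
    have "{S. S \<subseteq> {..<Suc k} \<and> card S = Suc k} = {{..<Suc k}}"
      by (auto dest: card_subset_eq[rotated] simp del: lessThan_Suc)
    moreover have "\<Sum>{..<Suc k} = Suc k choose 2"
      by (induction k) (simp_all add: numeral_2_eq_2)
    ultimately show ?case by (simp add: subset_sum_def qpoch_def del: lessThan_Suc)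
  next
    case (Suc m)
    have ch: "Suc k choose 2 = (k choose 2) + k" by (simp add: numeral_2_eq_2)
    have "subset_sum (Suc k + Suc m) (Suc k) * (qpoch (Suc k) * qpoch (Suc m)) =
      (subset_sum (Suc k + m) (Suc k) * (qpoch (Suc k) * qpoch m)) * (1 - q ^ Suc m) +
      q ^ (k + Suc m) * (subset_sum (k + Suc m) k * (qpoch k * qpoch (Suc m))) * (1 - q ^ Suc k)"
      using subset_sum_Suc[of "k + Suc m" k] by (simp add: qpoch_Suc algebra_simps)
    also have "\<dots> = q ^ (Suc k choose 2) * qpoch (k + Suc m) * (1 - q ^ Suc m) +
      q ^ (k + Suc m) * (q ^ (k choose 2) * qpoch (k + Suc m)) * (1 - q ^ Suc k)"
      using Suc IHk[of "Suc m"] by simp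
    also have "\<dots> = q ^ (Suc k choose 2) * (qpoch (k + Suc m) * (1 - q ^ Suc (k + Suc m)))"
      unfolding ch by (simp add: algebra_simps power_add)
    finally show ?case using qpoch_Suc[of "k + Suc m"] by simp
  qed
qed

text \<open>
  Translating \<open>{-n<..n}\<close> to \<open>{..<2 * n}\<close>, neutral diagrams become subsets of cardinality \<open>n\<close>, and the energy
  becomes the sum of the elements up to a constant. So the sum is the central Gaussian binomial
  coefficient.
\<close>

lemma window_sector_sum:
  "(\<Sum>A\<in>window n. if charge A = 0 then q ^ energy A else 0) = qpoch (2 * n) / (qpoch n)\<^sup>2"
proof -
  let ?W = "{- int n<..int n}"
  let ?g = "\<lambda>t. int t - int n + 1"
  have bij: "bij_betw ?g {..<2 * n} ?W"
    by (rule bij_betw_byWitness[where f' = "\<lambda>m. nat (m + int n - 1)"]) auto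
  have inj: "inj_on ?g T" for T by (auto simp: inj_on_def)
  have Pow_eq: "Pow ?W = (`) ?g ` Pow {..<2 * n}"
    using bij by (metis bij_betw_def image_Pow_surj)
  have injP: "inj_on ((`) ?g) (Pow {..<2 * n})"
    by (rule inj_on_image_Pow) (rule inj)
  have "(\<Sum>A\<in>window n. if charge A = 0 then q ^ energy A else 0) =
      (\<Sum>T\<in>Pow {..<2 * n}. if charge ({..- int n} \<union> ?g ` T) = 0
        then q ^ energy ({..- int n} \<union> ?g ` T) else 0)"
    unfolding sum_window Pow_eq by (simp add: sum.reindex[OF injP])
  also have "\<dots> = (\<Sum>T\<in>Pow {..<2 * n}. if card T = n then q ^ \<Sum>T / q ^ (n choose 2) else 0)"
  proof (rule sum.cong[OF refl])
    fix T assume T: "T \<in> Pow {..<2 * n}"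
    then have fT: "finite T" using finite_subset by auto
    have sub: "?g ` T \<subseteq> ?W" using T bij by (auto simp: bij_betw_def)
    have c: "charge ({..- int n} \<union> ?g ` T) = int (card T) - int n"
      using charge_energy_window(1)[OF sub] by (simp add: card_image inj)
    show "(if charge ({..- int n} \<union> ?g ` T) = 0
        then q ^ energy ({..- int n} \<union> ?g ` T) else 0) =
      (if card T = n then q ^ \<Sum>T / q ^ (n choose 2) else 0)"
    proof (cases "card T = n")
      case True
      have "2 * int (energy ({..- int n} \<union> ?g ` T)) =
          2 * (int (\<Sum>T) - int n * (int n - 1)) + int n * (int n - 1)"
        unfolding charge_energy_window(2)[OF sub] sum.reindex[OF inj]
        using True by (simp add: o_def sum.distrib sum_subtractf algebra_simps)
      then have "int (energy ({..- int n} \<union> ?g ` T)) + int (n choose 2) = int (\<Sum>T)"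
        using double_choose_2[of n] by (simp only: right_diff_distrib)
      then have "energy ({..- int n} \<union> ?g ` T) + (n choose 2) = \<Sum>T"
        by (simp only: of_nat_add[symmetric] of_nat_eq_iff)
      then have "q ^ \<Sum>T = q ^ energy ({..- int n} \<union> ?g ` T) * q ^ (n choose 2)"
        by (metis power_add)
      then show ?thesis using True c q_pos by simp
    qed (use c in simp)
  qed
  also have "\<dots> = subset_sum (2 * n) n / q ^ (n choose 2)"
    unfolding subset_sum_def
    by (simp add: sum.If_cases sum_divide_distrib Pow_def Int_def conj_commute)
  also have "\<dots> = qpoch (2 * n) / (qpoch n)\<^sup>2"
    using q_binomial[of n n, folded mult_2] qpoch_pos[of n] q_pos
    by (simp add: field_simps power2_eq_square)
  finally show ?thesis .
qed

definition euler :: real where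
  "euler = (\<Prod>k. 1 - q ^ Suc k)"

lemma convergent_prod_euler: "convergent_prod (\<lambda>k. 1 - q ^ Suc k)"
proof -
  have "summable (\<lambda>k. \<bar>- (q ^ Suc k)\<bar>)"
    using q_pos q_less_1 by (simp add: abs_mult power_abs summable_mult summable_geometric)
  moreover have "- (q ^ Suc k) \<noteq> -1" for k
    using power_Suc_less_one[of q k] q_pos q_less_1 by simp
  ultimately show ?thesis using summable_imp_convergent_prod_real by fastforce
qed

lemma qpoch_LIMSEQ: "qpoch \<longlonglongrightarrow> euler"
proof -
  have "(\<lambda>n. qpoch (Suc n)) \<longlonglongrightarrow> euler"
    using convergent_prod_LIMSEQ[OF convergent_prod_euler]
    by (simp add: euler_def qpoch_def lessThan_Suc_atMost)
  then show ?thesis by (rule LIMSEQ_imp_Suc)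
qed

lemma euler_pos: "0 < euler"
  unfolding euler_def
proof (rule less_0_prodinf[OF convergent_prod_euler])
  fix k
  show "0 < 1 - q ^ Suc k" using power_Suc_less_one[of q k] q_pos q_less_1 by simp
qed

text \<open>
  The central Gaussian binomial coefficients tend to the reciprocal of the Euler product.
\<close>

lemma neutral_sector_total:
  "(\<integral>\<^sup>+A. ennreal (if maya A \<and> charge A = 0 then euler * q ^ energy A else 0) \<partial>count_space UNIV) = 1"
proof -
  let ?f = "\<lambda>A. if charge A = 0 then euler * q ^ energy A else 0"
  have "(\<lambda>n. \<Sum>A\<in>window n. ennreal (?f A))
      \<longlonglongrightarrow> (\<integral>\<^sup>+A\<in>{A. maya A}. ennreal (?f A) \<partial>count_space UNIV)"
    by (rule nn_integral_maya_LIMSEQ)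
  moreover have "(\<Sum>A\<in>window n. ennreal (?f A)) = ennreal (euler * (qpoch (2 * n) / (qpoch n)\<^sup>2))" for n
  proof -
    have "(\<Sum>A\<in>window n. ennreal (?f A)) = ennreal (\<Sum>A\<in>window n. ?f A)"
      using euler_pos q_pos by (intro sum_ennreal) auto
    also have "(\<Sum>A\<in>window n. ?f A) = euler * (\<Sum>A\<in>window n. if charge A = 0 then q ^ energy A else 0)"
      unfolding sum_distrib_left by (intro sum.cong) auto
    finally show ?thesis by (simp add: window_sector_sum)
  qed
  moreover have "(\<lambda>n. ennreal (euler * (qpoch (2 * n) / (qpoch n)\<^sup>2)))
      \<longlonglongrightarrow> ennreal (euler * (euler / euler\<^sup>2))"
    using euler_pos
    by (intro tendsto_ennrealI tendsto_intros qpoch_LIMSEQ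
        LIMSEQ_subseq_LIMSEQ[OF qpoch_LIMSEQ, unfolded o_def] strict_monoI) auto
  ultimately have "(\<integral>\<^sup>+A\<in>{A. maya A}. ennreal (?f A) \<partial>count_space UNIV) =
      ennreal (euler * (euler / euler\<^sup>2))"
    using LIMSEQ_unique by force
  also have "euler * (euler / euler\<^sup>2) = 1" using euler_pos by (simp add: power2_eq_square)
  also have "(\<integral>\<^sup>+A\<in>{A. maya A}. ennreal (?f A) \<partial>count_space UNIV) =
      (\<integral>\<^sup>+A. ennreal (if maya A \<and> charge A = 0 then euler * q ^ energy A else 0) \<partial>count_space UNIV)"
    by (intro nn_integral_cong) (auto split: split_indicator)
  finally show ?thesis by simp
qed

end

section \<open>Detailed balance and q-exchangeability\<close>

lemma charge_union:
  assumes "finite F" "maya B" "B \<inter> F = {}"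
  shows "maya (B \<union> F) \<and> charge (B \<union> F) = charge B + int (card F)"
  using assms(1,3)
proof (induction F rule: finite_induct)
  case (insert x F)
  then have "maya (B \<union> F)" "charge (B \<union> F) = charge B + int (card F)" "x \<notin> B \<union> F" by auto
  then show ?case
    using charge_energy_insert(1)[of "B \<union> F" x] insert.hyps by (simp add: Un_insert_right)
qed (simp add: assms(2))

lemma right_list: "map (\<lambda>j. y (1 + int j)) [0..<n] = map y [1..int n]"
  by (induction n) (simp_all add: upto_rec2 add.commute)

lemma left_list: "map (\<lambda>j. - y (- int j)) [0..<m] = map uminus (rev (map y [1 - int m..0]))"
  by (induction m) (simp_all add: upto_rec1)

lemma sets_balanced [measurable]: "{\<omega> \<in> space perm_space. balanced \<omega>} \<in> sets perm_space"
proof -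
  have "{\<omega> \<in> space perm_space. balanced \<omega>} =
      (\<Union>A\<in>{A. maya A \<and> charge A = 0}. {\<omega>. bij \<omega> \<and> \<omega> ` {..0} = A})"
    using balanced_iff_charge by auto
  moreover have "countable {A. maya A \<and> charge A = 0}"
    by (rule countable_subset[OF _ countable_maya]) auto
  ultimately show ?thesis using sets_image by (auto intro!: sets.countable_UN')
qed

text \<open>
  Reduces statements about arbitrary finite sets of coordinates to intervals, where the probabilities
  of cylinders are known.
\<close>

lemma emeasure_cyl_extend:
  assumes M: "sets M = sets perm_space" and J: "finite J" "I \<subseteq> J"
  shows "emeasure M (cyl I y) =
    (\<integral>\<^sup>+z. emeasure M (cyl J z) \<partial>count_space {z \<in> J \<rightarrow>\<^sub>E UNIV. \<forall>j\<in>I. z j = y j})"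
proof -
  let ?Z = "{z \<in> J \<rightarrow>\<^sub>E UNIV. \<forall>j\<in>I. z j = y j}"
  have "cyl I y = (\<Union>z\<in>?Z. cyl J z)"
  proof (intro equalityI subsetI)
    fix \<omega> assume w: "\<omega> \<in> cyl I y"
    then have "restrict \<omega> J \<in> ?Z" "\<omega> \<in> cyl J (restrict \<omega> J)"
      using J(2) by (auto simp: cyl_def)
    then show "\<omega> \<in> (\<Union>z\<in>?Z. cyl J z)" by blast
  qed (use J(2) in \<open>auto simp: cyl_def\<close>)
  moreover have "countable ?Z"
    by (rule countable_subset[of _ "J \<rightarrow>\<^sub>E UNIV"]) (auto intro!: countable_PiE J(1))
  moreover have "disjoint_family_on (cyl J) ?Z"
    unfolding disjoint_family_on_def
  proof (intro ballI impI)
    fix z z' assume z: "z \<in> ?Z" "z' \<in> ?Z" "z \<noteq> z'"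
    then obtain j where "j \<in> J" "z j \<noteq> z' j" by (metis (mono_tags, lifting) PiE_ext mem_Collect_eq)
    then show "cyl J z \<inter> cyl J z' = {}" by (auto simp: cyl_def)
  qed
  ultimately show ?thesis by (simp add: emeasure_UN_countable M)
qed

context mallows
begin

text \<open>
  The law of the Maya diagram at the cut between \<open>0\<close> and \<open>1\<close>.
\<close>

definition sea_weight :: "int set \<Rightarrow> real" where
  "sea_weight A = (if maya A \<and> charge A = 0 then euler * q ^ energy A else 0)"

definition sea_pmf :: "int set pmf" where
  "sea_pmf = embed_pmf sea_weight"

text \<open>
  The balanced law: \<open>mallows_balanced_eq\<close> identifies it with the one given by a definite description.
\<close>

definition M0 :: "(int \<Rightarrow> int) measure" where
  "M0 = measure_pmf sea_pmf \<bind> law"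

lemma sea_weight_nonneg: "0 \<le> sea_weight A"
  using euler_pos q_pos by (simp add: sea_weight_def)

lemma pmf_sea: "pmf sea_pmf A = sea_weight A"
  unfolding sea_pmf_def
  using neutral_sector_total sea_weight_nonneg
  by (intro pmf_embed_pmf) (auto simp: sea_weight_def)

lemma measurable_law: "law \<in> measurable (measure_pmf sea_pmf) (subprob_algebra perm_space)"
  using prob_space_law by (auto simp: space_subprob_algebra intro: prob_space_imp_subprob_space)

lemma sets_M0 [simp, measurable_cong]: "sets M0 = sets perm_space"
  unfolding M0_def by (rule sets_bind) auto

lemma prob_space_M0: "prob_space M0"
  unfolding M0_def
  by (rule prob_space.prob_space_bind[OF prob_space_measure_pmf _ measurable_law])
     (simp add: prob_space_law)

lemma emeasure_M0:
  assumes "X \<in> sets perm_space"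
  shows "emeasure M0 X = (\<integral>\<^sup>+A. ennreal (sea_weight A) * emeasure (law A) X \<partial>count_space UNIV)"
  unfolding M0_def
  by (subst emeasure_bind[OF _ measurable_law assms])
     (simp_all add: nn_integral_measure_pmf pmf_sea)

lemma AE_balanced_M0: "AE \<omega> in M0. balanced \<omega>"
proof -
  have "AE A in measure_pmf sea_pmf. AE \<omega> in law A. balanced \<omega>"
  proof (rule AE_pmfI)
    fix A assume "A \<in> set_pmf sea_pmf"
    then have A: "maya A" "charge A = 0"
      by (auto simp: set_pmf_iff pmf_sea sea_weight_def split: if_splits)
    have "AE \<omega> in law A. bij \<omega>"
      using AE_space[of "law A"] sets_eq_imp_space_eq[OF sets_law[of A]] by simp
    then show "AE \<omega> in law A. balanced \<omega>"
      using AE_law_image[OF A(1)] by eventually_elim (use A balanced_iff_charge in auto)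
  qed
  then show ?thesis
    unfolding M0_def
    by (subst AE_bind[OF measurable_law]) (simp_all add: pred_def sets_balanced[simplified])
qed

text \<open>
  The constant that detailed balance produces when the cut moves over \<open>n\<close> places to the left, starting
  from charge \<open>a\<close>. Only its independence of the diagram matters.
\<close>

primrec flux :: "nat \<Rightarrow> int \<Rightarrow> real" where
  "flux 0 a = 1"
| "flux (Suc n) a = q powi a * flux n (a - 1)"

lemma flux_nonneg: "0 \<le> flux n a"
  using q_pos by (induction n arbitrary: a) auto

lemma powi_of_nat_add: "q powi (int n + k) = q ^ n * q powi k"
  using q_pos by (simp add: power_int_add)

text \<open>
  Drawing \<open>y\<close> to the left out of \<open>A\<close> and drawing \<open>y\<close> to the right into \<open>A - {y}\<close> are reverse moves. The
  energies differ by \<open>y\<close> and the numbers of rivals differ by \<open>y\<close> and the charge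
  (\<open>holes_minus_particles\<close>), so that \<open>y\<close> cancels.
\<close>

lemma one_step_balance:
  assumes A: "maya A" and y: "y \<in> A"
  shows "q ^ energy A * step (uminus ` A) (- y) =
    q powi charge A * (q ^ energy (A - {y}) * step (- (A - {y})) y)"
proof -
  let ?A = "A - {y}"
  have A': "maya ?A" "y \<notin> ?A" "insert y ?A = A" using A y by auto
  have "{m \<in> uminus ` A. m < - y} = {m \<in> uminus ` ?A. m < - y}" by auto
  then have r: "rank_in (uminus ` A) (- y) = rank_in (uminus ` ?A) (- y)" by (simp add: rank_in_def)
  have "int (energy A) + int (rank_in (uminus ` A) (- y)) =
      int (energy ?A) + int (rank_in (- ?A) y) + charge A"
    using charge_energy_insert[OF A'(1,2)] holes_minus_particles[OF A'(1,2)] A'(3) r by simp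
  then have "q powi (int (energy A) + int (rank_in (uminus ` A) (- y))) =
      q powi (int (energy ?A) + (int (rank_in (- ?A) y) + charge A))" by (simp add: add.assoc)
  then have "q ^ energy A * q ^ rank_in (uminus ` A) (- y) =
      q ^ energy ?A * (q ^ rank_in (- ?A) y * q powi charge A)"
    unfolding powi_of_nat_add by simp
  then show ?thesis using y by (simp add: step_def mult_ac)
qed

text \<open>
  Iterating the one-step relation moves the cut past a whole block \<open>ys\<close>: values drawn from the right to
  the left become values drawn from the left to the right.
\<close>

lemma detailed_balance:
  assumes "maya A" "distinct ys" "set ys \<subseteq> A"
  shows "q ^ energy A * kern (uminus ` A) (map uminus (rev ys)) =
    flux (length ys) (charge A) * (q ^ energy (A - set ys) * kern (- (A - set ys)) ys)"
  using assms
proof (induction ys arbitrary: A rule: rev_induct)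
  case (snoc y ys)
  let ?A = "A - {y}"
  have A': "maya ?A" "y \<notin> ?A" "insert y ?A = A" using snoc.prems by auto
  have ch: "charge ?A = charge A - 1" using charge_energy_insert(1)[OF A'(1,2)] A'(3) by simp
  have im: "uminus ` A - {- y} = uminus ` ?A" by auto
  have sub: "set ys \<subseteq> ?A" "distinct ys" using snoc.prems by auto
  have B: "A - set (ys @ [y]) = ?A - set ys" by auto
  have "- (?A - set ys) - set ys = - ?A" using sub by auto
  then have k: "kern (- (?A - set ys)) (ys @ [y]) = kern (- (?A - set ys)) ys * step (- ?A) y"
    by (simp add: kern_append)
  have "q ^ energy A * kern (uminus ` A) (map uminus (rev (ys @ [y]))) =
      (q ^ energy A * step (uminus ` A) (- y)) * kern (uminus ` ?A) (map uminus (rev ys))"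
    by (simp add: im)
  also have "\<dots> = q powi charge A * step (- ?A) y *
      (q ^ energy ?A * kern (uminus ` ?A) (map uminus (rev ys)))"
    using one_step_balance[of A y] snoc.prems by simp
  also have "\<dots> = q powi charge A * step (- ?A) y *
      (flux (length ys) (charge ?A) * (q ^ energy (?A - set ys) * kern (- (?A - set ys)) ys))"
    using snoc.IH[OF A'(1) sub(2,1)] by simp
  finally show ?case unfolding B k by (simp add: ch)
qed simp

text \<open>
  The substitution \<open>B = A - set ls\<close>, where \<open>ls\<close> are the values at the places \<open>1 - m..0\<close>, moves the cut
  from \<open>0\<close> to \<open>- m\<close>. On the right-hand side the values in the window enter only through one kernel,
  which treats all neighbouring pairs alike, including the pair at the places \<open>0\<close> and \<open>1\<close>.
\<close>

lemma M0_cylinder: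
  "emeasure M0 (cyl {- int m<..int n} y) =
    (\<integral>\<^sup>+B. ennreal (if maya B \<and> charge B = - int m
      then euler * flux m 0 * (q ^ energy B * kern (- B) (map y [1 - int m..int n])) else 0)
      \<partial>count_space UNIV)"
proof -
  define ls where "ls = map y [1 - int m..0]"
  define rs where "rs = map y [1..int n]"
  have len: "length ls = m" by (simp add: ls_def)
  have split: "map y [1 - int m..int n] = ls @ rs"
  proof -
    have "[1 - int m..int n] = [1 - int m..0] @ [1..int n]"
      using upto_split1[of "1 - int m" 1 "int n"] upto_split2[of "1 - int m" 0 "int n"]
      by (cases "m = 0"; cases "n = 0") simp_all
    then show ?thesis by (simp add: ls_def rs_def)
  qed
  have "emeasure M0 (cyl {- int m<..int n} y) =
      (\<integral>\<^sup>+A. ennreal (sea_weight A * (kern (- A) rs * kern (uminus ` A) (map uminus (rev ls))))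
        \<partial>count_space UNIV)"
    unfolding emeasure_M0[OF sets_cyl]
  proof (rule nn_integral_cong)
    fix A
    show "ennreal (sea_weight A) * emeasure (law A) (cyl {- int m<..int n} y) =
      ennreal (sea_weight A * (kern (- A) rs * kern (uminus ` A) (map uminus (rev ls))))"
    proof (cases "maya A")
      case True
      then show ?thesis
        unfolding law_cylinder[OF True] right_list left_list rs_def ls_def
        by (simp add: ennreal_mult sea_weight_nonneg kern_nonneg)
    qed (simp add: sea_weight_def)
  qed
  also have "\<dots> = (\<integral>\<^sup>+B. ennreal (if maya B \<and> charge B = - int m
      then euler * flux m 0 * (q ^ energy B * kern (- B) (ls @ rs)) else 0) \<partial>count_space UNIV)"
  proof (cases "distinct ls")
    case False
    have "kern (uminus ` A) (map uminus (rev ls)) = 0" for A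
      by (rule kern_0) (use False in \<open>simp add: distinct_map\<close>)
    moreover have "kern (- B) (ls @ rs) = 0" for B
      by (rule kern_0) (use False in simp)
    ultimately show ?thesis by (simp cong: if_cong)
  next
    case True
    let ?SA = "{A. maya A \<and> charge A = 0 \<and> set ls \<subseteq> A}"
    let ?SB = "{B. maya B \<and> charge B = - int m \<and> B \<inter> set ls = {}}"
    let ?fA = "\<lambda>A. ennreal (sea_weight A * (kern (- A) rs * kern (uminus ` A) (map uminus (rev ls))))"
    let ?fB = "\<lambda>B. ennreal (euler * flux m 0 * (q ^ energy B * kern (- B) (ls @ rs)))"
    have card: "card (set ls) = m" using True len by (simp add: distinct_card)
    have bij: "bij_betw (\<lambda>B. B \<union> set ls) ?SB ?SA"
    proof (rule bij_betw_byWitness[where f' = "\<lambda>A. A - set ls"])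
      show "(\<lambda>B. B \<union> set ls) ` ?SB \<subseteq> ?SA" using charge_union card by auto
      show "(\<lambda>A. A - set ls) ` ?SA \<subseteq> ?SB"
      proof
        fix B assume "B \<in> (\<lambda>A. A - set ls) ` ?SA"
        then obtain A where A: "maya A" "charge A = 0" "set ls \<subseteq> A" "B = A - set ls" by blast
        have "finite F \<Longrightarrow> maya (A - F)" for F
          by (induction F rule: finite_induct) (use A in \<open>simp_all add: Diff_insert[of A]\<close>)
        then have "maya B" using A by simp
        moreover have "B \<union> set ls = A" using A by auto
        moreover have "B \<inter> set ls = {}" using A by auto
        ultimately show "B \<in> ?SB" using charge_union[of "set ls" B] A(2) card by simp
      qed
    qed auto
    have "(\<integral>\<^sup>+A. ?fA A \<partial>count_space UNIV) = (\<integral>\<^sup>+A. ?fA A \<partial>count_space ?SA)"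
    proof (subst nn_integral_count_space_indicator, simp, intro nn_integral_cong)
      fix A
      show "?fA A = ?fA A * indicator ?SA A"
      proof (cases "A \<in> ?SA")
        case False
        then have "sea_weight A = 0 \<or> \<not> set (map uminus (rev ls)) \<subseteq> uminus ` A"
          by (auto simp: sea_weight_def)
        then have "sea_weight A = 0 \<or> kern (uminus ` A) (map uminus (rev ls)) = 0"
          using kern_0 by blast
        then show ?thesis by auto
      qed simp
    qed
    also have "\<dots> = (\<integral>\<^sup>+B. ?fA (B \<union> set ls) \<partial>count_space ?SB)"
      by (rule nn_integral_bij_count_space[OF bij, symmetric])
    also have "\<dots> = (\<integral>\<^sup>+B. ?fB B \<partial>count_space ?SB)"
    proof (rule nn_integral_cong)
      fix B assume "B \<in> space (count_space ?SB)"
      then have B: "B \<in> ?SB" by simp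
      then have A: "maya (B \<union> set ls)" "charge (B \<union> set ls) = 0" "B \<union> set ls - set ls = B"
        "- B - set ls = - (B \<union> set ls)"
        using charge_union[of "set ls" B] card by auto
      have e: "sea_weight (B \<union> set ls) * kern (uminus ` (B \<union> set ls)) (map uminus (rev ls)) =
          euler * flux m 0 * (q ^ energy B * kern (- B) ls)"
        using detailed_balance[OF A(1) True] A len by (simp add: sea_weight_def)
      have "sea_weight (B \<union> set ls) * (kern (- (B \<union> set ls)) rs *
          kern (uminus ` (B \<union> set ls)) (map uminus (rev ls))) =
          (sea_weight (B \<union> set ls) * kern (uminus ` (B \<union> set ls)) (map uminus (rev ls))) *
          kern (- (B \<union> set ls)) rs" by (simp only: mult_ac)
      also have "\<dots> = euler * flux m 0 * (q ^ energy B * kern (- B) (ls @ rs))"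
        unfolding e kern_append A(4) by (simp only: mult_ac)
      finally show "?fA (B \<union> set ls) = ?fB B" by simp
    qed
    also have "\<dots> = (\<integral>\<^sup>+B. ennreal (if maya B \<and> charge B = - int m
      then euler * flux m 0 * (q ^ energy B * kern (- B) (ls @ rs)) else 0) \<partial>count_space UNIV)"
    proof (subst nn_integral_count_space_indicator, simp, intro nn_integral_cong)
      fix B
      show "?fB B * indicator ?SB B = ennreal (if maya B \<and> charge B = - int m
        then euler * flux m 0 * (q ^ energy B * kern (- B) (ls @ rs)) else 0)"
      proof (cases "B \<inter> set ls = {}")
        case False
        then have "kern (- B) (ls @ rs) = 0" by (intro kern_0) auto
        then show ?thesis by simp
      qed auto
    qed
    finally show ?thesis .
  qed
  finally show ?thesis unfolding split .
qed

text \<open>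
  Only the larger of the two values notices the order: drawn second it has one rival less.
\<close>

lemma kern_swap:
  assumes C: "ray C" and uv: "u \<noteq> v"
  shows "kern C (v # u # ys) = q powi sgn (v - u) * kern C (u # v # ys)"
proof (cases "u \<in> C \<and> v \<in> C")
  case True
  have eq: "C - {v} - {u} = C - {u} - {v}" by auto
  have rk: "rank_in (C - {a}) b = (if a < b then rank_in C b - 1 else rank_in C b)"
    "a < b \<Longrightarrow> 0 < rank_in C b" if "a \<in> C" for a b
  proof -
    have fin: "finite {m\<in>C. m < b}" using C by (simp add: ray_def)
    have "{m\<in>C - {a}. m < b} = {m\<in>C. m < b} - {a}" by auto
    then show "rank_in (C - {a}) b = (if a < b then rank_in C b - 1 else rank_in C b)"
      using fin that by (auto simp: rank_in_def card_Diff_singleton_if)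
    show "a < b \<Longrightarrow> 0 < rank_in C b" using fin that by (auto simp: rank_in_def card_gt_0_iff)
  qed
  have pow: "q * q ^ (n - 1) = q ^ n" if "0 < n" for n :: nat
    using that by (metis power_minus_mult mult.commute)
  show ?thesis
  proof (cases "u < v")
    case lt: True
    then show ?thesis
      using True uv rk[of u v] rk[of v u] pow[of "rank_in C v"] q_pos
      by (simp add: step_def eq)
  next
    case False
    then have lt: "v < u" using uv by simp
    have p: "q ^ (rank_in C u - 1) = inverse q * q ^ rank_in C u"
      using lt pow[of "rank_in C u"] rk(2)[of v u] True q_pos by (simp add: field_simps)
    show ?thesis
      using True uv lt rk(1)[of u v] rk(1)[of v u] p by (simp add: step_def eq)
  qed
qed (auto simp: step_def)

lemma M0_interval_swap:
  assumes i: "- int n < i" "i < int n" and ne: "y i \<noteq> y (i + 1)"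
  shows "emeasure M0 (cyl {- int n<..int n} (y(i := y (i + 1), i + 1 := y i))) =
    ennreal (q powi sgn (y (i + 1) - y i)) * emeasure M0 (cyl {- int n<..int n} y)"
proof -
  let ?y = "y(i := y (i + 1), i + 1 := y i)"
  have split: "[1 - int n..int n] = [1 - int n..i - 1] @ i # (i + 1) # [i + 2..int n]"
  proof -
    have "[1 - int n..int n] = [1 - int n..i - 1] @ [i..int n]"
      using i by (intro upto_split1) auto
    also have "[i..int n] = i # (i + 1) # [i + 2..int n]"
      using i upto_rec1[of i "int n"] upto_rec1[of "i + 1" "int n"]
      by (simp add: add.commute)
    finally show ?thesis .
  qed
  define as where "as = map y [1 - int n..i - 1]"
  define bs where "bs = map y [i + 2..int n]"
  have 1: "map y [1 - int n..int n] = as @ y i # y (i + 1) # bs"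
    unfolding split as_def bs_def by simp
  have 2: "map ?y [1 - int n..int n] = as @ y (i + 1) # y i # bs"
    unfolding split as_def bs_def by (auto intro!: map_cong)
  have k: "kern (- B) (map ?y [1 - int n..int n]) =
      q powi sgn (y (i + 1) - y i) * kern (- B) (map y [1 - int n..int n])" if "maya B" for B
    unfolding 1 2 kern_append
    using kern_swap[OF ray_Diff_finite[OF ray_complement_maya[OF that], of "set as"] ne]
    by simp
  have pos: "0 \<le> q powi sgn (y (i + 1) - y i)" using q_pos by simp
  show ?thesis
    unfolding M0_cylinder
  proof (subst nn_integral_cmult[symmetric], simp, rule nn_integral_cong)
    fix B
    show "ennreal (if maya B \<and> charge B = - int n
        then euler * flux n 0 * (q ^ energy B * kern (- B) (map ?y [1 - int n..int n])) else 0) =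
      ennreal (q powi sgn (y (i + 1) - y i)) * ennreal (if maya B \<and> charge B = - int n
        then euler * flux n 0 * (q ^ energy B * kern (- B) (map y [1 - int n..int n])) else 0)"
      using k[of B] pos euler_pos flux_nonneg[of n 0] q_pos kern_nonneg
      by (simp add: ennreal_mult[symmetric] mult_ac)
  qed
qed

text \<open>
  Extend to a large interval. Swapping the values at \<open>i\<close> and \<open>i + 1\<close> permutes the extensions, and for
  each of them \<open>M0_interval_swap\<close> gives the same factor.
\<close>

lemma q_exchangeable_M0: "q_exchangeable q M0"
  unfolding q_exchangeable_def
proof (intro allI impI)
  fix i I and y :: "int \<Rightarrow> int"
  assume A: "finite I \<and> i \<in> I \<and> i + 1 \<in> I \<and> inj_on y I"
  let ?sw = "\<lambda>y :: int \<Rightarrow> int. y(i := y (i + 1), i + 1 := y i)"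
  interpret M0: prob_space M0 by (rule prob_space_M0)
  obtain b where b: "\<forall>x\<in>abs ` I. x \<le> b" using A bdd_above_finite[of "abs ` I"] bdd_above.unfold
    by (metis finite_imageI)
  define n where "n = nat (b + 1)"
  let ?J = "{- int n<..int n}"
  have sub: "I \<subseteq> ?J"
  proof
    fix x assume "x \<in> I"
    then have "\<bar>x\<bar> \<le> b" using b by blast
    then show "x \<in> ?J" by (auto simp: n_def)
  qed
  then have i: "- int n < i" "i < int n" using A by auto
  have ne: "y i \<noteq> y (i + 1)" using A inj_onD[of y I i "i + 1"] by auto
  let ?c = "ennreal (q powi sgn (y (i + 1) - y i))"
  let ?Z = "\<lambda>y. {z \<in> ?J \<rightarrow>\<^sub>E UNIV. \<forall>j\<in>I. z j = y j}"
  have bij: "bij_betw ?sw (?Z y) (?Z (?sw y))"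
  proof (rule bij_betw_byWitness[where f' = ?sw])
    show "?sw ` ?Z y \<subseteq> ?Z (?sw y)" using A i by (auto simp: PiE_def extensional_def)
    show "?sw ` ?Z (?sw y) \<subseteq> ?Z y" using A i by (auto simp: PiE_def extensional_def)
  qed auto
  have "emeasure M0 (cyl I (?sw y)) = (\<integral>\<^sup>+z. emeasure M0 (cyl ?J z) \<partial>count_space (?Z (?sw y)))"
    using sub by (intro emeasure_cyl_extend) auto
  also have "\<dots> = (\<integral>\<^sup>+z. emeasure M0 (cyl ?J (?sw z)) \<partial>count_space (?Z y))"
    by (rule nn_integral_bij_count_space[OF bij, symmetric])
  also have "\<dots> = (\<integral>\<^sup>+z. ?c * emeasure M0 (cyl ?J z) \<partial>count_space (?Z y))"
  proof (rule nn_integral_cong)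
    fix z assume "z \<in> space (count_space (?Z y))"
    then have "z i = y i" "z (i + 1) = y (i + 1)" using A by auto
    then show "emeasure M0 (cyl ?J (?sw z)) = ?c * emeasure M0 (cyl ?J z)"
      using M0_interval_swap[OF i, of z] ne by simp
  qed
  also have "\<dots> = ?c * emeasure M0 (cyl I y)"
    using sub by (simp add: nn_integral_cmult emeasure_cyl_extend[of M0 ?J I y])
  finally have "measure M0 (cyl I (?sw y)) = q powi sgn (y (i + 1) - y i) * measure M0 (cyl I y)"
    using q_pos by (simp add: measure_def enn2real_mult)
  then show "\<P>(\<omega> in M0. \<forall>j\<in>I. \<omega> j = ?sw y j) =
      q powi sgn (y (i + 1) - y i) * \<P>(\<omega> in M0. \<forall>j\<in>I. \<omega> j = y j)"
    using sets_eq_imp_space_eq[OF sets_M0] by (simp add: cyl_def)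
qed

end

section \<open>Uniqueness\<close>

text \<open>
  Cylinders form a generator that is closed under intersection, because two of them are either
  compatible or disjoint. So probabilities of cylinders determine a law on permutations.
\<close>

lemma sets_perm_space_cylinders:
  "sets perm_space = sigma_sets {\<omega>. bij \<omega>} {cyl I y | I y. finite I}" (is "_ = sigma_sets ?\<Omega> ?E")
proof
  have E: "?E \<subseteq> Pow ?\<Omega>" by (auto simp: cyl_def)
  have "id \<in> measurable (sigma ?\<Omega> ?E) perm_space"
  proof (rule measurable_to_perm_space)
    fix i
    show "(\<lambda>s. id s i) \<in> measurable (sigma ?\<Omega> ?E) (count_space UNIV)"
    proof (subst measurable_count_space_eq2_countable, intro conjI ballI)
      fix v
      have "(\<lambda>s. id s i) -` {v} \<inter> space (sigma ?\<Omega> ?E) = cyl {i} (\<lambda>_. v)"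
        using E by (auto simp: cyl_def space_measure_of_conv)
      also have "\<dots> \<in> sets (sigma ?\<Omega> ?E)" using E by (auto simp: sets_measure_of)
      finally show "(\<lambda>s. id s i) -` {v} \<inter> space (sigma ?\<Omega> ?E) \<in> sets (sigma ?\<Omega> ?E)" .
    qed auto
  qed (use E in \<open>auto simp: space_measure_of_conv\<close>)
  then have "X \<in> sets (sigma ?\<Omega> ?E)" if "X \<in> sets perm_space" for X
    using measurable_sets[of id "sigma ?\<Omega> ?E" perm_space X] that sets.sets_into_space[OF that] E
    by (simp add: space_measure_of_conv Int_absorb2)
  then show "sets perm_space \<subseteq> sigma_sets ?\<Omega> ?E" using E by (auto simp: sets_measure_of)
  have "?E \<subseteq> sets perm_space" by auto
  then show "sigma_sets ?\<Omega> ?E \<subseteq> sets perm_space"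
    using sets.sigma_sets_subset[of ?E perm_space] by simp
qed

lemma perm_measure_eqI:
  assumes "prob_space M" and M: "sets M = sets perm_space"
    and N: "sets N = sets perm_space"
    and eq: "\<And>I y. finite I \<Longrightarrow> emeasure M (cyl I y) = emeasure N (cyl I y)"
  shows "M = N"
proof (rule measure_eqI_generator_eq)
  let ?E = "{cyl I y | I y. finite I}"
  interpret prob_space M by fact
  show "Int_stable ?E"
    unfolding Int_stable_def
  proof safe
    fix I J :: "int set" and y z
    assume fin: "finite I" "finite J"
    show "\<exists>K w. cyl I y \<inter> cyl J z = cyl K w \<and> finite K"
    proof (cases "\<forall>j\<in>I \<inter> J. y j = z j")
      case True
      then have "cyl I y \<inter> cyl J z = cyl (I \<union> J) (\<lambda>j. if j \<in> I then y j else z j)"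
        by (auto simp: cyl_def)
      then show ?thesis using fin by blast
    next
      case False
      have "cyl {0, 1} (\<lambda>_. 0) = {}" by (auto simp: cyl_def dest!: bij_is_inj) (metis injD zero_neq_one)
      moreover have "cyl I y \<inter> cyl J z = {}" using False by (auto simp: cyl_def)
      ultimately show ?thesis by (metis finite.simps)
    qed
  qed
  show "?E \<subseteq> Pow {\<omega>. bij \<omega>}" by (auto simp: cyl_def)
  show "emeasure M X = emeasure N X" if "X \<in> ?E" for X using that eq by auto
  show "sets M = sigma_sets {\<omega>. bij \<omega>} ?E" "sets N = sigma_sets {\<omega>. bij \<omega>} ?E"
    using M N sets_perm_space_cylinders by auto
  show "range (\<lambda>n::nat. cyl {} id) \<subseteq> ?E" by auto
  show "(\<Union>n::nat. cyl {} id) = {\<omega>. bij \<omega>}" by (auto simp: cyl_def)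
  show "emeasure M (cyl {} id) \<noteq> \<infinity>" for n :: nat by (simp add: emeasure_eq_measure)
qed

text \<open>
  Without a descent \<open>z i - i\<close> would be nondecreasing, but it is nonnegative at the left end and
  nonpositive at the right end of the interval.
\<close>

lemma permutes_interval_descent:
  fixes z :: "int \<Rightarrow> int"
  assumes z: "z permutes {a..b}" and "z \<noteq> id"
  shows "\<exists>i. a \<le> i \<and> i < b \<and> z (i + 1) < z i"
proof (rule ccontr)
  assume no: "\<not> ?thesis"
  have asc: "z i + 1 \<le> z (i + 1)" if "a \<le> i" "i < b" for i
  proof -
    have "z i \<noteq> z (i + 1)" using permutes_inj[OF z] by (auto dest!: injD)
    then show ?thesis using no that by (metis linorder_neqE_linordered_idom zless_iff_Suc_zadd
          add1_zle_eq)
  qed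
  have lower: "i \<le> z i" if "a \<le> i" "i \<le> b" for i
    using that
  proof (induction i rule: int_ge_induct)
    case base
    then show ?case using permutes_in_image[OF z, of a] by auto
  next
    case (step i)
    then show ?case using asc[of i] by auto
  qed
  have upper: "z i \<le> i" if "i \<le> b" "a \<le> i" for i
    using that
  proof (induction i rule: int_le_induct)
    case base
    then show ?case using permutes_in_image[OF z, of b] by auto
  next
    case (step i)
    then show ?case using asc[of "i - 1"] by auto
  qed
  have "z i = i" for i
  proof (cases "a \<le> i \<and> i \<le> b")
    case True
    then show ?thesis using lower[of i] upper[of i] by auto
  next
    case False
    then show ?thesis using z by (auto simp: permutes_def)
  qed
  then show False using \<open>z \<noteq> id\<close> by auto
qed

context mallows
begin

text \<open>
  The competitors in the uniqueness statement, apart from balance.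
\<close>

definition exch :: "(int \<Rightarrow> int) measure \<Rightarrow> bool" where
  "exch P \<longleftrightarrow> prob_space P \<and> sets P = sets perm_space \<and> q_exchangeable q P"

lemma space_exch: "exch P \<Longrightarrow> space P = {\<omega>. bij \<omega>}"
  unfolding exch_def using sets_eq_imp_space_eq[of P perm_space] by simp

lemma exch_swap:
  assumes "exch P" "finite I" "i \<in> I" "i + 1 \<in> I" "inj_on y I"
  shows "measure P (cyl I (y(i := y (i + 1), i + 1 := y i))) =
    q powi sgn (y (i + 1) - y i) * measure P (cyl I y)"
proof -
  have "\<P>(\<omega> in P. \<forall>j\<in>I. \<omega> j = (y(i := y (i + 1), i + 1 := y i)) j) =
      q powi sgn (y (i + 1) - y i) * \<P>(\<omega> in P. \<forall>j\<in>I. \<omega> j = y j)"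
    using assms unfolding exch_def q_exchangeable_def by blast
  then show ?thesis unfolding space_exch[OF assms(1)] cyl_def by simp
qed

text \<open>
  Sorting by adjacent transpositions at descents. The factor depends on the signs of the differences
  that are met, hence on the pattern \<open>z\<close> only and neither on the law nor on the values \<open>f\<close>.
  The sum of the squares of \<open>j - z j\<close> decreases in each step.
\<close>

lemma arrangement_ratio:
  fixes a b :: int
  assumes "z permutes {a..b}"
  shows "\<exists>N\<ge>0. \<forall>P f. exch P \<longrightarrow> strict_mono_on {a..b} f \<longrightarrow>
    measure P (cyl {a..b} (f \<circ> z)) = N * measure P (cyl {a..b} f)"
  using assms
proof (induction "nat (\<Sum>j\<in>{a..b}. (j - z j)\<^sup>2)" arbitrary: z rule: less_induct)
  case less
  show ?case
  proof (cases "z = id")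
    case True
    then show ?thesis by (intro exI[of _ 1]) simp
  next
    case False
    from permutes_interval_descent[OF less.prems False]
    obtain i where i: "a \<le> i" "i < b" "z (i + 1) < z i" by blast
    define z' where "z' = z \<circ> Transposition.transpose i (i + 1)"
    have z': "z' permutes {a..b}"
      unfolding z'_def using i less.prems by (intro permutes_compose permutes_swap_id) auto
    have z'_app: "z' i = z (i + 1)" "z' (i + 1) = z i" "\<And>j. j \<noteq> i \<Longrightarrow> j \<noteq> i + 1 \<Longrightarrow> z' j = z j"
      by (auto simp: z'_def Transposition.transpose_def)
    have split: "(\<Sum>j\<in>{a..b}. g j) = g i + (g (i + 1) + (\<Sum>j\<in>{a..b} - {i} - {i + 1}. g j))"
      for g :: "int \<Rightarrow> int"
      using i by (simp add: sum.remove[of "{a..b}" i] sum.remove[of "{a..b} - {i}" "i + 1"])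
    have rest: "(\<Sum>j\<in>{a..b} - {i} - {i + 1}. (j - z' j)\<^sup>2) =
        (\<Sum>j\<in>{a..b} - {i} - {i + 1}. (j - z j)\<^sup>2)"
      using z'_app(3) by (intro sum.cong) auto
    \<comment> \<open>Exchanging a descent lowers the potential by twice its height.\<close>
    have "(\<Sum>j\<in>{a..b}. (j - z' j)\<^sup>2) < (\<Sum>j\<in>{a..b}. (j - z j)\<^sup>2)"
      unfolding split rest z'_app using i(3) by (simp add: power2_eq_square algebra_simps)
    moreover have "0 \<le> (\<Sum>j\<in>{a..b}. (j - z' j)\<^sup>2)" by (intro sum_nonneg) auto
    ultimately have "nat (\<Sum>j\<in>{a..b}. (j - z' j)\<^sup>2) < nat (\<Sum>j\<in>{a..b}. (j - z j)\<^sup>2)" by simp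
    from less.hyps[OF this z'] obtain N where N: "N \<ge> 0"
      "\<And>P f. exch P \<Longrightarrow> strict_mono_on {a..b} f \<Longrightarrow>
        measure P (cyl {a..b} (f \<circ> z')) = N * measure P (cyl {a..b} f)" by blast
    have "measure P (cyl {a..b} (f \<circ> z)) = q * N * measure P (cyl {a..b} f)"
      if P: "exch P" and f: "strict_mono_on {a..b} f" for P f
    proof -
      let ?y = "f \<circ> z'"
      \<comment> \<open>The arrangement is the swap of one without this descent, so that the sign is positive.\<close>
      have eq: "f \<circ> z = ?y(i := ?y (i + 1), i + 1 := ?y i)"
      proof
        fix j show "(f \<circ> z) j = (?y(i := ?y (i + 1), i + 1 := ?y i)) j"
          using z'_app by (cases "j = i"; cases "j = i + 1") auto
      qed
      have im: "z' ` {a..b} = {a..b}" using permutes_image[OF z'] .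
      have inj: "inj_on ?y {a..b}"
        using strict_mono_on_imp_inj_on[OF f] permutes_inj[OF z'] im
        by (intro comp_inj_on) (auto intro: inj_on_subset)
      have "z' i < z' (i + 1)" "z' i \<in> {a..b}" "z' (i + 1) \<in> {a..b}"
        using i z'_app(1,2) permutes_in_image[OF z', of i] permutes_in_image[OF z', of "i + 1"]
        by auto
      then have "sgn (?y (i + 1) - ?y i) = 1" using f by (auto simp: strict_mono_on_def)
      then show ?thesis
        unfolding eq using exch_swap[OF P _ _ _ inj, of i] i N(2)[OF P f] by simp
    qed
    then show ?thesis using N(1) q_pos by (intro exI[of _ "q * N"]) auto
  qed
qed

text \<open>
  Given the set of values on the interval, the arrangement is distributed as the pattern factors
  prescribe. The condition on \<open>f\<close> says that the prescribed values \<open>y j\<close> have the same rank as they would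
  have if the values were the interval itself; thus the event is a condition on the pattern.
\<close>

lemma conditional_constant:
  fixes a b :: int and y :: "int \<Rightarrow> int"
  assumes I: "I \<subseteq> {a..b}"
  shows "\<exists>c\<ge>0. \<forall>P f. exch P \<longrightarrow> strict_mono_on {a..b} f \<longrightarrow>
    (\<forall>j\<in>I. y j \<in> {a..b} \<and> f (y j) = y j) \<longrightarrow>
    measure P (cyl I y \<inter> {\<omega>. bij \<omega> \<and> \<omega> ` {a..b} = f ` {a..b}}) =
      c * measure P {\<omega>. bij \<omega> \<and> \<omega> ` {a..b} = f ` {a..b}}"
proof -
  let ?J = "{a..b}"
  let ?S = "{z. z permutes ?J}"
  let ?T = "{z. z permutes ?J \<and> (\<forall>j\<in>I. z j = y j)}"
  have "\<forall>z\<in>?S. \<exists>N\<ge>0. \<forall>P f. exch P \<longrightarrow> strict_mono_on ?J f \<longrightarrow>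
    measure P (cyl ?J (f \<circ> z)) = N * measure P (cyl ?J f)"
    using arrangement_ratio by blast
  then obtain N where N: "\<And>z. z permutes ?J \<Longrightarrow> 0 \<le> N z"
    "\<And>z P f. z permutes ?J \<Longrightarrow> exch P \<Longrightarrow> strict_mono_on ?J f \<Longrightarrow>
      measure P (cyl ?J (f \<circ> z)) = N z * measure P (cyl ?J f)"
    unfolding bchoice_iff by auto
  have fS: "finite ?S" by (rule finite_permutations) simp
  have TS: "?T \<subseteq> ?S" by auto
  \<comment> \<open>Total factor of the patterns that agree with \<open>y\<close> on \<open>I\<close>, relative to all patterns.\<close>
  define c where "c = sum N ?T / sum N ?S"
  have "c \<ge> 0" unfolding c_def using N(1) by (intro divide_nonneg_nonneg sum_nonneg) auto
  moreover have "measure P (cyl I y \<inter> {\<omega>. bij \<omega> \<and> \<omega> ` ?J = f ` ?J}) =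
      c * measure P {\<omega>. bij \<omega> \<and> \<omega> ` ?J = f ` ?J}"
    if P: "exch P" and f: "strict_mono_on ?J f"
      and fixes_y: "\<And>j. j \<in> I \<Longrightarrow> y j \<in> ?J" "\<And>j. j \<in> I \<Longrightarrow> f (y j) = y j" for P f
  proof -
    interpret prob_space P using P by (simp add: exch_def)
    have inj: "inj_on f ?J" using strict_mono_on_imp_inj_on[OF f] .
    have disj: "disjoint_family_on (\<lambda>z. cyl ?J (f \<circ> z)) ?S"
      unfolding disjoint_family_on_def
    proof (intro ballI impI)
      fix z w assume zw: "z \<in> ?S" "w \<in> ?S" "z \<noteq> w"
      then obtain j where j: "z j \<noteq> w j" by blast
      then have "j \<in> ?J" using zw by (auto simp: permutes_def)
      moreover from this have "f (z j) \<noteq> f (w j)"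
        using zw j inj permutes_in_image[of z ?J j] permutes_in_image[of w ?J j]
        by (auto simp: inj_on_def)
      ultimately show "cyl ?J (f \<circ> z) \<inter> cyl ?J (f \<circ> w) = {}" by (auto simp: cyl_def)
    qed
    have meas: "measure P (\<Union>z\<in>U. cyl ?J (f \<circ> z)) = sum N U * measure P (cyl ?J f)"
      if "U \<subseteq> ?S" for U
    proof -
      have "measure P (\<Union>z\<in>U. cyl ?J (f \<circ> z)) = (\<Sum>z\<in>U. measure P (cyl ?J (f \<circ> z)))"
        using P that fS disj
        by (intro finite_measure_finite_Union)
           (auto simp: exch_def disjoint_family_on_def intro: finite_subset)
      also have "\<dots> = (\<Sum>z\<in>U. N z * measure P (cyl ?J f))"
        using that N(2)[OF _ P f] by (intro sum.cong) auto
      finally show ?thesis by (simp add: sum_distrib_right)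
    qed
    have cover: "\<exists>z. z permutes ?J \<and> (\<forall>j\<in>?J. \<omega> j = f (z j))"
      if w: "bij \<omega>" "\<omega> ` ?J = f ` ?J" for \<omega>
    proof -
      define z where "z j = (if j \<in> ?J then inv_into ?J f (\<omega> j) else j)" for j
      have "bij_betw (inv_into ?J f) (f ` ?J) ?J"
        using inj by (simp add: bij_betw_inv_into inj_on_imp_bij_betw)
      moreover have "bij_betw \<omega> ?J (f ` ?J)"
        using w by (metis bij_betw_subset subset_UNIV)
      ultimately have "bij_betw (inv_into ?J f \<circ> \<omega>) ?J ?J" by (rule bij_betw_trans[rotated])
      then have "bij_betw z ?J ?J"
        by (rule bij_betw_cong[THEN iffD1, rotated]) (simp add: z_def)
      then have "z permutes ?J" by (rule bij_imp_permutes) (auto simp: z_def)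
      moreover have "\<omega> j = f (z j)" if "j \<in> ?J" for j
      proof -
        have "\<omega> j \<in> f ` ?J" using that w(2) by blast
        then show ?thesis using that by (simp add: z_def f_inv_into_f)
      qed
      ultimately show ?thesis by blast
    qed
    have S: "{\<omega>. bij \<omega> \<and> \<omega> ` ?J = f ` ?J} = (\<Union>z\<in>?S. cyl ?J (f \<circ> z))"
    proof (intro equalityI subsetI)
      fix \<omega> assume "\<omega> \<in> (\<Union>z\<in>?S. cyl ?J (f \<circ> z))"
      then obtain z where z: "z permutes ?J" "bij \<omega>" "\<And>j. j \<in> ?J \<Longrightarrow> \<omega> j = f (z j)"
        by (auto simp: cyl_def)
      have "\<omega> ` ?J = f ` z ` ?J" unfolding image_image using z(3) by (rule image_cong[OF refl])
      then show "\<omega> \<in> {\<omega>. bij \<omega> \<and> \<omega> ` ?J = f ` ?J}" using z permutes_image[OF z(1)] by simp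
    next
      fix \<omega> assume "\<omega> \<in> {\<omega>. bij \<omega> \<and> \<omega> ` ?J = f ` ?J}"
      then show "\<omega> \<in> (\<Union>z\<in>?S. cyl ?J (f \<circ> z))" using cover[of \<omega>] by (auto simp: cyl_def)
    qed
    have T: "cyl I y \<inter> {\<omega>. bij \<omega> \<and> \<omega> ` ?J = f ` ?J} = (\<Union>z\<in>?T. cyl ?J (f \<circ> z))"
    proof -
      have "(\<forall>j\<in>I. \<omega> j = y j) \<longleftrightarrow> (\<forall>j\<in>I. z j = y j)"
        if z: "z permutes ?J" and w: "\<omega> \<in> cyl ?J (f \<circ> z)" for \<omega> z
      proof -
        have "\<omega> j = y j \<longleftrightarrow> z j = y j" if j: "j \<in> I" for j
        proof -
          have "\<omega> j = f (z j)" "z j \<in> ?J" using w j I permutes_in_image[OF z, of j]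
            by (auto simp: cyl_def)
          then show ?thesis using fixes_y[OF j] inj by (metis inj_onD)
        qed
        then show ?thesis by blast
      qed
      then show ?thesis unfolding S by (auto simp: cyl_def)
    qed
    have "sum N ?T \<le> sum N ?S" using N(1) by (intro sum_mono2 fS TS) auto
    moreover have "0 \<le> sum N ?T" using N(1) by (intro sum_nonneg) auto
    ultimately have "sum N ?T = c * sum N ?S" unfolding c_def by (cases "sum N ?S = 0") auto
    then show ?thesis unfolding T unfolding S by (simp add: meas[OF TS] meas[OF order.refl])
  qed
  ultimately show ?thesis by blast
qed

end

text \<open>
  The possible sets of values on the interval \<open>{1 - n..n}\<close> for which the rank of every \<open>v\<close> in \<open>{- m..m}\<close>
  is the same as in the interval itself.
\<close>

definition order_rigid :: "int \<Rightarrow> nat \<Rightarrow> int set \<Rightarrow> bool" where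
  "order_rigid m n Y \<longleftrightarrow> (\<exists>f. strict_mono_on {1 - int n..int n} f \<and> f ` {1 - int n..int n} = Y \<and>
     (\<forall>v\<in>{- m..m}. f v = v))"

lemma strict_mono_enumeration:
  fixes Y :: "int set"
  assumes "finite Y" "card Y = 2 * n"
  obtains f where "strict_mono_on {1 - int n..int n} f" "f ` {1 - int n..int n} = Y"
proof
  let ?l = "sorted_list_of_set Y"
  let ?f = "\<lambda>j. ?l ! nat (j + int n - 1)"
  have len: "length ?l = 2 * n" using assms by simp
  show "strict_mono_on {1 - int n..int n} ?f"
  proof (rule strict_mono_onI)
    fix i j assume "i \<in> {1 - int n..int n}" "j \<in> {1 - int n..int n}" "i < j"
    then have "nat (i + int n - 1) < nat (j + int n - 1)" "nat (j + int n - 1) < length ?l"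
      unfolding len by auto
    then show "?f i < ?f j" by (intro sorted_wrt_nth_less[OF strict_sorted_list_of_set])
  qed
  have "(\<lambda>j. nat (j + int n - 1)) ` {1 - int n..int n} = {..<2 * n}"
  proof (intro equalityI subsetI)
    fix k assume "k \<in> {..<2 * n}"
    then show "k \<in> (\<lambda>j. nat (j + int n - 1)) ` {1 - int n..int n}"
      by (intro image_eqI[of _ _ "int k - int n + 1"]) auto
  qed auto
  moreover have "(!) ?l ` {..<2 * n} = Y"
    using nth_image[of "2 * n" ?l] len assms(1) by (simp add: lessThan_atLeast0)
  moreover have "?f ` {1 - int n..int n} =
      (!) ?l ` (\<lambda>j. nat (j + int n - 1)) ` {1 - int n..int n}"
    by (simp only: image_image)
  ultimately show "?f ` {1 - int n..int n} = Y" by simp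
qed

text \<open>
  The rank of \<open>v\<close> in \<open>Y\<close> is found by counting from \<open>0\<close>: exactly \<open>n\<close> elements are nonpositive, and
  between \<open>0\<close> and \<open>v\<close> nothing is missing.
\<close>

lemma order_rigidI:
  assumes Y: "finite Y" "card Y = 2 * n" "card (Y \<inter> {..0}) = n" "{- m..m} \<subseteq> Y"
  shows "order_rigid m n Y"
proof -
  obtain f where f: "strict_mono_on {1 - int n..int n} f" "f ` {1 - int n..int n} = Y"
    using strict_mono_enumeration[OF Y(1,2)] .
  have inY: "x \<in> Y" if "- m \<le> x" "x \<le> m" for x using Y(4) that by auto
  have "f v = v" if v: "v \<in> {- m..m}" for v
  proof -
    have fin: "finite (Y \<inter> {..x})" for x using Y(1) by simp
    obtain j where j: "j \<in> {1 - int n..int n}" "f j = v" using v Y(4) f(2) by blast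
    \<comment> \<open>The rank of \<open>v\<close> in \<open>Y\<close>, once through the enumeration \<open>f\<close> and once by counting from \<open>0\<close>.\<close>
    have "{s\<in>Y. s \<le> f j} = f ` {1 - int n..j}"
    proof (intro equalityI subsetI)
      fix s assume "s \<in> {s\<in>Y. s \<le> f j}"
      then obtain i where i: "i \<in> {1 - int n..int n}" "s = f i" "f i \<le> f j" using f(2) by blast
      have "i \<le> j"
      proof (rule ccontr)
        assume "\<not> i \<le> j"
        then have "f j < f i" using strict_mono_onD[OF f(1) j(1) i(1)] by simp
        then show False using i(3) by simp
      qed
      then show "s \<in> f ` {1 - int n..j}" using i by auto
    next
      fix s assume "s \<in> f ` {1 - int n..j}"
      then obtain i where i: "1 - int n \<le> i" "i \<le> j" "s = f i" by auto
      then have "f i \<le> f j" using j(1) by (intro strict_mono_on_leD[OF f(1)]) auto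
      then show "s \<in> {s\<in>Y. s \<le> f j}" using i j f(2) by auto
    qed
    moreover have "inj_on f {1 - int n..j}"
      using strict_mono_on_imp_inj_on[OF f(1)] j(1) by (auto intro: inj_on_subset)
    ultimately have "int (card {s\<in>Y. s \<le> f j}) = j + int n"
      using j(1) by (simp add: card_image)
    moreover have "int (card {s\<in>Y. s \<le> v}) = v + int n"
    proof (cases "0 \<le> v")
      case True
      have "{s\<in>Y. s \<le> v} = (Y \<inter> {..0}) \<union> {1..v}" using True v inY by auto
      moreover have "card ((Y \<inter> {..0}) \<union> {1..v}) = card (Y \<inter> {..0}) + card {1..v}"
        using fin by (intro card_Un_disjoint) auto
      ultimately show ?thesis using True Y(3) by simp
    next
      case False
      have "Y \<inter> {..0} = {s\<in>Y. s \<le> v} \<union> {v + 1..0}" using False v inY by auto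
      moreover have "card ({s\<in>Y. s \<le> v} \<union> {v + 1..0}) = card {s\<in>Y. s \<le> v} + card {v + 1..0}"
        using Y(1) by (intro card_Un_disjoint) auto
      ultimately show ?thesis using False Y(3) by simp
    qed
    ultimately show ?thesis using j by simp
  qed
  then show ?thesis using f unfolding order_rigid_def by (intro exI[of _ f]) simp
qed

lemma countable_order_rigid: "countable {Y. order_rigid m n Y}"
  by (rule countable_subset[OF _ countable_Collect_finite]) (auto simp: order_rigid_def)

lemma sets_order_rigid:
  "{\<omega>. bij \<omega> \<and> order_rigid m n (\<omega> ` {1 - int n..int n})} \<in> sets perm_space"
proof -
  have "{\<omega>. bij \<omega> \<and> order_rigid m n (\<omega> ` {1 - int n..int n})} =
      (\<Union>Y\<in>{Y. order_rigid m n Y}. {\<omega>. bij \<omega> \<and> \<omega> ` {1 - int n..int n} = Y})" by auto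
  also have "\<dots> \<in> sets perm_space"
    using sets_image countable_order_rigid by (intro sets.countable_UN') auto
  finally show ?thesis .
qed

text \<open>
  Outside the interval \<open>{1 - n..n}\<close> the permutation respects the sign, and all small values are taken
  inside. This increases with \<open>n\<close> and finally captures every balanced permutation.
\<close>

definition settled :: "int \<Rightarrow> nat \<Rightarrow> (int \<Rightarrow> int) set" where
  "settled m n = {\<omega>. bij \<omega> \<and> balanced \<omega> \<and> (\<forall>j>int n. 0 < \<omega> j) \<and> (\<forall>j\<le>- int n. \<omega> j \<le> 0) \<and>
     (\<forall>v\<in>{- m..m}. \<exists>j\<in>{1 - int n..int n}. \<omega> j = v)}"

lemma sets_settled: "settled m n \<in> sets perm_space"
proof -
  have "{\<omega> \<in> space perm_space. balanced \<omega>} \<inter> {\<omega> \<in> space perm_space. (\<forall>j\<in>{int n<..}. 0 < \<omega> j) \<and>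
      (\<forall>j\<in>{..- int n}. \<omega> j \<le> 0) \<and> (\<forall>v\<in>{- m..m}. \<exists>j\<in>{1 - int n..int n}. \<omega> j = v)}
      \<in> sets perm_space"
    by (intro sets.Int sets_balanced) measurable
  also have "{\<omega> \<in> space perm_space. balanced \<omega>} \<inter> {\<omega> \<in> space perm_space. (\<forall>j\<in>{int n<..}. 0 < \<omega> j) \<and>
      (\<forall>j\<in>{..- int n}. \<omega> j \<le> 0) \<and> (\<forall>v\<in>{- m..m}. \<exists>j\<in>{1 - int n..int n}. \<omega> j = v)} = settled m n"
    by (auto simp: settled_def)
  finally show ?thesis .
qed

lemma settled_Suc: "settled m n \<subseteq> settled m (Suc n)"
proof
  fix \<omega> assume w: "\<omega> \<in> settled m n"
  have "\<exists>j\<in>{1 - int (Suc n)..int (Suc n)}. \<omega> j = v" if v: "v \<in> {- m..m}" for v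
  proof -
    obtain j where "j \<in> {1 - int n..int n}" "\<omega> j = v" using w v unfolding settled_def by blast
    then show ?thesis by (intro bexI[of _ j]) auto
  qed
  then show "\<omega> \<in> settled m (Suc n)" using w by (auto simp: settled_def)
qed

lemma Union_settled: "(\<Union>n. settled m n) = {\<omega>. bij \<omega> \<and> balanced \<omega>}"
proof (intro equalityI subsetI)
  fix \<omega> :: "int \<Rightarrow> int" assume "\<omega> \<in> {\<omega>. bij \<omega> \<and> balanced \<omega>}"
  then have w: "bij \<omega>" "balanced \<omega>" by auto
  define F where "F = {j. j > 0 \<and> \<omega> j \<le> 0} \<union> {j. j \<le> 0 \<and> \<omega> j > 0} \<union> inv \<omega> ` {- m..m}"
  have "finite F" using w(2) by (simp add: F_def balanced_def)
  then have "finite (abs ` F)" by simp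
  then obtain b where b: "\<And>x. x \<in> F \<Longrightarrow> \<bar>x\<bar> \<le> b"
    by (metis bdd_above_finite bdd_above.unfold imageI)
  define n where "n = nat (b + 1)"
  have n: "- int n < x \<and> x < int n" if "x \<in> F" for x using b[OF that] by (auto simp: n_def)
  have "0 < \<omega> j" if "j > int n" for j
  proof (rule ccontr)
    assume "\<not> 0 < \<omega> j"
    then have "j \<in> F" using that by (auto simp: F_def)
    then show False using n that by force
  qed
  moreover have "\<omega> j \<le> 0" if "j \<le> - int n" for j
  proof (rule ccontr)
    assume "\<not> \<omega> j \<le> 0"
    then have "j \<in> F" using that by (auto simp: F_def)
    then show False using n that by force
  qed
  moreover have "\<exists>j\<in>{1 - int n..int n}. \<omega> j = v" if "v \<in> {- m..m}" for v
  proof (intro bexI)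
    show "\<omega> (inv \<omega> v) = v" using w(1) by (simp add: bij_is_surj surj_f_inv_f)
    have "inv \<omega> v \<in> F" using that by (simp add: F_def)
    then show "inv \<omega> v \<in> {1 - int n..int n}" using n by force
  qed
  ultimately have "\<omega> \<in> settled m n" using w by (auto simp: settled_def)
  then show "\<omega> \<in> (\<Union>n. settled m n)" by blast
qed (auto simp: settled_def)

text \<open>
  All sign violations happen inside the interval, and balance says that those to the left are as many
  as those to the right. So the number of nonpositive values taken in the interval is \<open>n\<close>.
\<close>

lemma settled_order_rigid:
  assumes w: "\<omega> \<in> settled m n"
  shows "order_rigid m n (\<omega> ` {1 - int n..int n})"
proof (rule order_rigidI)
  let ?J = "{1 - int n..int n}"
  let ?P = "{j. j > 0 \<and> \<omega> j \<le> 0}" and ?N = "{j. j \<le> 0 \<and> \<omega> j > 0}"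
  have inj: "inj_on \<omega> S" for S using w by (auto simp: settled_def bij_def intro: inj_on_subset)
  show "finite (\<omega> ` ?J)" by simp
  show "card (\<omega> ` ?J) = 2 * n" by (simp add: card_image inj)
  show "{- m..m} \<subseteq> \<omega> ` ?J"
  proof
    fix v assume "v \<in> {- m..m}"
    then obtain j where "j \<in> ?J" "\<omega> j = v" using w unfolding settled_def by blast
    then show "v \<in> \<omega> ` ?J" by blast
  qed
  have fin: "finite ?P" "finite ?N" "card ?P = card ?N"
    using w by (auto simp: settled_def balanced_def)
  have out: "\<And>j. j > int n \<Longrightarrow> 0 < \<omega> j" "\<And>j. j \<le> - int n \<Longrightarrow> \<omega> j \<le> 0"
    using w by (auto simp: settled_def)
  have sub: "?N \<subseteq> {1 - int n..0}"
  proof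
    fix j assume "j \<in> ?N"
    then show "j \<in> {1 - int n..0}" using out(2)[of j] by force
  qed
  have P: "?P \<subseteq> {1..int n}"
  proof
    fix j assume "j \<in> ?P"
    then show "j \<in> {1..int n}" using out(1)[of j] by force
  qed
  \<comment> \<open>Places with nonpositive values: those in the left half without the \<open>?N\<close>, and the \<open>?P\<close>.\<close>
  have "\<omega> ` ?J \<inter> {..0} = \<omega> ` (({1 - int n..0} - ?N) \<union> ?P)" using P by force
  then have "card (\<omega> ` ?J \<inter> {..0}) = card (({1 - int n..0} - ?N) \<union> ?P)"
    by (simp add: card_image inj)
  also have "\<dots> = card ({1 - int n..0} - ?N) + card ?P"
    using fin by (intro card_Un_disjoint) auto
  also have "card ({1 - int n..0} - ?N) = n - card ?N"
    using fin sub by (simp add: card_Diff_subset)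
  also have "n - card ?N + card ?P = n"
    using card_mono[OF _ sub] fin(3) by simp
  finally show "card (\<omega> ` ?J \<inter> {..0}) = n" .
qed

context mallows
begin

lemma rigid_conditional_constant:
  assumes I: "I \<subseteq> {1 - int n..int n}" and y: "\<And>j. j \<in> I \<Longrightarrow> y j \<in> {- m..m}"
    and mn: "m < int n"
  shows "\<exists>c. \<forall>P. exch P \<longrightarrow>
    measure P (cyl I y \<inter> {\<omega>. bij \<omega> \<and> order_rigid m n (\<omega> ` {1 - int n..int n})}) =
      c * measure P {\<omega>. bij \<omega> \<and> order_rigid m n (\<omega> ` {1 - int n..int n})}"
proof -
  let ?J = "{1 - int n..int n}"
  let ?G = "{\<omega>. bij \<omega> \<and> order_rigid m n (\<omega> ` ?J)}"
  let ?R = "{Y. order_rigid m n Y}"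
  let ?E = "\<lambda>Y. {\<omega>. bij \<omega> \<and> \<omega> ` ?J = Y}"
  have G: "?G = (\<Union>Y\<in>?R. ?E Y)" by auto
  obtain c where c: "c \<ge> 0" "\<And>P f. exch P \<Longrightarrow> strict_mono_on ?J f \<Longrightarrow>
      (\<forall>j\<in>I. y j \<in> ?J \<and> f (y j) = y j) \<Longrightarrow>
      measure P (cyl I y \<inter> ?E (f ` ?J)) = c * measure P (?E (f ` ?J))"
    using conditional_constant[OF I, of y] by blast
  have "measure P (cyl I y \<inter> ?G) = c * measure P ?G" if P: "exch P" for P
  proof -
    interpret prob_space P using P by (simp add: exch_def)
    have sP: "sets P = sets perm_space" using P by (simp add: exch_def)
    have one: "emeasure P (cyl I y \<inter> ?E Y) = ennreal c * emeasure P (?E Y)" if Y: "order_rigid m n Y" for Y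
    proof -
      obtain f where f: "strict_mono_on ?J f" "f ` ?J = Y" "\<And>v. v \<in> {- m..m} \<Longrightarrow> f v = v"
        using Y by (auto simp: order_rigid_def)
      have "\<forall>j\<in>I. y j \<in> ?J \<and> f (y j) = y j" using y f(3) mn by fastforce
      from c(2)[OF P f(1) this] show ?thesis
        unfolding f(2) emeasure_eq_measure using c(1) by (simp add: ennreal_mult)
    qed
    have "emeasure P (cyl I y \<inter> ?G) = emeasure P (\<Union>Y\<in>?R. cyl I y \<inter> ?E Y)"
      by (rule arg_cong[of _ _ "emeasure P"]) auto
    also have "\<dots> = (\<integral>\<^sup>+Y. emeasure P (cyl I y \<inter> ?E Y) \<partial>count_space ?R)"
      by (rule emeasure_UN_countable)
         (use countable_order_rigid sets_image in \<open>auto simp: sP disjoint_family_on_def intro!: sets.Int\<close>)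
    also have "\<dots> = (\<integral>\<^sup>+Y. ennreal c * emeasure P (?E Y) \<partial>count_space ?R)"
      using one by (intro nn_integral_cong) simp
    also have "\<dots> = ennreal c * (\<integral>\<^sup>+Y. emeasure P (?E Y) \<partial>count_space ?R)"
      by (rule nn_integral_cmult) simp
    also have "(\<integral>\<^sup>+Y. emeasure P (?E Y) \<partial>count_space ?R) = emeasure P ?G"
      unfolding G by (rule emeasure_UN_countable[symmetric])
         (use countable_order_rigid sets_image in \<open>auto simp: sP disjoint_family_on_def\<close>)
    finally show ?thesis using c(1) by (simp add: measure_def enn2real_mult)
  qed
  then show ?thesis by blast
qed

text \<open>
  On the event that the set of values on \<open>{1 - n..n}\<close> is order rigid, the conditional probability of the
  cylinder is a number \<open>c n\<close> that is the same for all laws, and the probability of the event tends to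
  \<open>1\<close>.
\<close>

lemma cylinder_probability_determined:
  assumes I: "finite I"
  shows "\<exists>c :: nat \<Rightarrow> real. \<forall>P. exch P \<and> (AE \<omega> in P. balanced \<omega>) \<longrightarrow>
    c \<longlonglongrightarrow> measure P (cyl I y)"
proof -
  have "finite (abs ` (I \<union> y ` I))" using I by simp
  then obtain m where m: "\<And>x. x \<in> I \<union> y ` I \<Longrightarrow> \<bar>x\<bar> \<le> m"
    by (metis bdd_above_finite bdd_above.unfold imageI)
  let ?G = "\<lambda>n. {\<omega>. bij \<omega> \<and> order_rigid m n (\<omega> ` {1 - int n..int n})}"
  have "\<exists>c. m < int n \<longrightarrow> (\<forall>P. exch P \<longrightarrow> measure P (cyl I y \<inter> ?G n) = c * measure P (?G n))" for n
  proof (cases "m < int n")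
    case True
    have "I \<subseteq> {1 - int n..int n}"
    proof
      fix x assume "x \<in> I"
      then show "x \<in> {1 - int n..int n}" using m[of x] True by auto
    qed
    moreover have "y j \<in> {- m..m}" if "j \<in> I" for j using m[of "y j"] that by auto
    ultimately show ?thesis using rigid_conditional_constant[OF _ _ True] by blast
  qed simp
  then have "\<exists>c. \<forall>n. m < int n \<longrightarrow>
      (\<forall>P. exch P \<longrightarrow> measure P (cyl I y \<inter> ?G n) = c n * measure P (?G n))"
    by (intro choice allI)
  then obtain c where c: "\<And>n P. m < int n \<Longrightarrow> exch P \<Longrightarrow>
      measure P (cyl I y \<inter> ?G n) = c n * measure P (?G n)"
    by blast
  have "c \<longlonglongrightarrow> measure P (cyl I y)" if P: "exch P" and bal: "AE \<omega> in P. balanced \<omega>" for P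
  proof -
    interpret prob_space P using P by (simp add: exch_def)
    have sP: "sets P = sets perm_space" using P by (simp add: exch_def)
    have ev: "eventually (\<lambda>n. m < int n) sequentially"
      using eventually_gt_at_top[of "nat m"] by eventually_elim auto
    have sG: "?G n \<in> sets P" for n
      unfolding sP by (rule sets_order_rigid)
    have "(\<lambda>n. measure P (settled m n)) \<longlonglongrightarrow> measure P (\<Union>n. settled m n)"
      using settled_Suc sets_settled
      by (intro finite_Lim_measure_incseq) (auto simp: sP intro!: incseq_SucI)
    also have "measure P (\<Union>n. settled m n) = 1"
      unfolding Union_settled using bal sets_balanced
      by (subst prob_eq_1) (auto simp: sP space_exch[OF P] elim!: AE_mp)
    finally have settled: "(\<lambda>n. measure P (settled m n)) \<longlonglongrightarrow> 1" .
    have G1: "(\<lambda>n. measure P (?G n)) \<longlonglongrightarrow> 1"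
    proof (rule tendsto_sandwich[OF _ _ settled tendsto_const])
      show "eventually (\<lambda>n. measure P (settled m n) \<le> measure P (?G n)) sequentially"
      proof (intro always_eventually allI)
        fix n
        have "settled m n \<subseteq> ?G n" using settled_order_rigid by (auto simp: settled_def)
        then show "measure P (settled m n) \<le> measure P (?G n)"
          using sG by (rule finite_measure_mono)
      qed
    qed (simp add: prob_le_1)
    have "(\<lambda>n. measure P (cyl I y \<inter> ?G n)) \<longlonglongrightarrow> measure P (cyl I y)"
    proof (rule tendsto_sandwich)
      show "eventually (\<lambda>n. measure P (cyl I y) - (1 - measure P (?G n)) \<le>
          measure P (cyl I y \<inter> ?G n)) sequentially"
      proof (intro always_eventually allI)
        fix n
        have "measure P (cyl I y) \<le> measure P ((cyl I y \<inter> ?G n) \<union> (space P - ?G n))"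
        proof (rule finite_measure_mono)
          show "cyl I y \<inter> ?G n \<union> (space P - ?G n) \<in> sets P"
            using sG by (intro sets.Un sets.Int sets.compl_sets) (simp_all add: sP)
        qed (auto simp: space_exch[OF P] cyl_def)
        also have "\<dots> \<le> measure P (cyl I y \<inter> ?G n) + measure P (space P - ?G n)"
          using sG by (intro measure_Un_le sets.Int sets.compl_sets) (simp_all add: sP)
        finally show "measure P (cyl I y) - (1 - measure P (?G n)) \<le>
            measure P (cyl I y \<inter> ?G n)" using prob_compl[OF sG] by simp
      qed
      show "eventually (\<lambda>n. measure P (cyl I y \<inter> ?G n) \<le> measure P (cyl I y)) sequentially"
        by (intro always_eventually allI finite_measure_mono) (auto simp: sP)
      show "(\<lambda>n. measure P (cyl I y) - (1 - measure P (?G n))) \<longlonglongrightarrow> measure P (cyl I y)"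
        by (rule tendsto_eq_intros G1 refl | simp)+
    qed simp
    then have "(\<lambda>n. measure P (cyl I y \<inter> ?G n) / measure P (?G n)) \<longlonglongrightarrow> measure P (cyl I y) / 1"
      using G1 by (intro tendsto_divide) auto
    moreover have "eventually (\<lambda>n. measure P (cyl I y \<inter> ?G n) / measure P (?G n) = c n) sequentially"
      using ev order_tendstoD(1)[OF G1 zero_less_one]
      by eventually_elim (use c[OF _ P] in auto)
    ultimately show ?thesis by (simp add: filterlim_cong)
  qed
  then show ?thesis by blast
qed

lemma balanced_exch_unique:
  assumes P: "exch P" "AE \<omega> in P. balanced \<omega>" and Q: "exch Q" "AE \<omega> in Q. balanced \<omega>"
  shows "P = Q"
proof (rule perm_measure_eqI)
  show "prob_space P" "sets P = sets perm_space" "sets Q = sets perm_space"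
    using P Q by (auto simp: exch_def)
  interpret P: prob_space P using P by (simp add: exch_def)
  interpret Q: prob_space Q using Q by (simp add: exch_def)
  fix I :: "int set" and y assume "finite I"
  from cylinder_probability_determined[OF this, of y] obtain c where
    "c \<longlonglongrightarrow> measure P (cyl I y)" "c \<longlonglongrightarrow> measure Q (cyl I y)"
    using P Q by blast
  then have "measure P (cyl I y) = measure Q (cyl I y)" by (rule LIMSEQ_unique)
  then show "emeasure P (cyl I y) = emeasure Q (cyl I y)"
    by (simp add: P.emeasure_eq_measure Q.emeasure_eq_measure)
qed

lemma exch_M0: "exch M0"
  using prob_space_M0 q_exchangeable_M0 by (simp add: exch_def)

lemma mallows_balanced_eq: "mallows_balanced q = M0"
  unfolding mallows_balanced_def
proof (rule the_equality)
  show "prob_space M0 \<and> sets M0 = sets perm_space \<and> q_exchangeable q M0 \<and> (AE \<sigma> in M0. balanced \<sigma>)"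
    using exch_M0 AE_balanced_M0 by (simp add: exch_def)
  fix M :: "(int \<Rightarrow> int) measure"
  assume "prob_space M \<and> sets M = sets perm_space \<and> q_exchangeable q M \<and> (AE \<sigma> in M. balanced \<sigma>)"
  then show "M = M0"
    using exch_M0 AE_balanced_M0 by (intro balanced_exch_unique) (simp_all add: exch_def)
qed

end

context mallows
begin

section \<open>Homogeneity of the displacements\<close>

definition conj_shift :: "(int \<Rightarrow> int) \<Rightarrow> int \<Rightarrow> int" where
  "conj_shift \<omega> = (\<lambda>j. \<omega> (j + 1) - 1)"

lemma bij_conj_shift:
  assumes "bij \<omega>"
  shows "bij (conj_shift \<omega>)"
proof -
  have 1: "bij (\<lambda>j::int. j + 1)" by (rule bij_betw_byWitness[where f' = "\<lambda>j. j - 1"]) auto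
  have 2: "bij (\<lambda>j::int. j - 1)" by (rule bij_betw_byWitness[where f' = "\<lambda>j. j + 1"]) auto
  have "bij ((\<lambda>j. j - 1) \<circ> (\<omega> \<circ> (\<lambda>j. j + 1)))" by (intro bij_comp 1 2 assms)
  then show ?thesis by (simp add: conj_shift_def o_def)
qed

text \<open>
  Moving the cut by one place adds the value \<open>\<omega> 1\<close> to the diagram and raises the charge by one; lowering
  all values by one takes it back.
\<close>

lemma balanced_conj_shift:
  assumes w: "bij \<omega>" and bal: "balanced \<omega>"
  shows "balanced (conj_shift \<omega>)"
proof -
  let ?A = "\<omega> ` {..0}"
  have A: "maya ?A" "charge ?A = 0" using balanced_iff_charge[OF w] bal by auto
  have "\<omega> 1 \<notin> ?A" using bij_is_inj[OF w] by (auto dest!: injD)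
  note ins = maya_insert[OF A(1), of "\<omega> 1"] charge_energy_insert(1)[OF A(1) this]
  have "(\<lambda>j. j + 1) ` {..0} = insert 1 {..0::int}"
    by (auto simp: image_iff intro!: bexI[of _ "_ - 1"])
  then have "(\<lambda>x. x - 1) ` \<omega> ` (\<lambda>j. j + 1) ` {..0} = (+) (- 1) ` insert (\<omega> 1) ?A"
    by (simp add: add.commute)
  then have "conj_shift \<omega> ` {..0} = (+) (- 1) ` insert (\<omega> 1) ?A"
    by (simp add: conj_shift_def image_image)
  then show ?thesis
    using balanced_iff_charge[OF bij_conj_shift[OF w]] maya_shift[OF ins(1), of "- 1"]
      charge_energy_shift(1)[OF ins(1), of "- 1"] ins(2) A(2) by simp
qed

lemma measurable_conj_shift: "conj_shift \<in> measurable perm_space perm_space"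
proof (rule measurable_to_perm_space)
  fix i
  have "(\<lambda>\<omega>. \<omega> (i + 1) - 1) \<in> measurable perm_space (count_space UNIV)"
    by (rule measurable_compose[OF measurable_perm_component]) simp
  then show "(\<lambda>\<omega>. conj_shift \<omega> i) \<in> measurable perm_space (count_space UNIV)"
    by (simp add: conj_shift_def)
qed (simp add: bij_conj_shift)

text \<open>
  Conjugation with the shift preserves exchangeability and balance, so uniqueness applies.
\<close>

lemma M0_conj_shift_invariant: "distr M0 perm_space conj_shift = M0"
proof (rule balanced_exch_unique[OF _ _ exch_M0 AE_balanced_M0])
  let ?D = "distr M0 perm_space conj_shift"
  have meas: "conj_shift \<in> measurable M0 perm_space"
    using measurable_conj_shift by (simp add: measurable_cong_sets[OF sets_M0 refl])
  have cyl: "measure ?D (cyl I y) = measure M0 (cyl ((+) 1 ` I) (\<lambda>j. y (j - 1) + 1))" for I y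
  proof -
    have "conj_shift -` cyl I y \<inter> space M0 = cyl ((+) 1 ` I) (\<lambda>j. y (j - 1) + 1)"
      unfolding space_exch[OF exch_M0] cyl_def using bij_conj_shift
      by (auto simp: conj_shift_def algebra_simps)
    then show ?thesis by (simp add: measure_distr[OF meas sets_cyl])
  qed
  have "q_exchangeable q ?D"
    unfolding q_exchangeable_def
  proof (intro allI impI)
    fix i I and y :: "int \<Rightarrow> int"
    assume A: "finite I \<and> i \<in> I \<and> i + 1 \<in> I \<and> inj_on y I"
    let ?y = "\<lambda>j. y (j - 1) + 1"
    have eq: "(\<lambda>j. (y(i := y (i + 1), i + 1 := y i)) (j - 1) + 1) =
        ?y(i + 1 := ?y (i + 1 + 1), i + 1 + 1 := ?y (i + 1))"
      by (rule ext) (simp add: add.commute)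
    have "inj_on ?y ((+) 1 ` I)" using A by (auto simp: inj_on_def)
    then have "measure ?D (cyl I (y(i := y (i + 1), i + 1 := y i))) =
        q powi sgn (y (i + 1) - y i) * measure ?D (cyl I y)"
      unfolding cyl eq using A
      by (subst exch_swap[OF exch_M0]) (auto simp: add.commute)
    then show "\<P>(\<omega> in ?D. \<forall>j\<in>I. \<omega> j = (y(i := y (i + 1), i + 1 := y i)) j) =
        q powi sgn (y (i + 1) - y i) * \<P>(\<omega> in ?D. \<forall>j\<in>I. \<omega> j = y j)"
      by (simp add: cyl_def)
  qed
  then show "exch ?D"
    using prob_space.prob_space_distr[OF prob_space_M0 meas] by (simp add: exch_def)
  have "AE \<omega> in M0. bij \<omega>" using AE_space[of M0] space_exch[OF exch_M0] by simp
  then have "AE \<omega> in M0. balanced (conj_shift \<omega>)"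
    using AE_balanced_M0 by eventually_elim (rule balanced_conj_shift)
  then show "AE \<omega> in ?D. balanced \<omega>"
    using sets_balanced by (simp add: AE_distr_iff[OF meas])
qed

definition disp_event :: "nat \<Rightarrow> (nat \<Rightarrow> int) \<Rightarrow> int \<Rightarrow> (int \<Rightarrow> int) set" where
  "disp_event k x i = {\<omega>. bij \<omega> \<and> (\<forall>j\<in>{1..k}. displacement \<omega> (i + int j) = x j)}"

lemma disp_event_cyl: "disp_event k x i = cyl {i<..i + int k} (\<lambda>j. x (nat (j - i)) + j)"
proof -
  have "(\<forall>j\<in>{1..k}. \<omega> (i + int j) - (i + int j) = x j) \<longleftrightarrow>
      (\<forall>j\<in>{i<..i + int k}. \<omega> j = x (nat (j - i)) + j)" for \<omega> :: "int \<Rightarrow> int"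
  proof
    assume *: "\<forall>j\<in>{1..k}. \<omega> (i + int j) - (i + int j) = x j"
    show "\<forall>j\<in>{i<..i + int k}. \<omega> j = x (nat (j - i)) + j"
    proof
      fix j assume j: "j \<in> {i<..i + int k}"
      then have "nat (j - i) \<in> {1..k}" by auto
      from bspec[OF * this] j show "\<omega> j = x (nat (j - i)) + j" by simp
    qed
  qed simp
  then show ?thesis by (simp add: disp_event_def displacement_def cyl_def)
qed

lemma M0_displacement_homogeneous:
  "emeasure M0 (disp_event k x i) = emeasure M0 (disp_event k x 0)"
proof -
  have step: "emeasure M0 (disp_event k x i) = emeasure M0 (disp_event k x (i + 1))" for i
  proof -
    have meas: "conj_shift \<in> measurable M0 perm_space"
      using measurable_conj_shift by (simp add: measurable_cong_sets[OF sets_M0 refl])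
    have "emeasure M0 (disp_event k x i) = emeasure (distr M0 perm_space conj_shift) (disp_event k x i)"
      by (simp add: M0_conj_shift_invariant)
    also have "\<dots> = emeasure M0 (conj_shift -` disp_event k x i \<inter> space M0)"
      unfolding disp_event_cyl by (rule emeasure_distr[OF meas sets_cyl])
    also have "conj_shift -` disp_event k x i \<inter> space M0 = disp_event k x (i + 1)"
      unfolding space_exch[OF exch_M0] disp_event_def displacement_def using bij_conj_shift
      by (auto simp: conj_shift_def algebra_simps)
    finally show ?thesis .
  qed
  show ?thesis
  proof (induction i rule: int_induct[where k = 0])
    case (step2 i)
    then show ?case using step[of "i - 1"] by simp
  qed (use step in auto)
qed

lemma emeasure_mallows_shift:
  "emeasure (mallows_shift q c) (disp_event k x i) =
    (\<integral>\<^sup>+A. ennreal (sea_weight A *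
      kern (- A) (map (\<lambda>j. x (Suc j) + (1 + int j) - c) [0..<k])) \<partial>count_space UNIV)"
proof -
  have meas: "(\<lambda>\<sigma> i. \<sigma> i + c) \<in> measurable M0 perm_space"
  proof (rule measurable_to_perm_space)
    fix i
    have "(\<lambda>\<omega>. \<omega> i + c) \<in> measurable perm_space (count_space UNIV)"
      by (rule measurable_compose[OF measurable_perm_component]) simp
    then show "(\<lambda>\<omega>. \<omega> i + c) \<in> measurable M0 (count_space UNIV)"
      by (simp add: measurable_cong_sets[OF sets_M0 refl])
  next
    fix \<omega> assume "\<omega> \<in> space M0"
    then have w: "bij \<omega>" by (simp add: space_exch[OF exch_M0])
    have "bij (\<lambda>j::int. j + c)" by (rule bij_betw_byWitness[where f' = "\<lambda>j. j - c"]) auto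
    then have "bij ((\<lambda>j. j + c) \<circ> \<omega>)" using w by (intro bij_comp)
    then show "bij (\<lambda>i. \<omega> i + c)" by (simp add: o_def)
  qed
  have "(\<lambda>\<sigma> i. \<sigma> i + c) -` disp_event k x i \<inter> space M0 = disp_event k (\<lambda>j. x j - c) i"
    unfolding disp_event_def displacement_def
    using measurable_space[OF meas] by (auto simp: space_exch[OF exch_M0] algebra_simps)
  then have "emeasure (mallows_shift q c) (disp_event k x i) = emeasure M0 (disp_event k (\<lambda>j. x j - c) i)"
    unfolding mallows_shift_def mallows_balanced_eq
    by (subst emeasure_distr[OF meas]) (simp_all add: disp_event_cyl)
  also have "\<dots> = emeasure M0 (disp_event k (\<lambda>j. x j - c) 0)" by (rule M0_displacement_homogeneous)
  also have "\<dots> = (\<integral>\<^sup>+A. ennreal (sea_weight A *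
      kern (- A) (map (\<lambda>j. x (Suc j) + (1 + int j) - c) [0..<k])) \<partial>count_space UNIV)"
    unfolding disp_event_cyl emeasure_M0[OF sets_cyl]
  proof (rule nn_integral_cong)
    fix A
    show "ennreal (sea_weight A) * emeasure (law A) (cyl {0<..0 + int k} (\<lambda>j. x (nat (j - 0)) - c + j)) =
      ennreal (sea_weight A * kern (- A) (map (\<lambda>j. x (Suc j) + (1 + int j) - c) [0..<k]))"
    proof (cases "maya A")
      case True
      have l: "map (\<lambda>j. x (nat (1 + int j - 0)) - c + (1 + int j)) [0..<k] =
          map (\<lambda>j. x (Suc j) + (1 + int j) - c) [0..<k]"
        by (simp add: nat_add_distrib)
      show ?thesis
        using law_cylinder[OF True, of 0 k "\<lambda>j. x (nat (j - 0)) - c + j"]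
        unfolding l by (simp add: ennreal_mult sea_weight_nonneg kern_nonneg)
    qed (simp add: sea_weight_def)
  qed
  finally show ?thesis .
qed

lemma sets_mallows_shift [simp]: "sets (mallows_shift q c) = sets perm_space"
  by (simp add: mallows_shift_def)

text \<open>
  A countable mixture of measures is countably additive, so the premeasure in the definition of the
  product measure is its value on measurable sets.
\<close>

lemma emeasure_mallows_product:
  assumes "X \<in> sets perm_space"
  shows "emeasure (mallows_product q \<alpha>) X =
    (\<integral>\<^sup>+c. ennreal (mallows_weight q \<alpha> c) * emeasure (mallows_shift q c) X \<partial>count_space UNIV)"
  unfolding mallows_product_def
proof (rule emeasure_measure_of_sigma)
  show "sigma_algebra (space perm_space) (sets perm_space)" ..
  show "positive (sets perm_space) (\<lambda>A. \<integral>\<^sup>+c. ennreal (mallows_weight q \<alpha> c) *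
      emeasure (mallows_shift q c) A \<partial>count_space UNIV)"
    by (simp add: positive_def)
  show "countably_additive (sets perm_space) (\<lambda>A. \<integral>\<^sup>+c. ennreal (mallows_weight q \<alpha> c) *
      emeasure (mallows_shift q c) A \<partial>count_space UNIV)"
  proof (rule countably_additiveI)
    fix F :: "nat \<Rightarrow> (int \<Rightarrow> int) set"
    assume F: "range F \<subseteq> sets perm_space" "disjoint_family F" "\<Union>(range F) \<in> sets perm_space"
    have "(\<Sum>n. \<integral>\<^sup>+c. ennreal (mallows_weight q \<alpha> c) * emeasure (mallows_shift q c) (F n) \<partial>count_space UNIV) =
      (\<integral>\<^sup>+c. (\<Sum>n. ennreal (mallows_weight q \<alpha> c) * emeasure (mallows_shift q c) (F n)) \<partial>count_space UNIV)"
      by (rule nn_integral_suminf[symmetric]) simp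
    also have "\<dots> = (\<integral>\<^sup>+c. ennreal (mallows_weight q \<alpha> c) *
        emeasure (mallows_shift q c) (\<Union>(range F)) \<partial>count_space UNIV)"
      using F by (intro nn_integral_cong) (simp add: suminf_emeasure)
    finally show "(\<Sum>n. \<integral>\<^sup>+c. ennreal (mallows_weight q \<alpha> c) * emeasure (mallows_shift q c) (F n) \<partial>count_space UNIV) =
      (\<integral>\<^sup>+c. ennreal (mallows_weight q \<alpha> c) * emeasure (mallows_shift q c) (\<Union>(range F)) \<partial>count_space UNIV)" .
  qed
qed (rule assms)

end

section \<open>The product measure as a sum over all Maya diagrams\<close>

lemma rank_in_shift: "rank_in ((+) c ` C) (c + y) = rank_in C y"
proof -
  have "{m \<in> (+) c ` C. m < c + y} = (+) c ` {m \<in> C. m < y}" by auto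
  then show ?thesis by (simp add: rank_in_def card_image)
qed

lemma maya_shift_iff: "maya ((+) c ` A) \<longleftrightarrow> maya A"
proof
  assume "maya ((+) c ` A)"
  from maya_shift[OF this, of "- c"] show "maya A" by (simp add: image_image)
qed (rule maya_shift)

context mallows
begin

lemma kern_shift: "kern ((+) c ` C) (map ((+) c) ys) = kern C ys"
proof (induction ys arbitrary: C)
  case (Cons y ys)
  have "(+) c ` C - {c + y} = (+) c ` (C - {y})" by auto
  moreover have "step ((+) c ` C) (c + y) = step C y" by (auto simp: step_def rank_in_shift)
  ultimately show ?case using Cons by simp
qed simp

text \<open>
  The weight of a diagram under the product measure before normalisation. The shift by half the charge
  turns the integral energy into the symmetric one.
\<close>

definition fock :: "real \<Rightarrow> int set \<Rightarrow> real" where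
  "fock \<alpha> A = \<alpha> powi charge A * q powr (real (energy A) - real_of_int (charge A) / 2)"

text \<open>
  The odds that \<open>m\<close> belongs to the image of \<open>{..0}\<close>; different \<open>m\<close> are independent by \<open>fock_window\<close>.
\<close>

definition odds :: "real \<Rightarrow> int \<Rightarrow> real" where
  "odds \<alpha> m = \<alpha> * q powr (real_of_int m - 1 / 2)"

definition half_prod :: "real \<Rightarrow> real" where
  "half_prod t = (\<Prod>k. 1 + t * q powr (real k + 1 / 2))"

lemma half_prod_convergence:
  assumes "0 < t"
  shows "(\<lambda>n. \<Prod>k<n. 1 + t * q powr (real k + 1 / 2)) \<longlonglongrightarrow> half_prod t"
    and "0 < half_prod t"
proof -
  have eq: "t * q powr (real k + 1 / 2) = (t * q powr (1 / 2)) * q ^ k" for k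
    using q_pos by (simp add: powr_add powr_realpow)
  have "summable (\<lambda>k. \<bar>t * q powr (real k + 1 / 2)\<bar>)"
    unfolding eq using assms q_pos q_less_1
    by (simp add: abs_mult power_abs summable_mult summable_geometric)
  moreover have pos: "0 < t * q powr (real k + 1 / 2)" for k using assms q_pos by simp
  then have "t * q powr (real k + 1 / 2) \<noteq> - 1" for k
    using pos[of k] by linarith
  ultimately have conv: "convergent_prod (\<lambda>k. 1 + t * q powr (real k + 1 / 2))"
    by (rule summable_imp_convergent_prod_real)
  have "(\<lambda>n. \<Prod>k<Suc n. 1 + t * q powr (real k + 1 / 2)) \<longlonglongrightarrow> half_prod t"
    using convergent_prod_LIMSEQ[OF conv] by (simp add: half_prod_def lessThan_Suc_atMost)
  then show "(\<lambda>n. \<Prod>k<n. 1 + t * q powr (real k + 1 / 2)) \<longlonglongrightarrow> half_prod t"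
    by (rule LIMSEQ_imp_Suc)
  show "0 < half_prod t"
    unfolding half_prod_def using pos by (intro less_0_prodinf conv) (simp add: add_pos_pos)
qed

text \<open>
  Adding \<open>c\<close> to all values shifts a neutral diagram to charge \<open>c\<close> and changes its energy by
  \<open>c * (c + 1) / 2\<close>. With the factor \<open>q powr (c\<^sup>2 / 2)\<close> of the weight, only \<open>- c / 2\<close> remains in the exponent,
  as required by \<open>fock\<close>; the Euler product cancels.
\<close>

lemma product_probability_as_sum:
  fixes x :: "nat \<Rightarrow> int" and k :: nat
  defines "ys \<equiv> map (\<lambda>j. x (Suc j) + (1 + int j)) [0..<k]"
  assumes a: "0 < \<alpha>"
  shows "emeasure (mallows_product q \<alpha>) (disp_event k x i) =
    (\<integral>\<^sup>+B\<in>{B. maya B}. ennreal (fock \<alpha> B * kern (- B) ys / (half_prod \<alpha> * half_prod (inverse \<alpha>)))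
      \<partial>count_space UNIV)"
proof -
  let ?H = "half_prod \<alpha> * half_prod (inverse \<alpha>)"
  have H: "0 < ?H" using half_prod_convergence(2) a by simp
  let ?V = "\<lambda>B. fock \<alpha> B * kern (- B) ys / ?H"
  have V: "0 \<le> ?V B" for B
    using H a q_pos kern_nonneg by (simp add: fock_def)
  have weight: "mallows_weight q \<alpha> c = \<alpha> powi c * q powr ((of_int c)\<^sup>2 / 2) / (euler * ?H)" for c
    by (simp add: mallows_weight_def euler_def half_prod_def mult_ac)
  have inner: "ennreal (mallows_weight q \<alpha> c) * emeasure (mallows_shift q c) (disp_event k x i) =
      (\<integral>\<^sup>+B. ennreal (if maya B \<and> charge B = c then ?V B else 0) \<partial>count_space UNIV)" for c
  proof -
    let ?F = "\<lambda>B. ennreal (if maya B \<and> charge B = c then ?V B else 0)"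
    have bij: "bij_betw (\<lambda>A. (+) c ` A) UNIV UNIV"
      by (rule bij_betw_byWitness[where f' = "\<lambda>A. (+) (- c) ` A"]) (auto simp: image_image)
    have w0: "0 \<le> mallows_weight q \<alpha> c"
      unfolding weight using a q_pos euler_pos H by simp
    have "ennreal (mallows_weight q \<alpha> c) * emeasure (mallows_shift q c) (disp_event k x i) =
        (\<integral>\<^sup>+A. ennreal (mallows_weight q \<alpha> c) * ennreal (sea_weight A *
          kern (- A) (map (\<lambda>j. x (Suc j) + (1 + int j) - c) [0..<k])) \<partial>count_space UNIV)"
      unfolding emeasure_mallows_shift by (rule nn_integral_cmult[symmetric]) simp
    also have "\<dots> = (\<integral>\<^sup>+A. ?F ((+) c ` A) \<partial>count_space UNIV)"
    proof (rule nn_integral_cong)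
      fix A
      let ?zs = "map (\<lambda>j. x (Suc j) + (1 + int j) - c) [0..<k]"
      show "ennreal (mallows_weight q \<alpha> c) * ennreal (sea_weight A * kern (- A) ?zs) = ?F ((+) c ` A)"
      proof (cases "maya A \<and> charge A = 0")
        case True
        note sh = charge_energy_shift[of A c]
        have ys: "ys = map ((+) c) ?zs" by (simp add: ys_def)
        have compl: "- ((+) c ` A) = (+) c ` (- A)" by (rule bij_image_Compl_eq[symmetric]) (simp add: bij_plus)
        have k: "kern (- ((+) c ` A)) ys = kern (- A) ?zs"
          unfolding ys compl by (rule kern_shift)
        have ch: "charge ((+) c ` A) = c" using sh(1) True by simp
        have "2 * int (energy ((+) c ` A)) = 2 * int (energy A) + c * (c + 1)"
          using sh(2) True by simp
        then have "2 * real (energy ((+) c ` A)) = 2 * real (energy A) + of_int c * (of_int c + 1)"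
          by (metis (mono_tags, lifting) of_int_1 of_int_add of_int_mult of_int_numeral of_int_of_nat_eq)
        then have en: "real (energy ((+) c ` A)) - of_int c / 2 = (of_int c)\<^sup>2 / 2 + real (energy A)"
          by (simp add: power2_eq_square field_simps)
        have "mallows_weight q \<alpha> c * (sea_weight A * kern (- A) ?zs) = ?V ((+) c ` A)"
          unfolding weight fock_def ch en k
          using True euler_pos q_pos by (simp add: sea_weight_def powr_add powr_realpow)
        moreover have "0 \<le> sea_weight A * kern (- A) ?zs"
          by (simp add: sea_weight_nonneg kern_nonneg)
        ultimately show ?thesis
          using True ch maya_shift[of A c] w0 by (simp add: ennreal_mult[symmetric])
      next
        case False
        then have "\<not> (maya ((+) c ` A) \<and> charge ((+) c ` A) = c)"
          using charge_energy_shift(1)[of A c] by (auto simp: maya_shift_iff)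
        moreover have "sea_weight A = 0" using False by (simp only: sea_weight_def if_False)
        ultimately show ?thesis by (simp only: if_False) simp
      qed
    qed
    also have "\<dots> = (\<integral>\<^sup>+B. ?F B \<partial>count_space UNIV)"
      by (rule nn_integral_bij_count_space[OF bij])
    finally show ?thesis .
  qed
  have "emeasure (mallows_product q \<alpha>) (disp_event k x i) =
      (\<integral>\<^sup>+c. \<integral>\<^sup>+B. ennreal (if maya B \<and> charge B = c then ?V B else 0) \<partial>count_space UNIV
        \<partial>count_space UNIV)"
    by (subst emeasure_mallows_product) (simp_all add: inner disp_event_cyl[symmetric],
        simp add: disp_event_cyl)
  also have "\<dots> = (\<integral>\<^sup>+B. \<integral>\<^sup>+c. ennreal (if maya B \<and> charge B = c then ?V B else 0)
      \<partial>count_space UNIV \<partial>count_space UNIV)"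
    by (rule nn_integral_count_space_nn_integral[symmetric]) auto
  also have "\<dots> = (\<integral>\<^sup>+B\<in>{B. maya B}. ennreal (?V B) \<partial>count_space UNIV)"
  proof (rule nn_integral_cong)
    fix B
    have "(\<integral>\<^sup>+c. ennreal (if maya B \<and> charge B = c then ?V B else 0) \<partial>count_space UNIV) =
        (\<integral>\<^sup>+c. (ennreal (?V B) * indicator {B. maya B} B) * indicator {charge B} c \<partial>count_space UNIV)"
      by (intro nn_integral_cong) (auto split: split_indicator)
    also have "\<dots> = ennreal (?V B) * indicator {B. maya B} B"
      by (subst nn_integral_cmult_indicator) simp_all
    finally show "(\<integral>\<^sup>+c. ennreal (if maya B \<and> charge B = c then ?V B else 0) \<partial>count_space UNIV) =
        ennreal (?V B) * indicator {B. maya B} B" .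
  qed
  finally show ?thesis .
qed

end

section \<open>Telescoping\<close>

definition above_count :: "int list \<Rightarrow> int \<Rightarrow> nat" where
  "above_count ys m = length (filter (\<lambda>y. m < y) ys)"

lemma prod_powr_same_base: "0 < x \<Longrightarrow> (\<Prod>m\<in>S. x powr f m) = x powr (\<Sum>m\<in>S. f m)" for x :: real
  by (induction S rule: infinite_finite_induct) (auto simp: powr_add)

context mallows
begin

lemma odds_pos: "0 < \<alpha> \<Longrightarrow> 0 < odds \<alpha> m"
  using q_pos by (simp add: odds_def)

lemma odds_shift: "odds \<alpha> m = q ^ n * odds \<alpha> (m - int n)"
proof -
  have "q powr (of_int m - 1 / 2) = q powr real n * q powr (of_int (m - int n) - 1 / 2)"
    by (simp add: powr_add[symmetric])
  then show ?thesis using q_pos by (simp add: odds_def powr_realpow)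
qed

lemma fock_window:
  assumes a: "0 < \<alpha>" and S: "S \<subseteq> {- int n<..int n}"
  shows "fock \<alpha> ({..- int n} \<union> S) = \<alpha> powi (- int n) * q powr ((real n)\<^sup>2 / 2) * (\<Prod>m\<in>S. odds \<alpha> m)"
proof -
  have fin: "finite S" using S finite_subset by blast
  have "2 * real (energy ({..- int n} \<union> S)) = 2 * of_int (\<Sum>S) + real n * (real n - 1)"
    using arg_cong[OF charge_energy_window(2)[OF S], of real_of_int] by simp
  moreover have "(\<Sum>m\<in>S. real_of_int m - 1 / 2) = of_int (\<Sum>S) - real (card S) / 2"
    by (simp add: sum_subtractf)
  ultimately have e: "real (energy ({..- int n} \<union> S)) - real_of_int (charge ({..- int n} \<union> S)) / 2 =
      (real n)\<^sup>2 / 2 + (\<Sum>m\<in>S. of_int m - 1 / 2)"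
    unfolding charge_energy_window(1)[OF S]
    by (simp add: power2_eq_square algebra_simps diff_divide_distrib)
  have "\<alpha> powi charge ({..- int n} \<union> S) = \<alpha> powi (- int n) * \<alpha> ^ card S"
    unfolding charge_energy_window(1)[OF S] using a by (simp add: power_int_diff power_int_minus field_simps)
  moreover have "(\<Prod>m\<in>S. odds \<alpha> m) = \<alpha> ^ card S * q powr (\<Sum>m\<in>S. of_int m - 1 / 2)"
    unfolding odds_def using q_pos by (simp add: prod.distrib prod_powr_same_base)
  ultimately show ?thesis unfolding fock_def e by (simp add: powr_add)
qed

text \<open>
  The finite version of the two infinite products in the normalisation: the factor \<open>1 + odds \<alpha> m\<close> with
  \<open>m \<le> 0\<close> is turned into \<open>1 + inverse (odds \<alpha> m)\<close> by the prefactor.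
\<close>

lemma fock_total_window:
  assumes a: "0 < \<alpha>"
  shows "\<alpha> powi (- int n) * q powr ((real n)\<^sup>2 / 2) * (\<Prod>m\<in>{- int n<..int n}. 1 + odds \<alpha> m) =
    (\<Prod>k<n. 1 + \<alpha> * q powr (real k + 1 / 2)) * (\<Prod>k<n. 1 + inverse \<alpha> * q powr (real k + 1 / 2))"
proof (induction n)
  case (Suc n)
  have set: "{- int (Suc n)<..int (Suc n)} = insert (- int n) (insert (int n + 1) {- int n<..int n})"
    by auto
  have "inverse \<alpha> * q powr (real n + 1 / 2) * (1 + odds \<alpha> (- int n)) =
      1 + inverse \<alpha> * q powr (real n + 1 / 2)"
  proof -
    have "q powr (real n + 1 / 2) * q powr (- real n - 1 / 2) = 1"
      using q_pos by (simp add: powr_add[symmetric])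
    then show ?thesis using a by (simp add: odds_def algebra_simps)
  qed
  moreover have "odds \<alpha> (int n + 1) = \<alpha> * q powr (real n + 1 / 2)"
    by (simp add: odds_def algebra_simps)
  moreover have "\<alpha> powi (- int (Suc n)) * q powr ((real (Suc n))\<^sup>2 / 2) =
      (\<alpha> powi (- int n) * q powr ((real n)\<^sup>2 / 2)) * (inverse \<alpha> * q powr (real n + 1 / 2))"
  proof -
    have "(real (Suc n))\<^sup>2 / 2 = (real n)\<^sup>2 / 2 + (real n + 1 / 2)"
      by (simp add: power2_eq_square field_simps)
    moreover have "\<alpha> powi (- int (Suc n)) = \<alpha> powi (- int n) * inverse \<alpha>"
      by (simp only: power_int_minus power_int_of_nat power_Suc) simp
    ultimately show ?thesis by (simp only: powr_add mult_ac)
  qed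
  ultimately have "\<alpha> powi (- int (Suc n)) * q powr ((real (Suc n))\<^sup>2 / 2) *
      (\<Prod>m\<in>{- int (Suc n)<..int (Suc n)}. 1 + odds \<alpha> m) =
      (\<alpha> powi (- int n) * q powr ((real n)\<^sup>2 / 2) * (\<Prod>m\<in>{- int n<..int n}. 1 + odds \<alpha> m)) *
      (1 + \<alpha> * q powr (real n + 1 / 2)) * (1 + inverse \<alpha> * q powr (real n + 1 / 2))"
    unfolding set by (simp add: mult_ac)
  then show ?case unfolding Suc by (simp add: mult_ac)
qed (use q_pos in simp)

text \<open>
  The number of rivals of a value is the number of smaller values outside the diagram, minus the number
  of those that have been drawn before. If the values increase, all earlier ones count, which gives
  the power \<open>length ys choose 2\<close>. What remains is a product over the places outside the diagram: each
  of them contributes one factor \<open>q\<close> for every larger value in \<open>ys\<close>.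
\<close>

lemma kern_increasing:
  assumes "sorted_wrt (<) ys" "set ys \<subseteq> {L<..U}" "S \<subseteq> {L<..U}"
  shows "kern (- ({..L} \<union> S)) ys * q ^ (length ys choose 2) =
    (if S \<inter> set ys = {} then (1 - q) ^ length ys * (\<Prod>m\<in>{L<..U} - S. q ^ above_count ys m) else 0)"
  using assms
proof (induction ys arbitrary: S)
  case Nil
  then show ?case by (simp add: above_count_def numeral_2_eq_2)
next
  case (Cons y ys)
  let ?W = "{L<..U}" and ?C = "- ({..L} \<union> S)"
  have y: "y \<in> ?W" using Cons.prems by auto
  have later: "y < z" if "z \<in> set ys" for z using Cons.prems(1) that by auto
  show ?case
  proof (cases "y \<in> S")
    case True
    then show ?thesis by (auto simp: step_def)
  next
    case False
    have rem: "?C - {y} = - ({..L} \<union> insert y S)" by auto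
    have IH: "kern (?C - {y}) ys * q ^ (length ys choose 2) =
      (if insert y S \<inter> set ys = {} then (1 - q) ^ length ys *
        (\<Prod>m\<in>?W - insert y S. q ^ above_count ys m) else 0)"
      unfolding rem using Cons.prems y by (intro Cons.IH) auto
    have ny: "y \<notin> set ys" using later by auto
    have "{m \<in> ?C. m < y} = {m \<in> ?W - S. m < y}" using y by auto
    then have r: "rank_in ?C y = card {m \<in> ?W - S. m < y}" by (simp add: rank_in_def)
    have st: "step ?C y = (1 - q) * q ^ card {m \<in> ?W - S. m < y}"
      using False y r by (simp add: step_def)
    have ch: "Suc (length ys) choose 2 = (length ys choose 2) + length ys"
      by (simp add: numeral_2_eq_2)
    have cnt: "above_count (y # ys) m = above_count ys m + (if m < y then 1 else 0)" for m
      by (simp add: above_count_def)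
    have cy: "above_count ys y = length ys"
      using later by (simp add: above_count_def)
    have "(\<Prod>m\<in>?W - S. q ^ above_count (y # ys) m) =
        (\<Prod>m\<in>?W - S. q ^ above_count ys m) * (\<Prod>m\<in>?W - S. if m < y then q else 1)"
      unfolding cnt prod.distrib[symmetric] by (intro prod.cong) (auto simp: power_add)
    also have "(\<Prod>m\<in>?W - S. if m < y then q else 1) = q ^ card {m \<in> ?W - S. m < y}"
      by (simp add: prod.If_cases Int_def)
    also have "(\<Prod>m\<in>?W - S. q ^ above_count ys m) =
        q ^ length ys * (\<Prod>m\<in>?W - insert y S. q ^ above_count ys m)"
    proof -
      have "?W - S = insert y (?W - insert y S)" using y False by auto
      then have "(\<Prod>m\<in>?W - S. q ^ above_count ys m) =
          (\<Prod>m\<in>insert y (?W - insert y S). q ^ above_count ys m)" by (rule arg_cong)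
      also have "\<dots> = q ^ above_count ys y * (\<Prod>m\<in>?W - insert y S. q ^ above_count ys m)"
        by (rule prod.insert) auto
      finally show ?thesis by (simp only: cy)
    qed
    finally have p: "(\<Prod>m\<in>?W - S. q ^ above_count (y # ys) m) = q ^ length ys *
        (\<Prod>m\<in>?W - insert y S. q ^ above_count ys m) * q ^ card {m \<in> ?W - S. m < y}" .
    have "kern ?C (y # ys) * q ^ (length (y # ys) choose 2) =
        step ?C y * q ^ length ys * (kern (?C - {y}) ys * q ^ (length ys choose 2))"
      by (simp add: ch power_add)
    also have "\<dots> = (if S \<inter> set (y # ys) = {} then (1 - q) ^ length (y # ys) *
        (\<Prod>m\<in>?W - S. q ^ above_count (y # ys) m) else 0)"
      unfolding IH st p using False ny by simp
    finally show ?thesis .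
  qed
qed

text \<open>
  The factors that the telescoping product leaves out.
\<close>

primrec denom :: "real \<Rightarrow> int list \<Rightarrow> real" where
  "denom \<alpha> [] = 1"
| "denom \<alpha> (y # ys) =
     (1 + odds \<alpha> (y - int (length ys) - 1)) * (1 + odds \<alpha> (y - int (length ys))) * denom \<alpha> ys"

lemma denom_pos: "0 < \<alpha> \<Longrightarrow> 0 < denom \<alpha> ys"
  using odds_pos[of \<alpha>] by (induction ys) (auto intro!: mult_pos_pos add_pos_pos)

text \<open>
  If \<open>s\<close> of the values exceed \<open>m\<close>, then \<open>odds \<alpha> m + q ^ s = q ^ s * (1 + odds \<alpha> (m - s))\<close>. Along the interval
  \<open>m - s\<close> runs through consecutive integers, except that at each value \<open>y\<close> the place \<open>y\<close> itself is
  absent and \<open>s\<close> drops by one; so two consecutive integers are skipped there, and these are the factors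
  of \<open>denom\<close>.
\<close>

lemma telescoping_product:
  assumes "sorted_wrt (<) ys" "set ys \<subseteq> {L<..U}"
  shows "(\<Prod>m\<in>{L<..U}. (if m \<in> set ys then 0 else odds \<alpha> m) + q ^ above_count ys m) * denom \<alpha> ys =
    (\<Prod>y\<leftarrow>ys. q powi (y - L - 1)) * (\<Prod>m\<in>{L - int (length ys)<..U}. 1 + odds \<alpha> m)"
  using assms
proof (induction ys arbitrary: L)
  case Nil
  then show ?case by (simp add: above_count_def add.commute)
next
  case (Cons y ys)
  let ?k = "int (length ys)"
  let ?t = "\<lambda>ys m. (if m \<in> set ys then 0 else odds \<alpha> m) + q ^ above_count ys m"
  have y: "L < y" "y \<le> U" using Cons.prems by auto
  have later: "y < z" if "z \<in> set ys" for z using Cons.prems(1) that by auto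
  have split: "{L<..U} = {L<..<y} \<union> insert y {y<..U}" using y by auto
  have t0: "(\<Prod>m\<in>{L<..U}. ?t (y # ys) m) =
      (\<Prod>m\<in>{L<..<y}. ?t (y # ys) m) * (?t (y # ys) y * (\<Prod>m\<in>{y<..U}. ?t (y # ys) m))"
    unfolding split by (subst prod.union_disjoint) auto
  have t1: "(\<Prod>m\<in>{y<..U}. ?t (y # ys) m) = (\<Prod>m\<in>{y<..U}. ?t ys m)"
    by (intro prod.cong) (auto simp: above_count_def)
  have "filter (\<lambda>z. y < z) ys = ys" using later by (intro filter_True) auto
  then have t2: "?t (y # ys) y = q ^ length ys" by (simp add: above_count_def)
  have "(\<Prod>m\<in>{L<..<y}. ?t (y # ys) m) =
      (\<Prod>m\<in>{L<..<y}. q ^ Suc (length ys) * (1 + odds \<alpha> (m - int (Suc (length ys)))))"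
  proof (rule prod.cong[OF refl])
    fix m assume m: "m \<in> {L<..<y}"
    have lt: "m < z" if "z \<in> set ys" for z using later[OF that] m by simp
    have "m \<notin> set (y # ys)" using m lt by auto
    moreover have "filter (\<lambda>y. m < y) ys = ys" using lt by (intro filter_True) auto
    ultimately show "?t (y # ys) m = q ^ Suc (length ys) * (1 + odds \<alpha> (m - int (Suc (length ys))))"
      using m odds_shift[of \<alpha> m "Suc (length ys)"] by (simp add: above_count_def algebra_simps)
  qed
  also have "\<dots> = q powi ((?k + 1) * (y - 1 - L)) *
      (\<Prod>m\<in>{L - ?k - 1<..<y - ?k - 1}. 1 + odds \<alpha> m)"
  proof -
    have "(\<Prod>m\<in>{L<..<y}. 1 + odds \<alpha> (m - int (Suc (length ys)))) =
        (\<Prod>m\<in>{L - ?k - 1<..<y - ?k - 1}. 1 + odds \<alpha> m)"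
      by (rule prod.reindex_bij_witness[of _ "\<lambda>m. m + ?k + 1" "\<lambda>m. m - ?k - 1"])
         (auto simp: algebra_simps)
    moreover have "(q ^ Suc (length ys)) ^ card {L<..<y} = q powi ((?k + 1) * (y - 1 - L))"
    proof -
      have "int (Suc (length ys) * card {L<..<y}) = (?k + 1) * (y - 1 - L)"
        using y by (simp add: algebra_simps)
      then show ?thesis by (metis power_int_of_nat power_mult)
    qed
    ultimately show ?thesis by (simp add: prod.distrib del: power_Suc)
  qed
  finally have A: "(\<Prod>m\<in>{L<..U}. ?t (y # ys) m) =
      q powi ((?k + 1) * (y - 1 - L)) * (\<Prod>m\<in>{L - ?k - 1<..<y - ?k - 1}. 1 + odds \<alpha> m) *
      (q ^ length ys * (\<Prod>m\<in>{y<..U}. ?t ys m))"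
    unfolding t0 t1 t2 by (rule arg_cong)
  have IH: "(\<Prod>m\<in>{y<..U}. ?t ys m) * denom \<alpha> ys =
      (\<Prod>z\<leftarrow>ys. q powi (z - y - 1)) * (\<Prod>m\<in>{y - ?k<..U}. 1 + odds \<alpha> m)"
    using Cons.prems later by (intro Cons.IH) auto
  \<comment> \<open>The two integers that are skipped at \<open>y\<close> appear here explicitly.\<close>
  have sets: "{L - int (length (y # ys))<..U} =
      {L - ?k - 1<..<y - ?k - 1} \<union> insert (y - ?k - 1) (insert (y - ?k) {y - ?k<..U})"
    using y by auto
  have B: "(\<Prod>m\<in>{L - int (length (y # ys))<..U}. 1 + odds \<alpha> m) =
      (\<Prod>m\<in>{L - ?k - 1<..<y - ?k - 1}. 1 + odds \<alpha> m) *
      ((1 + odds \<alpha> (y - ?k - 1)) * ((1 + odds \<alpha> (y - ?k)) * (\<Prod>m\<in>{y - ?k<..U}. 1 + odds \<alpha> m)))"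
    unfolding sets by (subst prod.union_disjoint) auto
  have C: "(\<Prod>z\<leftarrow>ys. q powi (z - L - 1)) = (\<Prod>z\<leftarrow>ys. q powi (z - y - 1)) * q powi (?k * (y - L))"
  proof (induction ys)
    case (Cons z zs)
    have zL: "z - L - 1 = (z - y - 1) + (y - L)" by simp
    have "q powi (z - L - 1) = q powi (z - y - 1) * q powi (y - L)"
      unfolding zL using q_pos by (intro power_int_add) simp
    moreover have "q powi (int (length (z # zs)) * (y - L)) = q powi (y - L) * q powi (int (length zs) * (y - L))"
      using q_pos by (simp add: power_int_add[symmetric] algebra_simps)
    ultimately show ?case unfolding list.map prod_list.Cons Cons by (simp add: mult_ac)
  qed simp
  \<comment> \<open>Powers of \<open>q\<close>: \<open>?k + 1\<close> from each place below \<open>y\<close>, and \<open>?k\<close> from \<open>y\<close> itself.\<close>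
  have D: "q powi ((?k + 1) * (y - 1 - L)) * q ^ length ys = q powi (y - L - 1) * q powi (?k * (y - L))"
  proof -
    have "(?k + 1) * (y - 1 - L) + ?k = (y - L - 1) + ?k * (y - L)" by (simp add: algebra_simps)
    then show ?thesis using q_pos by (metis power_int_add power_int_of_nat less_irrefl)
  qed
  have "(\<Prod>m\<in>{L<..U}. ?t (y # ys) m) * denom \<alpha> (y # ys) =
      (q powi ((?k + 1) * (y - 1 - L)) * q ^ length ys) *
      ((\<Prod>m\<in>{y<..U}. ?t ys m) * denom \<alpha> ys) *
      ((\<Prod>m\<in>{L - ?k - 1<..<y - ?k - 1}. 1 + odds \<alpha> m) *
       ((1 + odds \<alpha> (y - ?k - 1)) * (1 + odds \<alpha> (y - ?k))))"
    unfolding A denom.simps by (simp only: mult_ac)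
  also have "\<dots> = (\<Prod>z\<leftarrow>y # ys. q powi (z - L - 1)) *
      (\<Prod>m\<in>{L - int (length (y # ys))<..U}. 1 + odds \<alpha> m)"
    unfolding D IH B list.map prod_list.Cons C by (simp only: mult_ac)
  finally show ?case .
qed

end

context mallows
begin

section \<open>The displacement formula\<close>

text \<open>
  Summing over the subsets of the window expands a product over its places. After telescoping, the total
  weight of the window splits off, and only \<open>length ys\<close> factors at the lower end depend on \<open>n\<close>.
\<close>

lemma window_kernel_sum:
  assumes a: "0 < \<alpha>" and ys: "sorted_wrt (<) ys" "set ys \<subseteq> {- int n<..int n}"
  shows "(\<Sum>A\<in>window n. fock \<alpha> A * kern (- A) ys) =
    (\<Prod>k<n. 1 + \<alpha> * q powr (real k + 1 / 2)) * (\<Prod>k<n. 1 + inverse \<alpha> * q powr (real k + 1 / 2)) *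
    ((1 - q) ^ length ys / (q ^ (length ys choose 2) * denom \<alpha> ys) *
      (\<Prod>y\<leftarrow>ys. q powi (y - 1)) * (\<Prod>l<length ys. q ^ n + odds \<alpha> (- int l)))"
proof -
  let ?W = "{- int n<..int n}" and ?k = "length ys"
  let ?c = "\<alpha> powi (- int n) * q powr ((real n)\<^sup>2 / 2)"
  let ?h = "\<lambda>m. if m \<in> set ys then 0 else odds \<alpha> m"
  have summand: "fock \<alpha> ({..- int n} \<union> S) * kern (- ({..- int n} \<union> S)) ys =
      ?c * (1 - q) ^ ?k / q ^ (?k choose 2) *
      ((\<Prod>m\<in>S. ?h m) * (\<Prod>m\<in>?W - S. q ^ above_count ys m))" if S: "S \<in> Pow ?W" for S
  proof -
    have fin: "finite S" using S finite_subset by blast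
    have k: "kern (- ({..- int n} \<union> S)) ys = (if S \<inter> set ys = {} then (1 - q) ^ ?k *
        (\<Prod>m\<in>?W - S. q ^ above_count ys m) else 0) / q ^ (?k choose 2)"
      using kern_increasing[OF ys, of S] S q_pos by (simp add: field_simps)
    have f: "fock \<alpha> ({..- int n} \<union> S) = ?c * (\<Prod>m\<in>S. odds \<alpha> m)"
      using S by (intro fock_window a) auto
    show ?thesis
    proof (cases "S \<inter> set ys = {}")
      case True
      then have "(\<Prod>m\<in>S. ?h m) = (\<Prod>m\<in>S. odds \<alpha> m)" by (intro prod.cong) auto
      then show ?thesis unfolding f k using True by simp
    next
      case False
      then have "(\<Prod>m\<in>S. ?h m) = 0" using fin by (intro prod_zero) auto
      then show ?thesis unfolding k using False by simp
    qed
  qed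
  have "(\<Sum>A\<in>window n. fock \<alpha> A * kern (- A) ys) =
      (\<Sum>S\<in>Pow ?W. ?c * (1 - q) ^ ?k / q ^ (?k choose 2) *
        ((\<Prod>m\<in>S. ?h m) * (\<Prod>m\<in>?W - S. q ^ above_count ys m)))"
    unfolding sum_window by (rule sum.cong[OF refl summand])
  also have "\<dots> = ?c * (1 - q) ^ ?k / q ^ (?k choose 2) * (\<Prod>m\<in>?W. ?h m + q ^ above_count ys m)"
    unfolding sum_distrib_left[symmetric] by (subst prod_add) simp_all
  also have "(\<Prod>m\<in>?W. ?h m + q ^ above_count ys m) =
      (\<Prod>y\<leftarrow>ys. q powi (y - 1)) * (\<Prod>l<?k. q ^ n + odds \<alpha> (- int l)) *
      (\<Prod>m\<in>?W. 1 + odds \<alpha> m) / denom \<alpha> ys"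
  proof -
    \<comment> \<open>The diverging factor at the lower end of the window is compensated by one \<open>q ^ n\<close> per value.\<close>
    have 1: "(\<Prod>y\<leftarrow>ys. q powi (y - - int n - 1)) = (\<Prod>y\<leftarrow>ys. q powi (y - 1)) * (q ^ n) ^ ?k"
    proof (induction ys)
      case (Cons y ys)
      have eq: "y - - int n - 1 = (y - 1) + int n" by simp
      have "q powi (y - - int n - 1) = q powi (y - 1) * q ^ n"
        unfolding eq using q_pos by (subst power_int_add) auto
      then show ?case using Cons by (simp add: mult_ac)
    qed simp
    have "{- int n - int ?k<..int n} = {- int n - int ?k<..- int n} \<union> ?W" by auto
    then have "(\<Prod>m\<in>{- int n - int ?k<..int n}. 1 + odds \<alpha> m) =
        (\<Prod>m\<in>{- int n - int ?k<..- int n} \<union> ?W. 1 + odds \<alpha> m)" by (rule arg_cong)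
    also have "\<dots> = (\<Prod>m\<in>{- int n - int ?k<..- int n}. 1 + odds \<alpha> m) * (\<Prod>m\<in>?W. 1 + odds \<alpha> m)"
      by (rule prod.union_disjoint) auto
    also have "(\<Prod>m\<in>{- int n - int ?k<..- int n}. 1 + odds \<alpha> m) =
        (\<Prod>l<?k. 1 + odds \<alpha> (- int l - int n))"
      by (rule prod.reindex_bij_witness[of _ "\<lambda>l. - int l - int n" "\<lambda>m. nat (- m - int n)"]) auto
    finally have 2: "(\<Prod>m\<in>{- int n - int ?k<..int n}. 1 + odds \<alpha> m) =
        (\<Prod>l<?k. 1 + odds \<alpha> (- int l - int n)) * (\<Prod>m\<in>?W. 1 + odds \<alpha> m)" .
    have 3: "(q ^ n) ^ ?k * (\<Prod>l<?k. 1 + odds \<alpha> (- int l - int n)) =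
        (\<Prod>l<?k. q ^ n + odds \<alpha> (- int l))"
    proof -
      have "(\<Prod>l<?k. q ^ n + odds \<alpha> (- int l)) =
          (\<Prod>l<?k. q ^ n * (1 + odds \<alpha> (- int l - int n)))"
      proof (rule prod.cong[OF refl])
        fix l
        show "q ^ n + odds \<alpha> (- int l) = q ^ n * (1 + odds \<alpha> (- int l - int n))"
          using odds_shift[of \<alpha> "- int l" n] by (simp add: distrib_left)
      qed
      then show ?thesis by (simp add: prod.distrib)
    qed
    have "(\<Prod>m\<in>?W. ?h m + q ^ above_count ys m) * denom \<alpha> ys =
        (\<Prod>y\<leftarrow>ys. q powi (y - 1)) * ((q ^ n) ^ ?k * (\<Prod>l<?k. 1 + odds \<alpha> (- int l - int n))) *
        (\<Prod>m\<in>?W. 1 + odds \<alpha> m)"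
      unfolding telescoping_product[OF ys] 1 2 by (simp only: mult_ac)
    then show ?thesis unfolding 3 using denom_pos[OF a, of ys] by (simp add: field_simps)
  qed
  finally show ?thesis
    unfolding fock_total_window[OF a, symmetric] by simp
qed

lemma odds_product: "0 < \<alpha> \<Longrightarrow> (\<Prod>l<k. odds \<alpha> (- int l)) = \<alpha> ^ k * q powr (- (real k)\<^sup>2 / 2)"
proof (induction k)
  case (Suc k)
  have "- (real (Suc k))\<^sup>2 / 2 = - (real k)\<^sup>2 / 2 + (- real k - 1 / 2)"
    by (simp add: power2_eq_square field_simps)
  then have "q powr (- (real (Suc k))\<^sup>2 / 2) = q powr (- (real k)\<^sup>2 / 2) * q powr (- real k - 1 / 2)"
    by (simp only: powr_add)
  then show ?case using Suc by (simp add: odds_def)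
qed (use q_pos in simp)

lemma denom_map:
  "denom \<alpha> (map f [a..<a + k]) =
    (\<Prod>j<k. (1 + odds \<alpha> (f (a + j) - int k + int j)) * (1 + odds \<alpha> (f (a + j) - int k + int j + 1)))"
proof (induction k arbitrary: a)
  case (Suc k)
  have upt: "[a..<a + Suc k] = a # [Suc a..<Suc a + k]" by (simp add: upt_conv_Cons del: upt_Suc)
  have "denom \<alpha> (map f [a..<a + Suc k]) =
      (1 + odds \<alpha> (f a - int k - 1)) * (1 + odds \<alpha> (f a - int k)) * denom \<alpha> (map f [Suc a..<Suc a + k])"
    unfolding upt list.map denom.simps by (simp del: upt_Suc)
  also have "\<dots> = (1 + odds \<alpha> (f (a + 0) - int (Suc k) + int 0)) *
      (1 + odds \<alpha> (f (a + 0) - int (Suc k) + int 0 + 1)) *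
      (\<Prod>j<k. (1 + odds \<alpha> (f (a + Suc j) - int (Suc k) + int (Suc j))) *
        (1 + odds \<alpha> (f (a + Suc j) - int (Suc k) + int (Suc j) + 1)))"
    unfolding Suc by (simp add: algebra_simps)
  finally show ?case unfolding prod.lessThan_Suc_shift o_def by simp
qed simp

text \<open>
  In the limit the total weight of the window cancels against the normalisation, and the factors at the
  lower end tend to \<open>odds \<alpha> (- l)\<close>.
\<close>

lemma product_probability:
  fixes x :: "nat \<Rightarrow> int" and k :: nat
  defines "ys \<equiv> map (\<lambda>j. x (Suc j) + (1 + int j)) [0..<k]"
  assumes a: "0 < \<alpha>" and mono: "mono_on {1..k} x"
  shows "emeasure (mallows_product q \<alpha>) (disp_event k x i) =
    ennreal ((1 - q) ^ k / (q ^ (k choose 2) * denom \<alpha> ys) *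
      (\<Prod>y\<leftarrow>ys. q powi (y - 1)) * (\<alpha> ^ k * q powr (- (real k)\<^sup>2 / 2)))"
proof -
  let ?H = "half_prod \<alpha> * half_prod (inverse \<alpha>)"
  let ?D = "\<lambda>n. (\<Prod>k<n. 1 + \<alpha> * q powr (real k + 1 / 2)) *
    (\<Prod>k<n. 1 + inverse \<alpha> * q powr (real k + 1 / 2))"
  let ?e = "(1 - q) ^ k / (q ^ (k choose 2) * denom \<alpha> ys) * (\<Prod>y\<leftarrow>ys. q powi (y - 1))"
  have H: "0 < half_prod \<alpha>" "0 < half_prod (inverse \<alpha>)"
    using half_prod_convergence(2) a by simp_all
  have len: "length ys = k" by (simp add: ys_def)
  have sorted: "sorted_wrt (<) ys"
    unfolding ys_def sorted_wrt_iff_nth_less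
  proof (intro allI impI)
    fix i j assume ij: "i < j" "j < length (map (\<lambda>j. x (Suc j) + (1 + int j)) [0..<k])"
    then have "x (Suc i) \<le> x (Suc j)" by (intro mono_onD[OF mono]) auto
    then show "map (\<lambda>j. x (Suc j) + (1 + int j)) [0..<k] ! i <
        map (\<lambda>j. x (Suc j) + (1 + int j)) [0..<k] ! j" using ij by simp
  qed
  obtain b where b: "\<And>y. y \<in> set ys \<Longrightarrow> \<bar>y\<bar> \<le> b"
    using bdd_above_finite[of "abs ` set ys"] by (auto simp: bdd_above_def)
  have ev: "eventually (\<lambda>n. set ys \<subseteq> {- int n<..int n}) sequentially"
    using eventually_gt_at_top[of "nat b"]
  proof eventually_elim
    case (elim n)
    then have "b < int n" by linarith
    then show ?case using b by fastforce
  qed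
  have lim1: "(\<lambda>n. \<Sum>A\<in>window n. ennreal (fock \<alpha> A * kern (- A) ys / ?H))
      \<longlonglongrightarrow> emeasure (mallows_product q \<alpha>) (disp_event k x i)"
    unfolding product_probability_as_sum[OF a] ys_def by (rule nn_integral_maya_LIMSEQ)
  have "eventually (\<lambda>n. (\<Sum>A\<in>window n. ennreal (fock \<alpha> A * kern (- A) ys / ?H)) =
      ennreal (?D n * (?e * (\<Prod>l<k. q ^ n + odds \<alpha> (- int l))) / ?H)) sequentially"
    using ev
  proof eventually_elim
    case (elim n)
    have "(\<Sum>A\<in>window n. ennreal (fock \<alpha> A * kern (- A) ys / ?H)) =
        ennreal (\<Sum>A\<in>window n. fock \<alpha> A * kern (- A) ys / ?H)"
      using H a q_pos kern_nonneg by (intro sum_ennreal) (simp add: fock_def)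
    also have "(\<Sum>A\<in>window n. fock \<alpha> A * kern (- A) ys / ?H) =
        (\<Sum>A\<in>window n. fock \<alpha> A * kern (- A) ys) / ?H" by (rule sum_divide_distrib[symmetric])
    finally show ?case unfolding window_kernel_sum[OF a sorted elim] len .
  qed
  then have lim2: "(\<lambda>n. ennreal (?D n * (?e * (\<Prod>l<k. q ^ n + odds \<alpha> (- int l))) / ?H))
      \<longlonglongrightarrow> emeasure (mallows_product q \<alpha>) (disp_event k x i)"
    using lim1 by (rule Lim_transform_eventually[rotated])
  have "(\<lambda>n. ennreal (?D n * (?e * (\<Prod>l<k. q ^ n + odds \<alpha> (- int l))) / ?H))
      \<longlonglongrightarrow> ennreal (?H * (?e * (\<Prod>l<k. 0 + odds \<alpha> (- int l))) / ?H)"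
    using H a q_pos q_less_1
    by (intro tendsto_ennrealI tendsto_divide tendsto_mult tendsto_const tendsto_prod tendsto_add
        half_prod_convergence(1) LIMSEQ_realpow_zero) auto
  from LIMSEQ_unique[OF lim2 this] show ?thesis using H odds_product[OF a, of k] by simp
qed

end

theorem theorem1p1:
  fixes q \<alpha> :: real and k :: nat and x :: "nat \<Rightarrow> int" and i :: int
  assumes "0 < q" and "q < 1" and "0 < \<alpha>" and "k \<ge> 1"
    and "mono_on {1..k} x"
  shows "\<P>(\<omega> in mallows_product q \<alpha>. \<forall>j\<in>{1..k}. displacement \<omega> (i + int j) = x j) =
    (1 - q) ^ k * \<alpha> ^ k * q powr (of_int (\<Sum>j=1..k. x j) - (real k)\<^sup>2 / 2) /
    (\<Prod>j=1..k.
       (1 + \<alpha> * q powr (of_int (x j) + 2 * real j - real k - 3 / 2)) *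
       (1 + \<alpha> * q powr (of_int (x j) + 2 * real j - real k - 1 / 2)))"
proof -
  interpret mallows q using assms by unfold_locales
  define ys where "ys = map (\<lambda>j. x (Suc j) + (1 + int j)) [0..<k]"
  let ?den = "\<Prod>j=1..k.
       (1 + \<alpha> * q powr (of_int (x j) + 2 * real j - real k - 3 / 2)) *
       (1 + \<alpha> * q powr (of_int (x j) + 2 * real j - real k - 1 / 2))"
  have "denom \<alpha> ys = (\<Prod>j<k. (1 + odds \<alpha> (x (Suc j) + (1 + int j) - int k + int j)) *
      (1 + odds \<alpha> (x (Suc j) + (1 + int j) - int k + int j + 1)))"
    using denom_map[of \<alpha> "\<lambda>j. x (Suc j) + (1 + int j)" 0 k] by (simp add: ys_def)
  also have "\<dots> = (\<Prod>j<k.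
       (1 + \<alpha> * q powr (of_int (x (Suc j)) + 2 * real (Suc j) - real k - 3 / 2)) *
       (1 + \<alpha> * q powr (of_int (x (Suc j)) + 2 * real (Suc j) - real k - 1 / 2)))"
    unfolding odds_def by (intro prod.cong refl arg_cong2[of _ _ _ _ "(*)"] arg_cong2[of _ _ _ _ "(+)"]
        arg_cong2[of _ _ _ _ "(powr)"]) simp_all
  also have "\<dots> = ?den"
    by (rule prod.reindex_bij_witness[of _ "\<lambda>j. j - 1" Suc]) auto
  finally have den: "denom \<alpha> ys = ?den" .
  have num: "(\<Prod>y\<leftarrow>ys. q powi (y - 1)) = q powr (of_int (\<Sum>j=1..k. x j)) * q ^ (k choose 2)"
    unfolding ys_def
  proof (induction k)
    case (Suc k)
    have "q powi (x (Suc k) + int k) = q powr of_int (x (Suc k)) * q ^ k"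
      using assms(1) by (simp add: power_int_add powr_real_of_int')
    moreover have "Suc k choose 2 = (k choose 2) + k" by (simp add: numeral_2_eq_2)
    ultimately show ?case using Suc by (simp add: powr_add power_add mult_ac)
  qed (use assms(1) in \<open>simp add: numeral_2_eq_2\<close>)
  have "space (mallows_product q \<alpha>) = {\<omega>. bij \<omega>}"
    unfolding mallows_product_def by (simp only: space_measure_of_conv space_perm_space)
  then have "\<P>(\<omega> in mallows_product q \<alpha>. \<forall>j\<in>{1..k}. displacement \<omega> (i + int j) = x j) =
      measure (mallows_product q \<alpha>) (disp_event k x i)"
    by (simp add: disp_event_def)
  also have "\<dots> = (1 - q) ^ k / (q ^ (k choose 2) * denom \<alpha> ys) *
      (\<Prod>y\<leftarrow>ys. q powi (y - 1)) * (\<alpha> ^ k * q powr (- (real k)\<^sup>2 / 2))"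
    unfolding measure_def product_probability[OF assms(3,5)] ys_def
    using assms denom_pos[OF assms(3), of ys]
    by (intro enn2real_ennreal mult_nonneg_nonneg divide_nonneg_nonneg prod_list_nonneg)
       (auto simp: ys_def intro: less_imp_le)
  also have "\<dots> = (1 - q) ^ k * \<alpha> ^ k *
      (q powr (of_int (\<Sum>j=1..k. x j)) * q powr (- (real k)\<^sup>2 / 2)) / ?den"
    unfolding num den using assms(1) by (simp add: field_simps)
  also have "q powr (of_int (\<Sum>j=1..k. x j)) * q powr (- (real k)\<^sup>2 / 2) =
      q powr (of_int (\<Sum>j=1..k. x j) - (real k)\<^sup>2 / 2)"
    by (simp add: powr_add[symmetric])
  finally show ?thesis .
qed

end
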